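(* For any fixed integer $k \geq 0$, \textsc{1-Edge Contraction($\gamma_t$)} is polynomial-time solvable on $(P_4+kP_3)$-free graphs.
   Context: All graphs are finite, simple and connected. $P_n$ is the path on $n$ vertices, $+$ denotes disjoint union and $kP_3$ is the disjoint union of $k$ copies of $P_3$; a graph is $H$-free if it has no induced subgraph isomorphic to $H$. A set $D\subseteq V(G)$ is a total dominating set of $G$ if every vertex of $V(G)$ has at least one neighbor in $D$; $\gamma_t(G)$ is the minimum size of a total dominating set. $G/e$ denotes the graph obtained from $G$ by contracting edge $e$ (merging its endpoints into one vertex adjacent to all former neighbors of either endpoint, without loops or multiple edges). \textsc{1-Edge Contraction($\gamma_t$)}: given a connected graph $G$, decide whether there exists an edge $e$ with $\gamma_t(G/e)\leq\gamma_t(G)-1$. *)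

theory Defs
  imports
    "Graph_Theory.Graph_Theory"
    "HOL-Library.Extended_Nat"
    "HOL-Computational_Algebra.Polynomial"
begin

section \<open>Graphs\<close>

text \<open>
  A finite simple graph is a \<open>pair_graph\<close>: a finite, symmetric, loop-free digraph without
  parallel arcs. An undirected edge \<open>uv\<close> is the pair of arcs \<open>(u, v)\<close> and \<open>(v, u)\<close>.
\<close>

definition path_graph :: "nat \<Rightarrow> nat pair_pre_digraph" where
  "path_graph n = \<lparr> pverts = {0..<n},
     parcs = {(i, j). i < n \<and> j < n \<and> (j = Suc i \<or> i = Suc j)} \<rparr>"

definition disjoint_union ::
  "'a pair_pre_digraph \<Rightarrow> 'b pair_pre_digraph \<Rightarrow> ('a + 'b) pair_pre_digraph" where
  "disjoint_union G H = \<lparr> pverts = Inl ` pverts G \<union> Inr ` pverts H,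
     parcs = {(Inl u, Inl v) | u v. (u, v) \<in> parcs G} \<union>
             {(Inr u, Inr v) | u v. (u, v) \<in> parcs H} \<rparr>"

definition copies :: "nat \<Rightarrow> 'a pair_pre_digraph \<Rightarrow> (nat \<times> 'a) pair_pre_digraph" where
  "copies k G = \<lparr> pverts = {0..<k} \<times> pverts G,
     parcs = {((i, u), (i, v)) | i u v. i < k \<and> (u, v) \<in> parcs G} \<rparr>"

definition induced_free :: "'b pair_pre_digraph \<Rightarrow> 'a pair_pre_digraph \<Rightarrow> bool" where
  "induced_free H G \<longleftrightarrow>
     \<not> (\<exists>K. induced_subgraph K (with_proj G) \<and> digraph_iso (with_proj H) K)"

definition total_dominating_set :: "'a pair_pre_digraph \<Rightarrow> 'a set \<Rightarrow> bool" where
  "total_dominating_set G D \<longleftrightarrow>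
     D \<subseteq> pverts G \<and> (\<forall>v \<in> pverts G. \<exists>u \<in> D. (v, u) \<in> parcs G)"

text \<open>
  The value is \<open>\<infinity>\<close> when no total dominating set exists. Among connected finite simple graphs
  this concerns only the one-vertex graph, which is also the contraction of the single edge
  of \<open>P\<^sub>2\<close>.
\<close>

definition total_domination_number :: "'a pair_pre_digraph \<Rightarrow> enat" where
  "total_domination_number G = (INF D \<in> {D. total_dominating_set G D}. enat (card D))"

text \<open>
  The vertex \<open>u\<close> plays the role of the vertex into which \<open>u\<close> and \<open>v\<close> are merged.
\<close>

definition contract_edge :: "'a pair_pre_digraph \<Rightarrow> 'a \<times> 'a \<Rightarrow> 'a pair_pre_digraph" where
  "contract_edge G e = (case e of (u, v) \<Rightarrow>
     let f = (\<lambda>x. if x = v then u else x) in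
     \<lparr> pverts = f ` pverts G,
       parcs = {(f x, f y) | x y. (x, y) \<in> parcs G \<and> f x \<noteq> f y} \<rparr>)"

definition one_edge_contraction_total_dom :: "'a pair_pre_digraph \<Rightarrow> bool" where
  "one_edge_contraction_total_dom G \<longleftrightarrow>
     (\<exists>e \<in> parcs G. total_domination_number (contract_edge G e) \<le> total_domination_number G - 1)"

section \<open>Polynomial time\<close>

text \<open>
  The machine model is a random access machine under the uniform cost measure, programmed
  with structured control flow. It has registers and a memory that is addressed indirectly,
  all holding natural numbers. Arithmetic is restricted to addition and truncated
  subtraction. As there is no multiplication, one step at most doubles the largest value
  present, up to the constants of the program, so numbers keep linearly many bits in the
  elapsed time and the machine is polynomially equivalent to the deterministic Turing machine.
\<close>

datatype com =
    Skip
  | Const nat nat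
  | Add nat nat nat
  | Sub nat nat nat
  | Load nat nat
  | Store nat nat
  | Seq com com
  | Cond nat com com
  | Loop nat com

type_synonym state = "(nat \<Rightarrow> nat) \<times> (nat \<Rightarrow> nat)"

text \<open>
  \<open>exec c s t s'\<close>: started in state \<open>s\<close>, the program \<open>c\<close> halts in state \<open>s'\<close> after exactly
  \<open>t\<close> steps. A state consists of the registers \<open>r\<close> and the memory \<open>m\<close>.
\<close>

inductive exec :: "com \<Rightarrow> state \<Rightarrow> nat \<Rightarrow> state \<Rightarrow> bool" where
  exec_Skip: "exec Skip s 1 s"
| exec_Const: "exec (Const x n) (r, m) 1 (r(x := n), m)"
| exec_Add: "exec (Add x y z) (r, m) 1 (r(x := r y + r z), m)"
| exec_Sub: "exec (Sub x y z) (r, m) 1 (r(x := r y - r z), m)"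
| exec_Load: "exec (Load x y) (r, m) 1 (r(x := m (r y)), m)"
| exec_Store: "exec (Store x y) (r, m) 1 (r, m(r x := r y))"
| exec_Seq: "exec c1 s t1 s' \<Longrightarrow> exec c2 s' t2 s'' \<Longrightarrow> exec (Seq c1 c2) s (t1 + t2) s''"
| exec_CondTrue: "fst s x \<noteq> 0 \<Longrightarrow> exec c1 s t s' \<Longrightarrow> exec (Cond x c1 c2) s (1 + t) s'"
| exec_CondFalse: "fst s x = 0 \<Longrightarrow> exec c2 s t s' \<Longrightarrow> exec (Cond x c1 c2) s (1 + t) s'"
| exec_LoopFalse: "fst s x = 0 \<Longrightarrow> exec (Loop x c) s 1 s"
| exec_LoopTrue: "fst s x \<noteq> 0 \<Longrightarrow> exec c s t1 s' \<Longrightarrow> exec (Loop x c) s' t2 s'' \<Longrightarrow>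
    exec (Loop x c) s (1 + t1 + t2) s''"

inductive_cases exec_SkipE: "exec Skip s t s'"
inductive_cases exec_ConstE: "exec (Const x n) s t s'"
inductive_cases exec_AddE: "exec (Add x y z) s t s'"
inductive_cases exec_SubE: "exec (Sub x y z) s t s'"
inductive_cases exec_LoadE: "exec (Load x y) s t s'"
inductive_cases exec_StoreE: "exec (Store x y) s t s'"
inductive_cases exec_SeqE: "exec (Seq c1 c2) s t s'"
inductive_cases exec_CondE: "exec (Cond x c1 c2) s t s'"
inductive_cases exec_LoopE: "exec (Loop x c) s t s'"

lemma exec_deterministic:
  "exec c s t s1 \<Longrightarrow> exec c s u s2 \<Longrightarrow> t = u \<and> s1 = s2"
proof (induction arbitrary: u s2 rule: exec.induct)
  case (exec_Seq c1 s t1 s' c2 t2 s'')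
  from exec_Seq.prems obtain v1 v2 s3
    where "u = v1 + v2" "exec c1 s v1 s3" "exec c2 s3 v2 s2" by (rule exec_SeqE)
  with exec_Seq.IH show ?case by metis
next
  case (exec_CondTrue s x c1 t s' c2)
  from exec_CondTrue.prems show ?case
    by (rule exec_CondE) (use exec_CondTrue.IH exec_CondTrue.hyps(1) in auto)
next
  case (exec_CondFalse s x c2 t s' c1)
  from exec_CondFalse.prems show ?case
    by (rule exec_CondE) (use exec_CondFalse.IH exec_CondFalse.hyps(1) in auto)
next
  case (exec_LoopFalse s x c)
  from exec_LoopFalse.prems show ?case
    by (rule exec_LoopE) (use exec_LoopFalse.hyps in auto)
next
  case (exec_LoopTrue s x c t1 s' t2 s'')
  from exec_LoopTrue.prems show ?case
  proof (rule exec_LoopE)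
    assume "fst s x = 0"
    with exec_LoopTrue.hyps(1) show ?thesis by contradiction
  next
    fix v1 s3 v2
    assume "u = Suc (v1 + v2)" "exec c s v1 s3" "exec (Loop x c) s3 v2 s2"
    with exec_LoopTrue.IH show ?thesis by (metis add_Suc plus_1_eq_Suc)
  qed
qed (auto elim: exec_SkipE exec_ConstE exec_AddE exec_SubE exec_LoadE exec_StoreE)

text \<open>
  The input bits are in the memory from address 0 on, the input length is in register 0, and
  everything else is 0. The answer is yes iff register 0 is nonzero on halting.
\<close>

definition init_state :: "bool list \<Rightarrow> state" where
  "init_state xs = ((\<lambda>_. 0)(0 := length xs),
                    (\<lambda>i. if i < length xs \<and> xs ! i then 1 else 0))"

definition accepting :: "state \<Rightarrow> bool" where
  "accepting s \<longleftrightarrow> fst s 0 \<noteq> 0"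

text \<open>
  The problem \<open>Q\<close>, with instances encoded by \<open>enc\<close>, restricted to the instances in \<open>C\<close>. Nothing
  is required of the program on other inputs.
\<close>

definition poly_time_solvable_on ::
  "('i \<Rightarrow> bool list) \<Rightarrow> ('i \<Rightarrow> bool) \<Rightarrow> 'i set \<Rightarrow> bool" where
  "poly_time_solvable_on enc Q C \<longleftrightarrow>
     (\<exists>(c :: com) (p :: nat poly). \<forall>x \<in> C. \<exists>t s.
        exec c (init_state (enc x)) t s \<and> t \<le> poly p (length (enc x)) \<and>
        (accepting s \<longleftrightarrow> Q x))"

section \<open>Graphs as inputs\<close>

text \<open>
  Input graphs have the vertices \<open>0, \<dots>, n - 1\<close>, so every finite graph is represented up to
  isomorphism, in all its labellings. They are given by the adjacency matrix, row by row.
\<close>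

definition input_graph :: "nat pair_pre_digraph \<Rightarrow> bool" where
  "input_graph G \<longleftrightarrow>
     pair_graph G \<and> connected (with_proj G) \<and> (\<exists>n. pverts G = {0..<n})"

definition adjacency_matrix :: "nat pair_pre_digraph \<Rightarrow> bool list" where
  "adjacency_matrix G =
     (let n = card (pverts G) in map (\<lambda>i. (i div n, i mod n) \<in> parcs G) [0..<n * n])"

end

theory Submission
  imports Defs
begin

text \<open>An edge contraction lowers the total domination number iff some minimum total dominating set
  contains a path \<open>P\<^sub>3\<close>, not necessarily induced (Huang and Xu). So a graph is a no-instance iff every
  total dominating set that contains a \<open>P\<^sub>3\<close> can be improved, and for a bounded total domination number
  this is a first-order property.

  Now let the minimum total dominating set \<open>D\<close> of a no-instance be large. It induces a perfect matching.
  Remove a maximal induced \<open>P\<^sub>4 + jP\<^sub>3\<close> and its neighbours. What remains are cliques, and private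
  neighbours of \<open>D\<close> in them yield many induced paths \<open>P\<^sub>3\<close> (legs), such that every vertex outside
  touches the last two vertices of at most one leg. A vertex adjacent to the first vertices of two
  legs, a hub, extends a leg to a \<open>P\<^sub>4\<close>, so it is adjacent to the first vertices of all but at most
  \<open>k\<close> legs. Without the hubs the graph is \<open>P\<^sub>4\<close>-free, each of its components costs exactly two vertices
  of \<open>D\<close>, and no set with a hub does better on a bounded number of components. Conversely, this
  suffices for a no-instance, and it is again first-order, with boundedly many vertices determining
  the hubs.

  First-order properties are decided in polynomial time by nested loops over the vertices.\<close>

section \<open>Certificates\<close>

text \<open>The obstacle is that the minimum total dominating set of a no-instance is unbounded,
  while a formula quantifies over boundedly many vertices. Local conditions suffice because a saving
  is local too. Suppose that a set with hubs has at most twice as many vertices as there are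
  components, and look at the components in which it has at most one vertex. Hubs have to help
  there, every hub suits almost all components, and two components that suit the hubs involved could
  be dominated by four vertices including a hub. So there are at most \<open>3 * c + 1\<close> such
  components, and the certificate rules out this case directly. In the other direction, all
  structure of no-instances comes from one exchange: alter a minimum total dominating set at no cost
  so that it contains a P3. The number \<open>4 * k + 10\<close> of legs serves two purposes. An
  induced P4 off the hubs meets at most 8 legs and has to leave \<open>k\<close> of them, and a hub
  must still see two legs after \<open>3 * k + 2\<close> of them are spoiled and \<open>k\<close>
  are missed.\<close>

lemma card_le_of_semicomplete:
  fixes R :: "'a set" and b :: "'a \<Rightarrow> 'a \<Rightarrow> bool"
  assumes fin: "finite R"
    and deg: "\<And>x. x \<in> R \<Longrightarrow> card {y \<in> R. b x y} \<le> c"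
    and total: "\<And>x y. x \<in> R \<Longrightarrow> y \<in> R \<Longrightarrow> x \<noteq> y \<Longrightarrow> b x y \<or> b y x"
  shows "card R \<le> 2 * c + 1"
proof (cases "R = {}")
  case False
  define S where "S = Sigma R (\<lambda>x. {y \<in> R. b x y})"
  have finS: "finite S" unfolding S_def using fin by auto
  have "card S = (\<Sum>x\<in>R. card {y \<in> R. b x y})"
    unfolding S_def using fin by (subst card_SigmaI) auto
  also have "\<dots> \<le> (\<Sum>x\<in>R. c)" by (intro sum_mono deg)
  finally have S: "card S \<le> card R * c" by simp
  have "card (Sigma R (\<lambda>x. R - {x})) = (\<Sum>x\<in>R. card (R - {x}))"
    using fin by (subst card_SigmaI) auto
  also have "\<dots> = card R * (card R - 1)" using fin by simp
  finally have P: "card (Sigma R (\<lambda>x. R - {x})) = card R * (card R - 1)" .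
  \<comment> \<open>Every ordered pair of distinct elements, or its reversal, is counted in
    \<open>S\<close>, so \<open>card R * (card R - 1)\<close> is at most
    \<open>2 * card S\<close>.\<close>
  have "Sigma R (\<lambda>x. R - {x}) \<subseteq> S \<union> prod.swap ` S"
    using total unfolding S_def by (fastforce simp: image_iff)
  then have "card (Sigma R (\<lambda>x. R - {x})) \<le> card (S \<union> prod.swap ` S)"
    using finS by (intro card_mono) auto
  also have "\<dots> \<le> card S + card S"
    by (rule order_trans[OF card_Un_le]) (simp add: card_image_le finS)
  finally have "card R * (card R - 1) \<le> card R * (2 * c)" using S P by linarith
  moreover have "0 < card R" using False fin by (simp add: card_gt_0_iff)
  ultimately show ?thesis by simp
qed simp

section \<open>Graphs as adjacency relations, and the certificate\<close>

locale sgraph =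
  fixes V :: "'a set" and E :: "'a \<Rightarrow> 'a \<Rightarrow> bool"
  assumes fin: "finite V"
    and E_V: "E x y \<Longrightarrow> x \<in> V \<and> y \<in> V"
    and sym: "E x y \<Longrightarrow> E y x"
    and irr: "\<not> E x x"
begin

definition tds :: "'a set \<Rightarrow> bool" where
  "tds D \<longleftrightarrow> D \<subseteq> V \<and> (\<forall>v\<in>V. \<exists>u\<in>D. E v u)"

definition has_p3 :: "'a set \<Rightarrow> bool" where
  "has_p3 S \<longleftrightarrow> (\<exists>x\<in>S. \<exists>y\<in>S. \<exists>z\<in>S. E x y \<and> E y z \<and> x \<noteq> z)"

text \<open>Equivalently, no minimum total dominating set contains a path on three vertices. If
  there is no total dominating set at all, this holds vacuously.\<close>

definition no_inst :: bool where
  "no_inst \<longleftrightarrow> (\<forall>D. tds D \<longrightarrow> has_p3 D \<longrightarrow> (\<exists>D'. tds D' \<and> card D' < card D))"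

definition ip3 :: "'a \<Rightarrow> 'a \<Rightarrow> 'a \<Rightarrow> bool" where
  "ip3 a b c \<longleftrightarrow> E a b \<and> E b c \<and> \<not> E a c \<and> a \<noteq> c"

definition ip4 :: "'a \<Rightarrow> 'a \<Rightarrow> 'a \<Rightarrow> 'a \<Rightarrow> bool" where
  "ip4 a b c d \<longleftrightarrow> E a b \<and> E b c \<and> E c d \<and> \<not> E a c \<and> \<not> E b d \<and> \<not> E a d"

definition anti :: "'a set \<Rightarrow> 'a set \<Rightarrow> bool" where
  "anti X Y \<longleftrightarrow> (\<forall>x\<in>X. \<forall>y\<in>Y. x \<noteq> y \<and> \<not> E x y)"

definition p4kp3_free :: "nat \<Rightarrow> bool" where
  "p4kp3_free k \<longleftrightarrow> \<not> (\<exists>a b c d p q r. ip4 a b c d \<and>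
     (\<forall>i<k. ip3 (p i) (q i) (r i) \<and> anti {a, b, c, d} {p i, q i, r i}) \<and>
     (\<forall>i<k. \<forall>j<k. i \<noteq> j \<longrightarrow> anti {p i, q i, r i} {p j, q j, r j}))"

text \<open>Distance at most two instead of connectedness, which is not first-order. Without induced
  P4 the two agree.\<close>

definition near :: "'a set \<Rightarrow> 'a \<Rightarrow> 'a \<Rightarrow> bool" where
  "near H x y \<longleftrightarrow> x \<in> V - H \<and> y \<in> V - H \<and> (x = y \<or> E x y \<or> (\<exists>w\<in>V - H. E x w \<and> E w y))"

definition far :: "'a set \<Rightarrow> 'a set \<Rightarrow> bool" where
  "far H X \<longleftrightarrow> X \<subseteq> V - H \<and> (\<forall>x\<in>X. \<forall>y\<in>X. x \<noteq> y \<longrightarrow> \<not> near H x y)"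

text \<open>The component of \<open>x\<close> suits \<open>h\<close>: the vertex \<open>h\<close>
  reaches it, and together with any one vertex that it misses there, it dominates everything in the
  component except possibly that vertex.\<close>

definition good :: "'a set \<Rightarrow> 'a \<Rightarrow> 'a \<Rightarrow> bool" where
  "good H h x \<longleftrightarrow> (\<exists>y. near H x y \<and> E h y) \<and>
     (\<forall>y z. near H x y \<longrightarrow> near H x z \<longrightarrow> \<not> E h y \<longrightarrow> \<not> E h z \<longrightarrow> y \<noteq> z \<longrightarrow> E y z)"

text \<open>The intended \<open>H\<close> leaves a graph without induced \<open>P\<^sub>4\<close>, in which \<open>near H\<close> relates the vertices of
  a component and \<open>far H\<close> sets are sets of representatives of components. Each component is then
  dominated by the ends of an edge. Since a set that uses \<open>H\<close> cannot dominate a bounded number of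
  components at the cost of two vertices each, neither can it do so for all of them. The bounds by
  constants are what makes the certificate a first-order property.\<close>

definition cert :: "'a set \<Rightarrow> nat \<Rightarrow> bool" where
  "cert H c \<longleftrightarrow> H \<subseteq> V \<and>
     (\<forall>x y z. near H x y \<longrightarrow> near H y z \<longrightarrow> near H x z) \<and>
     (\<forall>v\<in>V - H. \<exists>w\<in>V - H. E v w \<and> (\<forall>y. near H v y \<longrightarrow> E y v \<or> E y w)) \<and>
     (\<forall>h\<in>H. \<forall>X. far H X \<longrightarrow> (\<forall>x\<in>X. \<not> good H h x) \<longrightarrow> card X \<le> c) \<and>
     (\<forall>X T. far H X \<longrightarrow> X \<noteq> {} \<longrightarrow> card X \<le> 3 * c + 2 \<longrightarrow> T \<subseteq> V \<longrightarrow> card T \<le> 2 * card X \<longrightarrow>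
        T \<inter> H \<noteq> {} \<longrightarrow> (\<exists>x\<in>X. \<exists>y. near H x y \<and> (\<forall>t\<in>T. \<not> E y t))) \<and>
     (\<exists>X. far H X \<and> card X = 2 * c + 2)"

section \<open>Soundness of the certificate\<close>

lemma tds_finite: "tds D \<Longrightarrow> finite D"
  using fin finite_subset unfolding tds_def by blast

lemma near_refl: "x \<in> V - H \<Longrightarrow> near H x x" by (simp add: near_def)

lemma near_sym: "near H x y \<Longrightarrow> near H y x"
  unfolding near_def using sym by blast

lemma near_V: "near H x y \<Longrightarrow> x \<in> V - H \<and> y \<in> V - H" by (simp add: near_def)

lemma E_near: "E x y \<Longrightarrow> x \<notin> H \<Longrightarrow> y \<notin> H \<Longrightarrow> near H x y"
  using E_V by (auto simp: near_def)

text \<open>A far set that cannot be extended meets every class. Maximum size is taken so that the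
  number of classes asserted by a certificate is a lower bound for \<open>card M\<close>.\<close>

lemma far_cover:
  obtains M where "far H M" "finite M" "\<And>X. far H X \<Longrightarrow> card X \<le> card M"
    "\<And>v. v \<in> V - H \<Longrightarrow> \<exists>m\<in>M. near H m v"
proof -
  have b: "card X \<le> card V" if "far H X" for X
    using that fin unfolding far_def by (intro card_mono) auto
  have "far H {}" by (simp add: far_def)
  then obtain M where M: "far H M" "\<forall>X. far H X \<longrightarrow> card X \<le> card M"
    using ex_has_greatest_nat[of "far H" "{}" card "card V + 1"] b
    by (metis less_Suc_eq_le Suc_eq_plus1)
  have fM: "finite M" using M(1) fin unfolding far_def by (meson finite_Diff finite_subset)
  have "\<exists>m\<in>M. near H m v" if v: "v \<in> V - H" for v
  proof (rule ccontr)
    assume *: "\<not> ?thesis"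
    then have "v \<notin> M" using near_refl v by blast
    have "far H (insert v M)"
      using M(1) * v near_sym unfolding far_def by blast
    then show False using M(2) fM \<open>v \<notin> M\<close> by (metis card_insert_disjoint Suc_n_not_le_n)
  qed
  then show ?thesis using that M fM by blast
qed

lemma card_split_classes:
  assumes far: "far H M" and finM: "finite M"
    and cover: "\<And>v. v \<in> V - H \<Longrightarrow> \<exists>m\<in>M. near H m v"
    and trans: "\<And>x y z. near H x y \<Longrightarrow> near H y z \<Longrightarrow> near H x z"
    and D: "D \<subseteq> V"
  shows "card D = card (D \<inter> H) + (\<Sum>m\<in>M. card (D \<inter> {y. near H m y}))"
proof -
  have finD: "finite D" using D fin finite_subset by blast
  have eq: "D - H = (\<Union>m\<in>M. D \<inter> {y. near H m y})"
    using cover D near_V by fastforce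
  have "card (D - H) = (\<Sum>m\<in>M. card (D \<inter> {y. near H m y}))"
    unfolding eq
  proof (rule card_UN_disjoint)
    show "finite M" by fact
    show "\<forall>i\<in>M. finite (D \<inter> {y. near H i y})" using finD by auto
    show "\<forall>i\<in>M. \<forall>j\<in>M. i \<noteq> j \<longrightarrow> D \<inter> {y. near H i y} \<inter> (D \<inter> {y. near H j y}) = {}"
      using far trans near_sym unfolding far_def by blast
  qed
  moreover have "card D = card (D \<inter> H) + card (D - H)"
    using finD by (metis Int_Diff_disjoint Int_Diff_Un card_Un_disjoint finite_Diff finite_Int)
  ultimately show ?thesis by simp
qed

lemma card_ge_2: "finite S \<Longrightarrow> a \<in> S \<Longrightarrow> b \<in> S \<Longrightarrow> a \<noteq> b \<Longrightarrow> 2 \<le> card S"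
  using card_mono[of S "{a, b}"] by auto

text \<open>As \<open>D\<close> avoids \<open>H\<close>, a vertex of the class is dominated from
  within the class, and so is its dominator, by yet another vertex.\<close>

lemma tds_class_ge_2:
  assumes "tds D" "D \<inter> H = {}" "m \<in> V - H"
    and trans: "\<And>x y z. near H x y \<Longrightarrow> near H y z \<Longrightarrow> near H x z"
  shows "2 \<le> card (D \<inter> {y. near H m y})"
proof -
  obtain d where d: "d \<in> D" "E m d" using assms unfolding tds_def by blast
  obtain d' where d': "d' \<in> D" "E d d'" using assms(1) E_V[OF d(2)] unfolding tds_def by blast
  have md: "near H m d" using E_near[OF d(2)] assms(2,3) d(1) by blast
  have "near H d d'" using E_near[OF d'(2)] assms(2) d(1) d'(1) by blast
  then have "near H m d'" using trans[OF md] by blast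
  moreover have "d \<noteq> d'" using d' irr by blast
  ultimately show ?thesis using d d' md tds_finite[OF assms(1)]
    by (intro card_ge_2[of _ d d']) auto
qed

text \<open>With representatives \<open>M\<close> of the classes, \<open>2 * card M\<close> vertices
  suffice for total domination, and a total dominating set with a P3 needs more. If it avoids
  \<open>H\<close>, every class takes two of its vertices and the class of the path three. If it
  meets \<open>H\<close>, its vertices in \<open>H\<close> and in the classes with at most one
  vertex dominate those classes at a price that the certificate excludes.\<close>

theorem cert_no_inst:
  assumes cert: "cert H c"
  shows no_inst
proof -
  note c = cert[unfolded cert_def]
  have HV: "H \<subseteq> V" using c by (rule conjunct1)
  note c = c[THEN conjunct2]
  have trans: "\<And>x y z. near H x y \<Longrightarrow> near H y z \<Longrightarrow> near H x z"
    using c[THEN conjunct1] by blast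
  note c = c[THEN conjunct2]
  have pair: "\<And>v. v \<in> V - H \<Longrightarrow> \<exists>w\<in>V - H. E v w \<and> (\<forall>y. near H v y \<longrightarrow> E y v \<or> E y w)"
    using c[THEN conjunct1] by (rule bspec)
  note c = c[THEN conjunct2]
  have bad: "\<And>h X. h \<in> H \<Longrightarrow> far H X \<Longrightarrow> (\<forall>x\<in>X. \<not> good H h x) \<Longrightarrow> card X \<le> c"
    using c[THEN conjunct1] by blast
  note c = c[THEN conjunct2]
  have viol: "\<And>X T. far H X \<Longrightarrow> X \<noteq> {} \<Longrightarrow> card X \<le> 3 * c + 2 \<Longrightarrow> T \<subseteq> V \<Longrightarrow> card T \<le> 2 * card X \<Longrightarrow>
        T \<inter> H \<noteq> {} \<Longrightarrow> \<exists>x\<in>X. \<exists>y. near H x y \<and> (\<forall>t\<in>T. \<not> E y t)"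
    using c[THEN conjunct1] by (elim allE impE)
  have big: "\<exists>X. far H X \<and> card X = 2 * c + 2"
    using c[THEN conjunct2] .
  obtain M where M: "far H M" "finite M" "\<And>X. far H X \<Longrightarrow> card X \<le> card M"
    "\<And>v. v \<in> V - H \<Longrightarrow> \<exists>m\<in>M. near H m v" using far_cover by metis
  have cardM: "2 * c + 2 \<le> card M" using big M(3) by metis
  have MV: "M \<subseteq> V - H" using M(1) unfolding far_def by blast
  have far_sub: "far H X" if "X \<subseteq> M" for X using M(1) that unfolding far_def by blast
  \<comment> \<open>The vertices of the class that \<open>h0\<close> misses form a clique:
    \<open>h\<close> takes care of \<open>u\<close>, and \<open>u\<close> of all others.\<close>
  have pair_dom: "E y h0 \<or> E y h \<or> E y u"
    if "good H h0 m" "near H m u" "\<not> E h0 u" "E h u" "near H m y" for h0 h m u y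
    using that sym unfolding good_def by metis
  \<comment> \<open>Two classes against four vertices. For \<open>c = 0\<close> this needs the bound
    \<open>3 * c + 2\<close> in the certificate, as \<open>3 * c + 1\<close> would only admit one
    class.\<close>
  have pair_viol: False
    if h: "h0 \<in> H" "h \<in> H" and m: "m \<in> M" "m' \<in> M" "m \<noteq> m'"
      and T: "\<And>y. near H m y \<Longrightarrow> E y h0 \<or> E y h \<or> E y u"
        "\<And>y. near H m' y \<Longrightarrow> E y h0 \<or> E y h \<or> E y u'"
      and u: "u \<in> V" "u' \<in> V" for h0 h m m' u u'
  proof -
    have "card {h0, h, u, u'} \<le> 4" by (simp add: card_insert_if)
    then show False
      using viol[of "{m, m'}" "{h0, h, u, u'}"] far_sub[of "{m, m'}"] that HV by auto
  qed
  have single_viol: False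
    if "h \<in> H" "m \<in> M" "v \<in> V" "\<And>y. near H m y \<Longrightarrow> E y h \<or> E y v" for h m v
  proof -
    have "card {h, v} \<le> 2" by (simp add: card_insert_if)
    then show False
      using viol[of "{m}" "{h, v}"] far_sub[of "{m}"] that HV by auto
  qed
  have bad_card: "card {m \<in> M. \<not> good H h m} \<le> c" if "h \<in> H" for h
    by (rule bad[OF that]) (auto intro: far_sub)
  have "\<exists>D0. tds D0 \<and> card D0 \<le> 2 * card M"
  proof -
    \<comment> \<open>One fixed vertex of \<open>H\<close> steers the choice: with
      \<open>f m\<close> next to \<open>h0\<close> in all classes that suit \<open>h0\<close>, every
      other vertex of \<open>H\<close> is forced to see some \<open>f m\<close>.\<close>
    obtain h0 where h0: "H \<noteq> {} \<longrightarrow> h0 \<in> H" by blast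
    have "\<exists>v w. near H m v \<and> near H m w \<and> (\<forall>y. near H m y \<longrightarrow> E y v \<or> E y w) \<and> (good H h0 m \<longrightarrow> E h0 v)"
      if m: "m \<in> M" for m
    proof -
      have "near H m m" using near_refl m MV by blast
      then obtain v where v: "near H m v" "good H h0 m \<longrightarrow> E h0 v"
        unfolding good_def by blast
      obtain w where w: "w \<in> V - H" "E v w" "\<forall>y. near H v y \<longrightarrow> E y v \<or> E y w"
        using pair[of v] near_V[OF v(1)] by blast
      have "near H v w" using E_near[OF w(2)] w(1) near_V[OF v(1)] by blast
      then have "near H m w" using trans[OF v(1)] by blast
      moreover have "E y v \<or> E y w" if "near H m y" for y
        using w(3) trans[OF near_sym[OF v(1)] that] by blast
      ultimately show ?thesis using v w(2) by blast
    qed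
    then obtain f g where fg: "\<And>m. m \<in> M \<Longrightarrow> near H m (f m) \<and> near H m (g m) \<and>
        (\<forall>y. near H m y \<longrightarrow> E y (f m) \<or> E y (g m)) \<and> (good H h0 m \<longrightarrow> E h0 (f m))" by metis
    define D0 where "D0 = f ` M \<union> g ` M"
    have "card D0 \<le> card (f ` M) + card (g ` M)" unfolding D0_def by (rule card_Un_le)
    also have "\<dots> \<le> 2 * card M" using card_image_le[OF M(2), of f] card_image_le[OF M(2), of g] by simp
    finally have c: "card D0 \<le> 2 * card M" .
    have "\<exists>u\<in>D0. E v u" if v: "v \<in> V" for v
    proof (cases "v \<in> H")
      case False
      then obtain m where m: "m \<in> M" "near H m v" using M(4) v by blast
      then have "E v (f m) \<or> E v (g m)" using fg by blast
      then show ?thesis using m(1) unfolding D0_def by blast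
    next
      case True
      then have h0H: "h0 \<in> H" using h0 by blast
      show ?thesis
      proof (rule ccontr)
        assume *: "\<not> ?thesis"
        \<comment> \<open>There are at least \<open>2 * c + 2\<close> classes, and each of
          \<open>h0\<close> and \<open>v\<close> fails to suit at most \<open>c\<close>. In the two
          classes that remain, \<open>f m\<close> is missed by \<open>v\<close> but seen by
          \<open>h0\<close>.\<close>
        let ?Z = "M - {m \<in> M. \<not> good H h0 m} - {m \<in> M. \<not> good H v m}"
        have "card M - c - c \<le> card ?Z"
          using bad_card[OF h0H] bad_card[OF True] diff_card_le_card_Diff[of "{m \<in> M. \<not> good H h0 m}" M]
            diff_card_le_card_Diff[of "{m \<in> M. \<not> good H v m}" "M - {m \<in> M. \<not> good H h0 m}"] M(2)
          by fastforce
        then have "2 \<le> card ?Z" using cardM by linarith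
        then obtain m m' where mm: "m \<in> ?Z" "m' \<in> ?Z" "m \<noteq> m'"
          by (metis (no_types, lifting) One_nat_def Suc_1 card_le_Suc0_iff_eq not_less_eq_eq card.infinite le_zero_eq nat.simps(3))
        have n: "\<not> E v (f m)" "\<not> E v (f m')" using * mm unfolding D0_def by auto
        have d: "E y v \<or> E y h0 \<or> E y (f n)" if "n \<in> ?Z" "\<not> E v (f n)" "near H n y" for n y
          using pair_dom[of v n "f n" h0 y] that fg[of n] by auto
        have "f m \<in> V" "f m' \<in> V" using fg[of m] fg[of m'] mm near_V[of H] by blast+
        moreover have "m \<in> M" "m' \<in> M" using mm(1,2) by blast+
        ultimately show False
          using pair_viol[OF True h0H _ _ mm(3) d[OF mm(1) n(1)] d[OF mm(2) n(2)]] by blast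
      qed
    qed
    moreover have "D0 \<subseteq> V"
    proof -
      have "f m \<in> V" "g m \<in> V" if "m \<in> M" for m using fg[OF that] near_V[of H] by blast+
      then show ?thesis unfolding D0_def by blast
    qed
    ultimately have "tds D0" unfolding tds_def by blast
    then show ?thesis using c by blast
  qed
  then obtain D0 where D0: "tds D0" "card D0 \<le> 2 * card M" by blast
  have False if D: "tds D" "has_p3 D" "card D \<le> 2 * card M" for D
  proof -
    have DV: "D \<subseteq> V" using D(1) unfolding tds_def by blast
    have finD: "finite D" using D(1) tds_finite by blast
    define K where "K m = D \<inter> {y. near H m y}" for m
    have split: "card D = card (D \<inter> H) + (\<Sum>m\<in>M. card (K m))"
      unfolding K_def
    proof (rule card_split_classes[OF M(1,2)])
      show "\<exists>m\<in>M. near H m v" if "v \<in> V - H" for v using M(4) that .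
      show "near H x z" if "near H x y" "near H y z" for x y z using trans that .
    qed (fact DV)
    have finK: "finite (K m)" for m unfolding K_def using finD by simp
    have DH: "D \<inter> H \<noteq> {}"
    proof
      assume e: "D \<inter> H = {}"
      have ge: "2 \<le> card (K m)" if "m \<in> M" for m
        unfolding K_def
      proof (rule tds_class_ge_2[OF D(1) e])
        show "m \<in> V - H" using that MV by blast
        show "near H x z" if "near H x y" "near H y z" for x y z using trans that .
      qed
      obtain x y z where xyz: "x \<in> D" "y \<in> D" "z \<in> D" "E x y" "E y z" "x \<noteq> z"
        using D(2) unfolding has_p3_def by blast
      obtain m where m: "m \<in> M" "near H m x" using M(4)[of x] xyz e DV by blast
      have xH: "x \<notin> H" "y \<notin> H" "z \<notin> H" using xyz(1-3) e by blast+
      have xy: "near H x y" and yz: "near H y z" using E_near xyz(4,5) xH by blast+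
      have my: "near H m y" using trans[OF m(2) xy] .
      have "near H m z" using trans[OF my yz] .
      then have "{x, y, z} \<subseteq> K m" unfolding K_def using my m xyz(1-3) by blast
      moreover have "x \<noteq> y" "y \<noteq> z" using xyz(4,5) irr by blast+
      then have "card {x, y, z} = 3" using xyz(6) by simp
      ultimately have "3 \<le> card (K m)" using card_mono[OF finK] by metis
      then have "(\<Sum>m\<in>M. 2) < (\<Sum>m\<in>M. card (K m))"
        using ge m M(2) by (intro sum_strict_mono_ex1) force+
      then show False using split D(3) by simp
    qed
    then obtain h0 where h0: "h0 \<in> D" "h0 \<in> H" by blast
    define R where "R = {m \<in> M. card (K m) \<le> 1}"
    have RM: "R \<subseteq> M" "finite R" unfolding R_def using M(2) by auto
    have domK: "(\<exists>h\<in>D \<inter> H. E y h) \<or> (\<exists>v\<in>K m. E y v)" if y: "near H m y" for m y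
    proof -
      obtain d where d: "d \<in> D" "E y d" using D(1) near_V[OF y] unfolding tds_def by blast
      show ?thesis
      proof (cases "d \<in> H")
        case False
        then have "near H y d" using E_near[OF d(2)] near_V[OF y] by blast
        then have "near H m d" using trans[OF y] by blast
        then show ?thesis using d unfolding K_def by blast
      qed (use d in blast)
    qed
    define R0 where "R0 = {m \<in> R. good H h0 m}"
    \<comment> \<open>Otherwise \<open>h0\<close> and the at most one vertex in \<open>K m\<close>
      would dominate the class by themselves.\<close>
    have hub: "\<exists>h u. h \<in> D \<inter> H \<and> near H m u \<and> \<not> E h0 u \<and> E h u" if m: "m \<in> R0" for m
    proof (rule ccontr)
      assume *: "\<not> ?thesis"
      have mM: "m \<in> M" "card (K m) \<le> 1" using m unfolding R0_def R_def by auto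
      obtain v where v: "K m \<subseteq> {v}" "v \<in> V"
      proof (cases "K m = {}")
        case True
        then show ?thesis using that mM MV by blast
      next
        case False
        then obtain v where "v \<in> K m" by blast
        then have "K m = {v}" using mM(2)
          card_le_Suc0_iff_eq[OF finK[of m]] \<open>v \<in> K m\<close> by auto
        then show ?thesis using that \<open>v \<in> K m\<close> DV unfolding K_def by blast
      qed
      have "E y h0 \<or> E y v" if y: "near H m y" for y
      proof (rule ccontr)
        assume n: "\<not> ?thesis"
        then have "\<not> E h0 y" using sym by blast
        moreover obtain h where "h \<in> D \<inter> H" "E y h" using domK[OF y] n v(1) by blast
        ultimately show False using * y sym[OF \<open>E y h\<close>] by blast
      qed
      then show False using single_viol[OF h0(2) mM(1) v(2)] by blast
    qed
    obtain hh uu where hu: "\<And>m. m \<in> R0 \<Longrightarrow>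
        hh m \<in> D \<inter> H \<and> near H m (uu m) \<and> \<not> E h0 (uu m) \<and> E (hh m) (uu m)" using hub by metis
    have R0M: "R0 \<subseteq> M" "finite R0" using RM unfolding R0_def by auto
    have gR0: "good H h0 m" if "m \<in> R0" for m using that unfolding R0_def by blast
    \<comment> \<open>By \<open>inj\<close> below, neither of \<open>hh m\<close>,
      \<open>hh m'\<close> reaches the witness \<open>uu\<close> in the class of the other. If each
      suited the class of the other, these two and the two witnesses would dominate both
      classes.\<close>
    have badp: "\<not> good H (hh m') m \<or> \<not> good H (hh m) m'" if mm: "m \<in> R0" "m' \<in> R0" "m \<noteq> m'" for m m'
    proof (rule ccontr)
      assume *: "\<not> ?thesis"
      have inj: False if m12: "m1 \<in> R0" "m2 \<in> R0" "m1 \<noteq> m2" and u2: "near H m2 u2" "\<not> E h0 u2" "E (hh m1) u2" for m1 m2 u2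
      proof (rule pair_viol[of h0 "hh m1" m1 m2 "uu m1" u2])
        show "E y h0 \<or> E y (hh m1) \<or> E y (uu m1)" if "near H m1 y" for y
          using pair_dom[OF gR0[OF m12(1)] _ _ _ that] hu[OF m12(1)] by blast
        show "E y h0 \<or> E y (hh m1) \<or> E y u2" if "near H m2 y" for y
          using pair_dom[OF gR0[OF m12(2)] u2 that] .
        show "hh m1 \<in> H" "uu m1 \<in> V" "u2 \<in> V" using hu[OF m12(1)] u2(1) near_V[of H] by blast+
      qed (use h0 m12 R0M in blast)+
      have n1: "\<not> E (hh m') (uu m)"
        using inj[OF mm(2,1) mm(3)[symmetric], of "uu m"] hu[OF mm(1)] by blast
      have n2: "\<not> E (hh m) (uu m')"
        using inj[OF mm, of "uu m'"] hu[OF mm(2)] by blast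
      have g: "good H (hh m') m" "good H (hh m) m'" using * by blast+
      show False
      proof (rule pair_viol[of "hh m" "hh m'" m m' "uu m" "uu m'"])
        show "E y (hh m) \<or> E y (hh m') \<or> E y (uu m)" if "near H m y" for y
          using pair_dom[OF g(1) _ n1 _ that] hu[OF mm(1)] by blast
        show "E y (hh m) \<or> E y (hh m') \<or> E y (uu m')" if "near H m' y" for y
          using pair_dom[OF g(2) _ n2 _ that] hu[OF mm(2)] by blast
        show "hh m \<in> H" "hh m' \<in> H" using hu[OF mm(1)] hu[OF mm(2)] by blast+
        show "uu m \<in> V" "uu m' \<in> V" using hu[OF mm(1)] hu[OF mm(2)] near_V[of H] by blast+
      qed (use mm R0M in blast)+
    qed
    have "card R0 \<le> 2 * c + 1"
    proof (rule card_le_of_semicomplete[of R0 "\<lambda>m' m. \<not> good H (hh m') m"])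
      fix x assume "x \<in> R0"
      then show "card {y \<in> R0. \<not> good H (hh x) y} \<le> c"
        using hu[of x] R0M by (intro bad[of "hh x"]) (auto intro: far_sub)
    qed (use R0M badp in blast)+
    moreover have "card {m \<in> R. \<not> good H h0 m} \<le> c"
      using h0 RM by (intro bad[of h0]) (auto intro: far_sub)
    moreover have "card R \<le> card R0 + card {m \<in> R. \<not> good H h0 m}"
      by (rule order_trans[OF card_mono card_Un_le]) (use RM in \<open>auto simp: R0_def\<close>)
    ultimately have cR: "card R \<le> 3 * c + 1" by linarith
    \<comment> \<open>The classes outside \<open>R\<close> take at least two vertices each, so at
      most \<open>2 * card R\<close> vertices are left for \<open>H\<close> and the classes in
      \<open>R\<close>.\<close>
    define T where "T = (D \<inter> H) \<union> (\<Union>m\<in>R. K m)"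
    have "card T \<le> card (D \<inter> H) + card (\<Union>m\<in>R. K m)" unfolding T_def by (rule card_Un_le)
    also have "card (\<Union>m\<in>R. K m) \<le> (\<Sum>m\<in>R. card (K m))" using RM by (intro card_UN_le)
    finally have T1: "card T \<le> card (D \<inter> H) + (\<Sum>m\<in>R. card (K m))" by simp
    have s: "(\<Sum>m\<in>M. card (K m)) = (\<Sum>m\<in>M - R. card (K m)) + (\<Sum>m\<in>R. card (K m))"
      using RM M(2) by (intro sum.subset_diff)
    have "(\<Sum>m\<in>M - R. 2) \<le> (\<Sum>m\<in>M - R. card (K m))"
      unfolding R_def by (intro sum_mono) auto
    then have s2: "2 * (card M - card R) \<le> (\<Sum>m\<in>M - R. card (K m))"
      using RM by (simp add: card_Diff_subset mult.commute)
    have "card R \<le> card M" using RM M(2) card_mono by blast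
    then have cT: "card T \<le> 2 * card R" using T1 s s2 split D(3) by linarith
    moreover have "T \<inter> H \<noteq> {}" using h0 unfolding T_def by blast
    moreover have "R \<noteq> {}"
    proof
      assume "R = {}"
      then have "card T = 0" using cT by simp
      moreover have "finite T" "h0 \<in> T" unfolding T_def using finD finK RM h0 by auto
      ultimately show False by auto
    qed
    moreover have "T \<subseteq> V" unfolding T_def K_def using DV by blast
    ultimately obtain m y where "m \<in> R" "near H m y" "\<forall>t\<in>T. \<not> E y t"
      using viol[of R T] far_sub[of R] RM cR by auto
    then show False using domK unfolding T_def by blast
  qed
  then show ?thesis
    unfolding no_inst_def using D0 by (meson le_trans not_le_imp_less)
qed

end

section \<open>Graphs without induced paths on four vertices\<close>

text \<open>Distinctness is explicit because the relation may be the complement of a graph, which is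
  reflexive.\<close>

definition path4 :: "('a \<Rightarrow> 'a \<Rightarrow> bool) \<Rightarrow> 'a \<Rightarrow> 'a \<Rightarrow> 'a \<Rightarrow> 'a \<Rightarrow> bool" where
  "path4 R a b c d \<longleftrightarrow> distinct [a, b, c, d] \<and> R a b \<and> R b c \<and> R c d \<and> \<not> R a c \<and> \<not> R b d \<and> \<not> R a d"

text \<open>That is, the graph on \<open>Y\<close> or its complement is disconnected.\<close>

definition splits :: "('a \<Rightarrow> 'a \<Rightarrow> bool) \<Rightarrow> 'a set \<Rightarrow> bool" where
  "splits R Y \<longleftrightarrow> (\<exists>X Z. X \<noteq> {} \<and> Z \<noteq> {} \<and> X \<union> Z = Y \<and> X \<inter> Z = {} \<and>
     ((\<forall>x\<in>X. \<forall>z\<in>Z. R x z) \<or> (\<forall>x\<in>X. \<forall>z\<in>Z. \<not> R x z)))"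

text \<open>If \<open>v\<close> misses a vertex of \<open>X\<close> but sees a vertex
  \<open>d\<close> of \<open>Z\<close>, the vertices of \<open>X\<close> missed by \<open>v\<close>
  are separated from everything else: an edge from such an \<open>m\<close> to a neighbour
  \<open>a\<close> of \<open>v\<close> in \<open>X\<close> would give the induced path
  \<open>m\<close>, \<open>a\<close>, \<open>v\<close>, \<open>d\<close>. All other cases split off
  \<open>v\<close> alone or a whole side.\<close>

lemma splits_insert:
  assumes sym: "\<And>x y. R x y \<Longrightarrow> R y x"
    and XZ: "X \<noteq> {}" "Z \<noteq> {}" "X \<inter> Z = {}" "\<forall>x\<in>X. \<forall>z\<in>Z. \<not> R x z"
    and v: "v \<notin> X \<union> Z"
    and free: "\<And>a b c d. {a, b, c, d} \<subseteq> insert v (X \<union> Z) \<Longrightarrow> \<not> path4 R a b c d"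
  shows "splits R (insert v (X \<union> Z))"
proof -
  have main: "splits R (insert v (X \<union> Z))"
    if XZ: "X \<noteq> {}" "Z \<noteq> {}" "X \<inter> Z = {}" "\<forall>x\<in>X. \<forall>z\<in>Z. \<not> R x z" and v: "v \<notin> X \<union> Z"
      and free: "\<And>a b c d. {a, b, c, d} \<subseteq> insert v (X \<union> Z) \<Longrightarrow> \<not> path4 R a b c d"
      and c: "c \<in> X" "\<not> R v c" for X Z c
  proof (cases "\<exists>d\<in>Z. R v d")
    case False
    then have "\<forall>x\<in>Z. \<forall>z\<in>insert v X. \<not> R x z" using XZ(4) sym by blast
    moreover have "Z \<inter> insert v X = {}" "Z \<union> insert v X = insert v (X \<union> Z)" using XZ(3) v by blast+
    ultimately show ?thesis unfolding splits_def using XZ(2)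
      by (intro exI[of _ Z] exI[of _ "insert v X"]) simp
  next
    case True
    then obtain d where d: "d \<in> Z" "R v d" by blast
    define M where "M = {x \<in> X. \<not> R v x}"
    have nR: "\<not> R m a" if "m \<in> M" "a \<in> insert v (X \<union> Z) - M" for a m
    proof
      assume "R m a"
      then have am: "R a m" by (rule sym)
      have "a \<in> X" "R v a" using that XZ am sym[OF am] unfolding M_def by blast+
      then have "path4 R m a v d"
        unfolding path4_def using am that d XZ v sym[of m v] sym[of v a] sym[of a m]
        unfolding M_def by auto
      then show False using free[of m a v d] \<open>a \<in> X\<close> that d unfolding M_def by blast
    qed
    have "c \<in> M" "d \<in> insert v (X \<union> Z) - M" "M \<subseteq> X"
      using c d XZ(3) unfolding M_def by blast+
    moreover have "M \<union> (insert v (X \<union> Z) - M) = insert v (X \<union> Z)" using \<open>M \<subseteq> X\<close> by blast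
    moreover have "M \<inter> (insert v (X \<union> Z) - M) = {}" by blast
    moreover have "\<forall>x\<in>M. \<forall>z\<in>insert v (X \<union> Z) - M. \<not> R x z" using nR by blast
    moreover have "M \<noteq> {}" "insert v (X \<union> Z) - M \<noteq> {}" using \<open>c \<in> M\<close> \<open>d \<in> insert v (X \<union> Z) - M\<close> by blast+
    ultimately show ?thesis unfolding splits_def
      by (intro exI[of _ M] exI[of _ "insert v (X \<union> Z) - M"]) simp
  qed
  show ?thesis
  proof (cases "\<forall>c\<in>X \<union> Z. R v c")
    case True
    moreover have "{v} \<inter> (X \<union> Z) = {}" "{v} \<union> (X \<union> Z) = insert v (X \<union> Z)" "X \<union> Z \<noteq> {}"
      using XZ(1) v by blast+
    ultimately show ?thesis unfolding splits_def
      by (intro exI[of _ "{v}"] exI[of _ "X \<union> Z"]) simp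
  next
    case False
    then obtain c where c: "c \<in> X \<or> c \<in> Z" "\<not> R v c" by blast
    have "Z \<inter> X = {}" "\<forall>x\<in>Z. \<forall>z\<in>X. \<not> R x z" "v \<notin> Z \<union> X" using XZ v sym by blast+
    then show ?thesis
    proof (cases "c \<in> X")
      case True
      then show ?thesis using main[OF XZ v free True c(2)] by blast
    next
      case False
      then have "c \<in> Z" using c(1) by blast
      have "Z \<union> X = X \<union> Z" by blast
      then show ?thesis
        using main[of Z X c, OF XZ(2,1) \<open>Z \<inter> X = {}\<close> \<open>\<forall>x\<in>Z. \<forall>z\<in>X. \<not> R x z\<close> \<open>v \<notin> Z \<union> X\<close> _ \<open>c \<in> Z\<close> c(2)]
          free by simp
    qed
  qed
qed

text \<open>The complement of a path on four vertices is again one, so the induction step need only treat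
  one of the two kinds of splitting.\<close>

lemma splits_complement: "splits (\<lambda>x y. \<not> R x y) Y \<longleftrightarrow> splits R Y"
  unfolding splits_def by auto

text \<open>Known as Seinsche's theorem on cographs; by induction on the number of vertices.\<close>

lemma path4_free_splits:
  assumes "finite Y" "2 \<le> card Y" and sym: "\<And>x y. R x y \<Longrightarrow> R y x"
    and "\<And>a b c d. {a, b, c, d} \<subseteq> Y \<Longrightarrow> \<not> path4 R a b c d"
  shows "splits R Y"
  using assms(1,2,4)
proof (induction Y rule: finite_induct)
  case (insert v Y)
  show ?case
  proof (cases "2 \<le> card Y")
    case True
    have "splits R Y" using insert.IH[OF True] insert.prems(2) by blast
    then obtain X Z where XZ: "X \<noteq> {}" "Z \<noteq> {}" "X \<union> Z = Y" "X \<inter> Z = {}"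
      and alt: "(\<forall>x\<in>X. \<forall>z\<in>Z. R x z) \<or> (\<forall>x\<in>X. \<forall>z\<in>Z. \<not> R x z)"
      unfolding splits_def by blast
    have vXZ: "v \<notin> X \<union> Z" using XZ insert.hyps by simp
    from alt show ?thesis
    proof
      assume "\<forall>x\<in>X. \<forall>z\<in>Z. \<not> R x z"
      then have "splits R (insert v (X \<union> Z))"
        using XZ vXZ insert.prems(2) sym by (intro splits_insert) auto
      then show ?thesis using XZ by simp
    next
      assume *: "\<forall>x\<in>X. \<forall>z\<in>Z. R x z"
      have "\<not> path4 (\<lambda>x y. \<not> R x y) a b c d" if "{a, b, c, d} \<subseteq> insert v (X \<union> Z)" for a b c d
      proof
        assume p: "path4 (\<lambda>x y. \<not> R x y) a b c d"
        \<comment> \<open>The three non-edges of the path \<open>a\<close>, \<open>b\<close>,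
          \<open>c\<close>, \<open>d\<close> in the complement form this path.\<close>
        have "path4 R c a d b"
          using p sym[of a c] sym[of c d] sym[of a b] sym[of c b] sym[of b d] sym[of d b]
          unfolding path4_def by auto
        then show False using insert.prems(2)[of c a d b] that XZ(3) by blast
      qed
      then have "splits (\<lambda>x y. \<not> R x y) (insert v (X \<union> Z))"
        using XZ vXZ sym * by (intro splits_insert) auto
      then show ?thesis using XZ splits_complement by metis
    qed
  next
    case False
    then have "card Y = 1" using insert by simp
    then obtain u where u: "Y = {u}" using card_1_singletonE by blast
    then show ?thesis unfolding splits_def using insert.hyps
      by (intro exI[of _ "{v}"] exI[of _ "{u}"]) auto
  qed
qed simp

section \<open>Components without induced paths on four vertices\<close>

context sgraph begin

text \<open>Connectedness as the absence of a closed proper part, so that every use obtains an edge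
  leaving a given set.\<close>

definition conn :: "'a set \<Rightarrow> bool" where
  "conn Y \<longleftrightarrow> (\<forall>X. X \<subseteq> Y \<longrightarrow> X \<noteq> {} \<longrightarrow> X \<noteq> Y \<longrightarrow> (\<exists>x\<in>X. \<exists>y\<in>Y - X. E x y))"

lemma path4_ip4: "path4 E a b c d \<Longrightarrow> ip4 a b c d"
  unfolding path4_def ip4_def by simp

lemma conn_join:
  assumes "finite Y" "2 \<le> card Y" "conn Y" "\<And>a b c d. {a, b, c, d} \<subseteq> Y \<Longrightarrow> \<not> ip4 a b c d"
  obtains X Z where "X \<noteq> {}" "Z \<noteq> {}" "X \<union> Z = Y" "X \<inter> Z = {}" "\<And>x z. x \<in> X \<Longrightarrow> z \<in> Z \<Longrightarrow> E x z"
proof -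
  have "splits E Y"
  proof (rule path4_free_splits[OF assms(1,2)])
    show "E y x" if "E x y" for x y using that by (rule sym)
    show "\<not> path4 E a b c d" if "{a, b, c, d} \<subseteq> Y" for a b c d
      using assms(4)[OF that] path4_ip4 by blast
  qed
  then obtain X Z where XZ: "X \<noteq> {}" "Z \<noteq> {}" "X \<union> Z = Y" "X \<inter> Z = {}"
    and alt: "(\<forall>x\<in>X. \<forall>z\<in>Z. E x z) \<or> (\<forall>x\<in>X. \<forall>z\<in>Z. \<not> E x z)"
    unfolding splits_def by blast
  have "X \<subseteq> Y" "X \<noteq> Y" "Y - X = Z" using XZ by auto
  then have "\<exists>x\<in>X. \<exists>z\<in>Z. E x z" using assms(3) XZ(1) unfolding conn_def by metis
  then show ?thesis using alt XZ that by blast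
qed

text \<open>If one more edge led to distance three, the walk \<open>x\<close>, \<open>w\<close>,
  \<open>y\<close>, \<open>z\<close> would be an induced P4. So distance two exhausts a
  component.\<close>

lemma near_trans:
  assumes free: "\<And>a b c d. {a, b, c, d} \<subseteq> V - H \<Longrightarrow> \<not> ip4 a b c d"
    and "near H x y" "near H y z"
  shows "near H x z"
proof -
  have step: "near H x z" if xy: "near H x y" and yz: "E y z" and z: "z \<in> V - H" for x y z
  proof -
    have V: "x \<in> V - H" "y \<in> V - H" using near_V[OF xy] by auto
    consider "x = y" | "E x y" | w where "w \<in> V - H" "E x w" "E w y"
      using xy unfolding near_def by blast
    then show ?thesis
    proof cases
      case 3
      then show ?thesis
        using free[of x w y z] V z yz unfolding near_def ip4_def by blast
    qed (use V z yz in \<open>auto simp: near_def\<close>)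
  qed
  consider "y = z" | "E y z" | w where "w \<in> V - H" "E y w" "E w z"
    using assms(3) unfolding near_def by blast
  then show ?thesis
  proof cases
    case 3
    then show ?thesis using step[OF step[OF assms(2)], of w z] near_V[OF assms(3)] by blast
  qed (use assms step near_V[OF assms(3)] in auto)
qed

text \<open>A component is connected, so of the two kinds of splitting only the complete join is
  possible.\<close>

lemma class_join:
  assumes free: "\<And>a b c d. {a, b, c, d} \<subseteq> V - H \<Longrightarrow> \<not> ip4 a b c d"
    and xy: "near H x y" "x \<noteq> y"
  obtains X Z where "X \<noteq> {}" "Z \<noteq> {}" "X \<union> Z = {y. near H x y}" "X \<inter> Z = {}"
    "\<And>x z. x \<in> X \<Longrightarrow> z \<in> Z \<Longrightarrow> E x z"
proof (rule conn_join[of "{y. near H x y}"])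
  have sub: "{y. near H x y} \<subseteq> V - H" using near_V[of H x] by blast
  show f: "finite {y. near H x y}" using sub fin finite_subset by blast
  have xx: "near H x x" using near_refl near_V[OF xy(1)] by blast
  show "2 \<le> card {y. near H x y}" using card_ge_2[OF f, of x y] xx xy by auto
  show "\<not> ip4 a b c d" if "{a, b, c, d} \<subseteq> {y. near H x y}" for a b c d
    using free[of a b c d] that sub by blast
  show "conn {y. near H x y}"
    unfolding conn_def
  proof (intro allI impI)
    fix X assume X: "X \<subseteq> {y. near H x y}" "X \<noteq> {}" "X \<noteq> {y. near H x y}"
    then obtain u v where u: "u \<in> X" and v: "near H x v" "v \<notin> X" by blast
    have xu: "near H x u" using X u by blast
    have uv: "near H u v" using near_trans[OF free near_sym[OF xu] v(1)] .
    then consider "E u v" | w where "w \<in> V - H" "E u w" "E w v"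
      using u v unfolding near_def by blast
    then show "\<exists>x'\<in>X. \<exists>y\<in>{y. near H x y} - X. E x' y"
    proof cases
      case 2
      have "near H u w" using E_near[OF 2(2)] 2(1) near_V[OF uv] by blast
      then have "near H x w" using near_trans[OF free xu] by blast
      then show ?thesis using 2 u v by blast
    qed (use u v in blast)
  qed
qed (use that in blast)

text \<open>In the join, each side is seen entirely by every vertex of the other side; so any vertex
  of the opposite side is a partner for \<open>x\<close>.\<close>

lemma class_pair:
  assumes free: "\<And>a b c d. {a, b, c, d} \<subseteq> V - H \<Longrightarrow> \<not> ip4 a b c d"
    and xy: "near H x y" "x \<noteq> y"
  shows "\<exists>w\<in>V - H. E x w \<and> (\<forall>y. near H x y \<longrightarrow> E y x \<or> E y w)"
proof -
  obtain X Z where XZ: "X \<noteq> {}" "Z \<noteq> {}" "X \<union> Z = {y. near H x y}" "X \<inter> Z = {}"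
    and join: "\<And>x z. x \<in> X \<Longrightarrow> z \<in> Z \<Longrightarrow> E x z"
    using class_join[OF free xy] by metis
  have sub: "{y. near H x y} \<subseteq> V - H" using near_V[of H x] by blast
  have xx: "near H x x" using near_refl near_V[OF xy(1)] by blast
  obtain x0 z0 where x0: "x0 \<in> X" "z0 \<in> Z" using XZ by blast
  then have V: "x0 \<in> V - H" "z0 \<in> V - H" using XZ(3) sub by blast+
  show ?thesis
  proof (cases "x \<in> X")
    case True
    then show ?thesis using XZ(3) join sym x0 V by (intro bexI[of _ z0]) blast+
  next
    case False
    then have "x \<in> Z" using xx XZ(3) by blast
    then show ?thesis using XZ(3) join sym x0 V by (intro bexI[of _ x0]) blast+
  qed
qed

text \<open>The form in which the excluded subgraph is used: the P3 may be indexed by any set with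
  at least \<open>k\<close> elements, such as legs or components.\<close>

lemma p4kp3_freeD:
  assumes free: "p4kp3_free k" and p4: "ip4 a b c d" and J: "finite J" "k \<le> card J"
    and P: "\<And>i. i \<in> J \<Longrightarrow> ip3 (p i) (q i) (r i)"
    and A: "\<And>i. i \<in> J \<Longrightarrow> anti {a, b, c, d} {p i, q i, r i}"
    and PP: "\<And>i j. i \<in> J \<Longrightarrow> j \<in> J \<Longrightarrow> i \<noteq> j \<Longrightarrow> anti {p i, q i, r i} {p j, q j, r j}"
  shows False
proof -
  obtain J' where J': "J' \<subseteq> J" "card J' = k" "finite J'"
    using obtain_subset_with_card_n[OF J(2)] by metis
  then obtain f where f: "bij_betw f {0..<k} J'" using ex_bij_betw_nat_finite by metis
  have fJ: "f i \<in> J" if "i < k" for i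
    using f that J' unfolding bij_betw_def by auto
  have fi: "f i \<noteq> f j" if "i < k" "j < k" "i \<noteq> j" for i j
    using f that unfolding bij_betw_def inj_on_def by auto
  show False
    using free unfolding p4kp3_free_def
  proof (rule notE, intro exI conjI allI impI)
    show "ip4 a b c d" by fact
    show "ip3 ((p \<circ> f) i) ((q \<circ> f) i) ((r \<circ> f) i)" if "i < k" for i
      using P[OF fJ[OF that]] by simp
    show "anti {a, b, c, d} {(p \<circ> f) i, (q \<circ> f) i, (r \<circ> f) i}" if "i < k" for i
      using A[OF fJ[OF that]] by simp
    show "anti {(p \<circ> f) i, (q \<circ> f) i, (r \<circ> f) i} {(p \<circ> f) j, (q \<circ> f) j, (r \<circ> f) j}"
      if "i < k" "j < k" "i \<noteq> j" for i j
      using PP[OF fJ[OF that(1)] fJ[OF that(2)] fi[OF that]] by simp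
  qed
qed

end

section \<open>Hubs\<close>

lemma card_le_1I:
  assumes "\<And>x y. x \<in> S \<Longrightarrow> y \<in> S \<Longrightarrow> x = y"
  shows "card S \<le> 1"
proof (cases "finite S")
  case True
  then show ?thesis using assms card_le_Suc0_iff_eq[OF True] by simp
qed simp

context sgraph begin

definition touch :: "'a \<Rightarrow> 'a \<Rightarrow> 'a \<Rightarrow> bool" where
  "touch v z y \<longleftrightarrow> v = z \<or> v = y \<or> E v z \<or> E v y"

lemma anti_insert: "anti (insert x X) Y \<longleftrightarrow> anti {x} Y \<and> anti X Y"
  unfolding anti_def by blast

lemma has_p3I: "x \<in> S \<Longrightarrow> y \<in> S \<Longrightarrow> w \<in> S \<Longrightarrow> E x y \<Longrightarrow> E y w \<Longrightarrow> x \<noteq> w \<Longrightarrow> has_p3 S"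
  unfolding has_p3_def by blast

end

text \<open>Only the first vertices \<open>b i\<close> of different legs may have common neighbours.
  The condition \<open>attached\<close> yields two vertices of \<open>D\<close> in the component of
  a leg after the hubs are removed: a hub sees two first vertices, whereas these two see none of
  another leg.\<close>

locale leg_family = sgraph V E for V :: "'a set" and E +
  fixes k :: nat and J :: "'i set" and b z y :: "'i \<Rightarrow> 'a" and D :: "'a set"
  assumes no: no_inst
    and free: "p4kp3_free k"
    and conn: "conn V"
    and D: "tds D" "\<And>D'. tds D' \<Longrightarrow> card D \<le> card D'"
    and J: "finite J" "4 * k + 10 \<le> card J"
    and leg: "\<And>i. i \<in> J \<Longrightarrow> ip3 (b i) (z i) (y i)"
    and b_indep: "\<And>i j. i \<in> J \<Longrightarrow> j \<in> J \<Longrightarrow> i \<noteq> j \<Longrightarrow> b i \<noteq> b j \<and> \<not> E (b i) (b j)"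
    and touch1: "\<And>v i j. i \<in> J \<Longrightarrow> j \<in> J \<Longrightarrow> touch v (z i) (y i) \<Longrightarrow> touch v (z j) (y j) \<Longrightarrow> i = j"
    and attached: "\<And>i. i \<in> J \<Longrightarrow> \<exists>d\<in>D. \<exists>d'\<in>D. d \<noteq> d' \<and>
      (\<forall>d\<in>{d, d'}. (d = z i \<or> d = b i \<or> E d (z i) \<or> E d (b i)) \<and> (\<forall>j\<in>J. j \<noteq> i \<longrightarrow> \<not> E d (b j)))"
begin

text \<open>As \<open>P\<^sub>4 + kP\<^sub>3\<close> is excluded, a hub misses at most \<open>k\<close> of the vertices \<open>b i\<close>, so that all hubs are
  found from any \<open>4 * k + 10\<close> of them.\<close>

definition H :: "'a set" where
  "H = {h \<in> V. \<exists>i\<in>J. \<exists>j\<in>J. i \<noteq> j \<and> E h (b i) \<and> E h (b j)}"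

section \<open>How a vertex meets the legs\<close>

lemma leg_E:
  assumes "i \<in> J"
  shows "E (b i) (z i)" "E (z i) (y i)" "\<not> E (b i) (y i)" "b i \<noteq> y i"
    "E (z i) (b i)" "E (y i) (z i)" "\<not> E (y i) (b i)"
  using leg[OF assms] sym[of "b i" "z i"] sym[of "z i" "y i"] sym[of "y i" "b i"] unfolding ip3_def by blast+

lemma leg_V: "i \<in> J \<Longrightarrow> b i \<in> V \<and> z i \<in> V \<and> y i \<in> V"
  using leg_E(1,2)[of i] E_V[of "b i" "z i"] E_V[of "z i" "y i"] by blast

lemma touch_leg:
  assumes "i \<in> J"
  shows "touch (b i) (z i) (y i)" "touch (z i) (z i) (y i)" "touch (y i) (z i) (y i)"
  using leg_E[OF assms] unfolding touch_def by auto

lemma E_zb: "i \<in> J \<Longrightarrow> j \<in> J \<Longrightarrow> E (z i) (b j) \<Longrightarrow> i = j"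
  using touch1[of i j "b j"] touch_leg(1)[of j] sym[of "z i" "b j"] unfolding touch_def by blast

lemma E_yb: "i \<in> J \<Longrightarrow> j \<in> J \<Longrightarrow> \<not> E (y i) (b j)"
  using touch1[of i j "b j"] touch_leg(1)[of j] sym[of "y i" "b j"] leg_E(7)[of i] unfolding touch_def by blast

lemma E_bb: "i \<in> J \<Longrightarrow> j \<in> J \<Longrightarrow> \<not> E (b i) (b j)"
  using b_indep irr by metis

lemma anti_legs:
  assumes ij: "i \<in> J" "j \<in> J" "i \<noteq> j"
  shows "anti {b i, z i, y i} {b j, z j, y j}"
proof -
  have nt: "\<not> touch v (z j) (y j)" if "v \<in> {b i, z i, y i}" for v
    using touch1[OF ij(1,2), of v] touch_leg[OF ij(1)] ij(3) that by auto
  have "v \<noteq> b j" if "v \<in> {b i, z i, y i}" for v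
    using nt[OF that] touch_leg(1)[OF ij(2)] by auto
  moreover have "\<not> E v (b j)" if "v \<in> {b i, z i, y i}" for v
    using that E_bb[OF ij(1,2)] E_zb[OF ij(1,2)] E_yb[OF ij(1,2)] ij(3) by auto
  ultimately show ?thesis using nt unfolding anti_def touch_def by blast
qed

lemma untouched_anti:
  assumes "i \<in> J" "\<not> E v (b i)" "\<not> touch v (z i) (y i)"
  shows "anti {v} {b i, z i, y i}"
proof -
  have "v \<noteq> b i" using assms touch_leg by auto
  then show ?thesis using assms unfolding anti_def touch_def by auto
qed

lemma card_touch: "card {i \<in> J. touch v (z i) (y i)} \<le> 1"
proof (rule card_le_1I)
  fix i j assume "i \<in> {i \<in> J. touch v (z i) (y i)}" "j \<in> {i \<in> J. touch v (z i) (y i)}"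
  then show "i = j" using touch1[of i j v] by blast
qed

text \<open>Of two legs whose first vertices the hub sees, it touches the last two vertices of at
  most one. The other leg becomes an induced P4 by adding the hub.\<close>

lemma hub_p4:
  assumes "h \<in> H"
  obtains i where "i \<in> J" "E h (b i)" "ip4 (y i) (z i) (b i) h"
proof -
  obtain i where i: "i \<in> J" "E h (b i)" "\<not> touch h (z i) (y i)"
    using assms touch1[of _ _ h] unfolding H_def by blast
  then have "ip4 (y i) (z i) (b i) h"
    using leg_E[OF i(1)] sym[OF i(2)] sym[of "z i" h] sym[of "y i" h] unfolding ip4_def touch_def by blast
  then show ?thesis using that i by blast
qed

lemma hub_adj:
  assumes h: "h \<in> H"
  shows "card {j \<in> J. \<not> E h (b j)} \<le> k"
proof (rule ccontr)
  assume *: "\<not> ?thesis"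
  obtain i where i: "i \<in> J" "E h (b i)" "ip4 (y i) (z i) (b i) h" using hub_p4[OF h] .
  let ?S = "{j \<in> J. \<not> E h (b j)}" and ?T = "{j \<in> J. touch h (z j) (y j)}"
  have "card ?S - card ?T \<le> card (?S - ?T)"
    using J(1) by (intro diff_card_le_card_Diff) auto
  \<comment> \<open>One leg is given up because the hub may touch its last two vertices; hence more
    than \<open>k\<close> missed legs are assumed for the contradiction.\<close>
  then have k: "k \<le> card (?S - ?T)" using * card_touch[of h] by linarith
  show False
  proof (rule p4kp3_freeD[OF free i(3) _ k])
    show "finite (?S - ?T)" using J(1) by simp
    show "ip3 (b j) (z j) (y j)" if "j \<in> ?S - ?T" for j using leg that by blast
    show "anti {y i, z i, b i, h} {b j, z j, y j}" if j: "j \<in> ?S - ?T" for j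
    proof -
      have "i \<noteq> j" using i j by blast
      then have "anti {b i, z i, y i} {b j, z j, y j}" using anti_legs[OF i(1)] j by blast
      moreover have "anti {h} {b j, z j, y j}" using j by (intro untouched_anti) auto
      ultimately show ?thesis unfolding anti_def by blast
    qed
    show "anti {b i, z i, y i} {b j, z j, y j}" if "i \<in> ?S - ?T" "j \<in> ?S - ?T" "i \<noteq> j" for i j
      using anti_legs that by blast
  qed
qed

text \<open>One leg may be met at its first vertex, since seeing two first vertices makes a hub, and
  one at its last two vertices.\<close>

lemma card_nonhub:
  assumes "v \<in> V - H"
  shows "card {j \<in> J. \<not> anti {v} {b j, z j, y j}} \<le> 2"
proof -
  have "card {j \<in> J. E v (b j)} \<le> 1"
    by (rule card_le_1I) (use assms in \<open>auto simp: H_def\<close>)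
  moreover have "{j \<in> J. \<not> anti {v} {b j, z j, y j}} \<subseteq>
      {j \<in> J. E v (b j)} \<union> {j \<in> J. touch v (z j) (y j)}"
    using untouched_anti by blast
  then have "card {j \<in> J. \<not> anti {v} {b j, z j, y j}} \<le>
      card {j \<in> J. E v (b j)} + card {j \<in> J. touch v (z j) (y j)}"
    using J(1) by (intro order_trans[OF card_mono card_Un_le]) auto
  ultimately show ?thesis using card_touch[of v] by linarith
qed

text \<open>Four vertices outside \<open>H\<close> meet at most eight legs, so at least
  \<open>k\<close> of the \<open>4 * k + 10\<close> legs are anticomplete to the path.\<close>

lemma p4_free_off_H:
  assumes sub: "{p, q, r, s} \<subseteq> V - H"
  shows "\<not> ip4 p q r s"
proof
  assume p4: "ip4 p q r s"
  define N where "N v = {j \<in> J. \<not> anti {v} {b j, z j, y j}}" for v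
  let ?U = "N p \<union> N q \<union> N r \<union> N s"
  have N2: "card (N v) \<le> 2" if "v \<in> V - H" for v
    unfolding N_def by (rule card_nonhub[OF that])
  have "p \<in> V - H" "q \<in> V - H" "r \<in> V - H" "s \<in> V - H" using sub by simp_all
  note this[THEN N2]
  then have U: "card ?U \<le> 8"
    using card_Un_le[of "N p" "N q"] card_Un_le[of "N p \<union> N q" "N r"] card_Un_le[of "N p \<union> N q \<union> N r" "N s"]
    by linarith
  have "finite ?U" using J(1) unfolding N_def by simp
  then have "card J - card ?U \<le> card (J - ?U)" by (rule diff_card_le_card_Diff)
  then have k: "k \<le> card (J - ?U)" using J(2) U by linarith
  show False
  proof (rule p4kp3_freeD[OF free p4 _ k])
    show "finite (J - ?U)" using J(1) by simp
    show "ip3 (b j) (z j) (y j)" if "j \<in> J - ?U" for j using leg that by simp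
    show "anti {p, q, r, s} {b j, z j, y j}" if j: "j \<in> J - ?U" for j
    proof -
      have nN: "anti {v} {b j, z j, y j}" if "j \<in> J - N v" for v
        using that unfolding N_def by blast
      show ?thesis
        unfolding anti_insert[of p "{q, r, s}"] anti_insert[of q "{r, s}"] anti_insert[of r "{s}"]
        by (intro conjI nN) (use j in blast)+
    qed
    show "anti {b i, z i, y i} {b j, z j, y j}" if "i \<in> J - ?U" "j \<in> J - ?U" "i \<noteq> j" for i j
      using anti_legs[of i j] that by simp
  qed
qed

section \<open>Components of the graph without the hubs\<close>

lemma trans: "near H u v \<Longrightarrow> near H v w \<Longrightarrow> near H u w"
  by (rule near_trans[OF p4_free_off_H])

lemma b_nonhub: "i \<in> J \<Longrightarrow> b i \<in> V - H"
proof
  assume i: "i \<in> J"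
  show "b i \<in> V" using leg_V[OF i] by blast
  show "b i \<notin> H"
  proof
    assume "b i \<in> H"
    then obtain j where "j \<in> J" "E (b i) (b j)" unfolding H_def by blast
    then show False using E_bb[OF i] by blast
  qed
qed

text \<open>First vertices of different legs are not adjacent, and a common neighbour of them is a
  hub.\<close>

lemma b_far: "i \<in> J \<Longrightarrow> j \<in> J \<Longrightarrow> near H (b i) (b j) \<Longrightarrow> i = j"
proof (rule ccontr)
  assume ij: "i \<in> J" "j \<in> J" "near H (b i) (b j)" "i \<noteq> j"
  then obtain w where w: "w \<in> V - H" "E (b i) w" "E w (b j)"
    using b_indep[OF ij(1,2,4)] unfolding near_def by blast
  then show False using ij sym[OF w(2)] unfolding H_def by blast
qed

lemma class_ge_2:
  assumes i: "i \<in> J"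
  shows "2 \<le> card (D \<inter> {x. near H (b i) x})"
proof -
  have zH: "z i \<notin> H" using E_zb[OF i] unfolding H_def by blast
  have bH: "b i \<notin> H" using b_nonhub[OF i] by blast
  have bz: "near H (b i) (z i)" using E_near[OF leg_E(1)[OF i] bH zH] .
  have att: "near H (b i) d"
    if d: "d \<in> D" "d = z i \<or> d = b i \<or> E d (z i) \<or> E d (b i)" "\<forall>j\<in>J. j \<noteq> i \<longrightarrow> \<not> E d (b j)" for d
  proof -
    have dH: "d \<notin> H"
    proof
      assume "d \<in> H"
      then obtain j j' where "j \<in> J" "j' \<in> J" "j \<noteq> j'" "E d (b j)" "E d (b j')" unfolding H_def by blast
      then show False using d(3) by metis
    qed
    consider "d = z i" | "d = b i" | "E (z i) d" | "E (b i) d" using d(2) sym by blast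
    then show ?thesis
    proof cases
      case 2
      then show ?thesis using near_refl[of "b i" H] b_nonhub[OF i] by simp
    next
      case 3
      then show ?thesis using trans[OF bz E_near[OF 3 zH dH]] by blast
    qed (use bz E_near[of "b i" d H] bH dH in blast)+
  qed
  obtain d d' where "d \<in> D" "d' \<in> D" "d \<noteq> d'" "near H (b i) d" "near H (b i) d'"
    using attached[OF i] att by blast
  then show ?thesis using card_ge_2[of "D \<inter> {x. near H (b i) x}" d d'] tds_finite[OF D(1)] by blast
qed

section \<open>Exchanging the vertices of the minimum set inside the components\<close>

lemma no_p3: "tds D' \<Longrightarrow> card D' \<le> card D \<Longrightarrow> \<not> has_p3 D'"
proof
  assume D': "tds D'" "card D' \<le> card D" "has_p3 D'"
  then obtain D'' where "tds D''" "card D'' < card D'" using no unfolding no_inst_def by blast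
  then show False using D(2)[of D''] D'(2) by simp
qed

lemma class_near_pair:
  assumes "near H m v" "near H m v'" "v \<noteq> v'" "near H m u"
  shows "\<exists>w. near H m w \<and> (\<forall>x. near H m x \<longrightarrow> E x u \<or> E x w)"
proof -
  have "\<exists>v. near H u v \<and> u \<noteq> v" using assms trans[OF near_sym[OF assms(4)]] by metis
  then obtain v where "near H u v" "u \<noteq> v" by blast
  then obtain w where w: "w \<in> V - H" "E u w" "\<forall>x. near H u x \<longrightarrow> E x u \<or> E x w"
    using class_pair[of H u v] p4_free_off_H by blast
  have "near H u w" using E_near[OF w(2)] w(1) near_V[OF assms(4)] by blast
  then have "near H m w" using trans[OF assms(4)] by blast
  moreover have "E x u \<or> E x w" if "near H m x" for x
    using w(3) trans[OF near_sym[OF assms(4)] that] by blast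
  ultimately show ?thesis by blast
qed

text \<open>The vertices \<open>f m\<close> and \<open>g m\<close> are a new pair for the class of
  \<open>m\<close>. Where a leg starts, \<open>f m\<close> is its first vertex, so that swapping in
  the pairs provides neighbours for the hubs. The guard is there because two vertices of
  \<open>D\<close> in every class are only known once \<open>D\<close> is known to avoid the
  hubs.\<close>

definition class_reps :: "'a set \<Rightarrow> ('a \<Rightarrow> 'a) \<Rightarrow> ('a \<Rightarrow> 'a) \<Rightarrow> bool" where
  "class_reps M f g \<longleftrightarrow> far H M \<and> (\<forall>v\<in>V - H. \<exists>m\<in>M. near H m v) \<and>
     (\<forall>m\<in>M. 2 \<le> card (D \<inter> {x. near H m x}) \<longrightarrow>
       near H m (f m) \<and> near H m (g m) \<and> (\<forall>x. near H m x \<longrightarrow> E x (f m) \<or> E x (g m))) \<and>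
     (\<forall>m\<in>M. \<forall>i\<in>J. near H m (b i) \<longrightarrow> f m = b i)"

lemma class_repsD:
  assumes "class_reps M f g"
  shows "far H M" "finite M" "\<And>v. v \<in> V - H \<Longrightarrow> \<exists>m\<in>M. near H m v"
    "\<And>m. m \<in> M \<Longrightarrow> 2 \<le> card (D \<inter> {x. near H m x}) \<Longrightarrow>
      near H m (f m) \<and> near H m (g m) \<and> (\<forall>x. near H m x \<longrightarrow> E x (f m) \<or> E x (g m))"
    "\<And>m i. m \<in> M \<Longrightarrow> i \<in> J \<Longrightarrow> near H m (b i) \<Longrightarrow> f m = b i"
proof -
  show M: "far H M" using assms unfolding class_reps_def by blast
  then have "M \<subseteq> V" unfolding far_def by blast
  then show "finite M" using fin finite_subset by blast
  show "\<exists>m\<in>M. near H m v" if "v \<in> V - H" for v using assms that unfolding class_reps_def by simp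
  show "near H m (f m) \<and> near H m (g m) \<and> (\<forall>x. near H m x \<longrightarrow> E x (f m) \<or> E x (g m))"
    if "m \<in> M" "2 \<le> card (D \<inter> {x. near H m x})" for m
    using assms that unfolding class_reps_def by simp
  show "f m = b i" if "m \<in> M" "i \<in> J" "near H m (b i)" for m i
    using assms that unfolding class_reps_def by simp
qed

lemma class_reps_ex: "\<exists>M f g. class_reps M f g"
proof -
  obtain M where M: "far H M" "finite M" "\<And>v. v \<in> V - H \<Longrightarrow> \<exists>m\<in>M. near H m v"
    using far_cover by metis
  have "\<exists>v w. (2 \<le> card (D \<inter> {x. near H m x}) \<longrightarrow>
      near H m v \<and> near H m w \<and> (\<forall>x. near H m x \<longrightarrow> E x v \<or> E x w)) \<and>
      (\<forall>i\<in>J. near H m (b i) \<longrightarrow> v = b i)" if m: "m \<in> M" for m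
  proof -
    have mm: "near H m m" using near_refl[of m H] m M(1) unfolding far_def by blast
    obtain v where v: "near H m v" "\<forall>i\<in>J. near H m (b i) \<longrightarrow> v = b i"
    proof (cases "\<exists>i\<in>J. near H m (b i)")
      case True
      then obtain i where i: "i \<in> J" "near H m (b i)" by blast
      have "j = i" if "j \<in> J" "near H m (b j)" for j
        using b_far[OF i(1) that(1) trans[OF near_sym[OF i(2)] that(2)]] by simp
      then show ?thesis using that[of "b i"] i by blast
    qed (use that mm in blast)
    show ?thesis
    proof (cases "2 \<le> card (D \<inter> {x. near H m x})")
      case True
      have "\<exists>u u'. near H m u \<and> near H m u' \<and> u \<noteq> u'"
      proof (rule ccontr)
        assume *: "\<not> ?thesis"
        have "card (D \<inter> {x. near H m x}) \<le> 1" by (rule card_le_1I) (use * in blast)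
        then show False using True by simp
      qed
      then obtain u u' where "near H m u" "near H m u'" "u \<noteq> u'" by blast
      then obtain w where "near H m w \<and> (\<forall>x. near H m x \<longrightarrow> E x v \<or> E x w)"
        using class_near_pair[of m u u' v] v(1) by blast
      then show ?thesis using v by blast
    qed (use v in blast)
  qed
  then have "\<exists>f g. \<forall>m\<in>M. (2 \<le> card (D \<inter> {x. near H m x}) \<longrightarrow>
      near H m (f m) \<and> near H m (g m) \<and> (\<forall>x. near H m x \<longrightarrow> E x (f m) \<or> E x (g m))) \<and>
      (\<forall>i\<in>J. near H m (b i) \<longrightarrow> f m = b i)" by metis
  then obtain f g where fg: "\<forall>m\<in>M. (2 \<le> card (D \<inter> {x. near H m x}) \<longrightarrow>
      near H m (f m) \<and> near H m (g m) \<and> (\<forall>x. near H m x \<longrightarrow> E x (f m) \<or> E x (g m))) \<and>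
      (\<forall>i\<in>J. near H m (b i) \<longrightarrow> f m = b i)" by (elim exE)
  have "class_reps M f g"
    unfolding class_reps_def
  proof (intro conjI ballI impI)
    show "near H m (f m)" "near H m (g m)" if "m \<in> M" "2 \<le> card (D \<inter> {x. near H m x})" for m
      using bspec[OF fg that(1)] that(2) by blast+
    show "\<forall>x. near H m x \<longrightarrow> E x (f m) \<or> E x (g m)" if "m \<in> M" "2 \<le> card (D \<inter> {x. near H m x})" for m
      using bspec[OF fg that(1)] that(2) by blast
    show "f m = b i" if "m \<in> M" "i \<in> J" "near H m (b i)" for m i
      using bspec[OF fg that(1)] that(2,3) by blast
  qed (use M(1,3) in auto)
  then show ?thesis by blast
qed

lemma class_eq:
  assumes "near H m v" shows "{x. near H m x} = {x. near H v x}"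
proof (intro Collect_cong iffI)
  show "near H v x" if "near H m x" for x using trans[OF near_sym[OF assms] that] .
  show "near H m x" if "near H v x" for x using trans[OF assms that] .
qed

text \<open>In each class with at least two vertices of \<open>D\<close>, these are exchanged for
  \<open>f m\<close> and \<open>g m\<close>. The new set is no larger and contains all
  \<open>b i\<close>, which dominate the hubs; a hub kept from \<open>D\<close> would be the middle
  of a path in it.\<close>

lemma D_no_hub: "D \<inter> H = {}"
proof (rule ccontr)
  assume DH: "D \<inter> H \<noteq> {}"
  obtain M f g where r: "class_reps M f g" using class_reps_ex by blast
  note M = class_repsD(1-3)[OF r] and fg = class_repsD(4)[OF r] and fb = class_repsD(5)[OF r]
  define K where "K m = D \<inter> {x. near H m x}" for m
  define P where "P m = (if 2 \<le> card (K m) then {f m, g m} else K m)" for m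
  define D' where "D' = (D \<inter> H) \<union> (\<Union>m\<in>M. P m)"
  have DV: "D \<subseteq> V" using D(1) unfolding tds_def by blast
  have "card (P m) \<le> card (K m)" for m
    unfolding P_def using card_insert_le_m1[of 2 "{g m}" "f m"] by auto
  then have "(\<Sum>m\<in>M. card (P m)) \<le> (\<Sum>m\<in>M. card (K m))" by (rule sum_mono)
  moreover have "card D' \<le> card (D \<inter> H) + (\<Sum>m\<in>M. card (P m))"
    unfolding D'_def using card_UN_le[OF M(2), of P] card_Un_le[of "D \<inter> H" "\<Union>m\<in>M. P m"] by linarith
  moreover have "card D = card (D \<inter> H) + (\<Sum>m\<in>M. card (K m))"
    unfolding K_def
  proof (rule card_split_classes[OF M(1,2)])
    show "\<exists>m\<in>M. near H m v" if "v \<in> V - H" for v using M(3) that .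
    show "near H u w" if "near H u v" "near H v w" for u v w using trans that .
  qed fact
  ultimately have cD': "card D' \<le> card D" by linarith
  have bD': "b i \<in> D'" if i: "i \<in> J" for i
  proof -
    obtain m where m: "m \<in> M" "near H m (b i)" using M(3)[OF b_nonhub[OF i]] by blast
    have "2 \<le> card (K m)" unfolding K_def class_eq[OF m(2)] by (rule class_ge_2[OF i])
    then show ?thesis unfolding D'_def P_def using m(1) fb[OF m(1) i m(2)] by force
  qed
  have "\<exists>u\<in>D'. E v u" if v: "v \<in> V" for v
  proof (cases "v \<in> H")
    case True
    then show ?thesis using bD' unfolding H_def by blast
  next
    case False
    then obtain m where m: "m \<in> M" "near H m v" using M(3)[of v] v by blast
    obtain d where d: "d \<in> D" "E v d" using D(1) v unfolding tds_def by blast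
    show ?thesis
    proof (cases "d \<in> H")
      case True
      then show ?thesis using d unfolding D'_def by blast
    next
      case dH: False
      have "near H m d" using trans[OF m(2) E_near[OF d(2) False dH]] .
      then have dK: "d \<in> K m" unfolding K_def using d by blast
      show ?thesis
      proof (cases "2 \<le> card (K m)")
        case True
        then have "E v (f m) \<or> E v (g m)" using fg[OF m(1)] m(2) unfolding K_def by blast
        then show ?thesis unfolding D'_def P_def using True m(1) by fastforce
      next
        case False
        then show ?thesis unfolding D'_def P_def using dK d(2) m(1) by fastforce
      qed
    qed
  qed
  moreover have "D' \<subseteq> V"
  proof -
    have "P m \<subseteq> V" if "m \<in> M" for m
      using fg[OF that] DV near_V[of H m] unfolding P_def K_def by auto
    then show ?thesis unfolding D'_def using DV by blast
  qed
  ultimately have "tds D'" unfolding tds_def by blast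
  then have np3: "\<not> has_p3 D'" using no_p3 cD' by blast
  obtain h where h: "h \<in> D" "h \<in> H" using DH by blast
  then obtain i j where ij: "i \<in> J" "j \<in> J" "i \<noteq> j" "E h (b i)" "E h (b j)" unfolding H_def by blast
  have hD: "h \<in> D'" unfolding D'_def using h by blast
  have bb: "b i \<noteq> b j" using b_indep[OF ij(1-3)] by blast
  have "has_p3 D'"
    by (rule has_p3I[OF bD'[OF ij(1)] hD bD'[OF ij(2)] sym[OF ij(4)] ij(5) bb])
  with np3 show False by contradiction
qed

lemma class_D_ge_2: "m \<in> V - H \<Longrightarrow> 2 \<le> card (D \<inter> {x. near H m x})"
proof (rule tds_class_ge_2[OF D(1) D_no_hub])
  show "near H u w" if "near H u v" "near H v w" for u v w using trans that .
qed

text \<open>Otherwise \<open>T\<close> could pay for the classes of \<open>X\<close>, and the pairs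
  \<open>f m\<close>, \<open>g m\<close> for all others, without exceeding \<open>card D\<close>.
  The first vertices of all legs outside the classes of \<open>X\<close> are present, so the hubs
  are dominated and a hub in \<open>T\<close> is the middle of a path.\<close>

lemma hub_sets_costly:
  assumes X: "far H X" "X \<noteq> {}" "card X \<le> 3 * k + 2"
    and T: "T \<subseteq> V" "card T \<le> 2 * card X" "T \<inter> H \<noteq> {}"
  shows "\<exists>x\<in>X. \<exists>y. near H x y \<and> (\<forall>t\<in>T. \<not> E y t)"
proof (rule ccontr)
  assume neg: "\<not> ?thesis"
  have dom: "\<exists>t\<in>T. E v t" if "x \<in> X" "near H x v" for x v
  proof (rule ccontr)
    assume "\<not> ?thesis"
    then have "\<forall>t\<in>T. \<not> E v t" by blast
    with neg that show False by blast
  qed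
  obtain M f g where r: "class_reps M f g" using class_reps_ex by blast
  note M = class_repsD(1-3)[OF r] and fg = class_repsD(4)[OF r] and fb = class_repsD(5)[OF r]
  have MV: "M \<subseteq> V - H" and XV: "X \<subseteq> V - H" using M(1) X(1) unfolding far_def by blast+
  have fg': "near H m (f m) \<and> near H m (g m) \<and> (\<forall>x. near H m x \<longrightarrow> E x (f m) \<or> E x (g m))"
    if "m \<in> M" for m using fg[OF that] class_D_ge_2[of m] that MV by blast
  have finX: "finite X" using XV fin finite_subset by blast
  \<comment> \<open>The members of \<open>X\<close> need not belong to \<open>M\<close>;
    \<open>N\<close> collects the representatives of their classes.\<close>
  define N where "N = {m \<in> M. \<exists>x\<in>X. near H x m}"
  have "card X \<le> card N"
  proof -
    have "\<forall>x\<in>X. \<exists>m. m \<in> N \<and> near H x m"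
      using M(3) XV near_sym unfolding N_def by blast
    then obtain r where r: "\<And>x. x \<in> X \<Longrightarrow> r x \<in> N \<and> near H x (r x)" by metis
    have "inj_on r X"
    proof (rule inj_onI, rule ccontr)
      fix x x' assume xx: "x \<in> X" "x' \<in> X" "r x = r x'" "x \<noteq> x'"
      have "near H x x'" using trans[of x "r x" x'] r[OF xx(1)] r[OF xx(2)] near_sym[of H x' "r x'"] xx(3) by simp
      then show False using X(1) xx unfolding far_def by blast
    qed
    then show ?thesis using r M(2) by (intro card_inj_on_le[of r]) (auto simp: N_def)
  qed
  moreover have NM: "N \<subseteq> M" unfolding N_def by blast
  ultimately have cMN: "card (M - N) + card X \<le> card M"
    using card_mono[OF M(2) NM] card_Diff_subset[of N M] finite_subset[OF NM M(2)] by simp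
  define D' where "D' = T \<union> (f ` (M - N) \<union> g ` (M - N))"
  have "card D' \<le> card T + (card (f ` (M - N)) + card (g ` (M - N)))"
    unfolding D'_def
    using card_Un_le[of T "f ` (M - N) \<union> g ` (M - N)"] card_Un_le[of "f ` (M - N)" "g ` (M - N)"]
    by linarith
  also have "\<dots> \<le> 2 * card X + (card (M - N) + card (M - N))"
    using T(2) card_image_le[of "M - N" f] card_image_le[of "M - N" g] M(2) by simp
  also have "\<dots> \<le> 2 * card M" using cMN by linarith
  also have "2 * card M \<le> card D"
  proof -
    have "card D = card (D \<inter> H) + (\<Sum>m\<in>M. card (D \<inter> {x. near H m x}))"
    proof (rule card_split_classes[OF M(1,2)])
      show "\<exists>m\<in>M. near H m v" if "v \<in> V - H" for v using M(3) that .
      show "near H u w" if "near H u v" "near H v w" for u v w using trans that .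
      show "D \<subseteq> V" using D(1) unfolding tds_def by blast
    qed
    moreover have "(\<Sum>m\<in>M. 2) \<le> (\<Sum>m\<in>M. card (D \<inter> {x. near H m x}))"
      using MV class_D_ge_2 by (intro sum_mono) blast
    ultimately show ?thesis by simp
  qed
  finally have cD': "card D' \<le> card D" .
  define Z where "Z = {j \<in> J. \<exists>x\<in>X. near H x (b j)}"
  have "card Z \<le> card X"
  proof -
    have "\<forall>j\<in>Z. \<exists>x. x \<in> X \<and> near H x (b j)" unfolding Z_def by blast
    then obtain r where r: "\<And>j. j \<in> Z \<Longrightarrow> r j \<in> X \<and> near H (r j) (b j)" by metis
    have "inj_on r Z"
    proof (rule inj_onI)
      fix i j assume ij: "i \<in> Z" "j \<in> Z" "r i = r j"
      have "near H (b i) (b j)"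
        using trans[of "b i" "r i" "b j"] r[OF ij(1)] r[OF ij(2)] near_sym[of H "r i" "b i"] ij(3) by simp
      then show "i = j" using b_far ij unfolding Z_def by blast
    qed
    then show ?thesis using r finX by (intro card_inj_on_le[of r]) auto
  qed
  then have cZ: "card Z \<le> 3 * k + 2" using X(3) by linarith
  have bD': "b j \<in> D'" if j: "j \<in> J - Z" for j
  proof -
    obtain m where m: "m \<in> M" "near H m (b j)" using M(3) b_nonhub[of j] j by blast
    have "m \<notin> N"
    proof
      assume "m \<in> N"
      then obtain x where "x \<in> X" "near H x m" unfolding N_def by blast
      then show False using trans[OF _ m(2), of x] j unfolding Z_def by blast
    qed
    then show ?thesis unfolding D'_def using m(1) fb[OF m(1) _ m(2)] j by force
  qed
  \<comment> \<open>At most \<open>3 * k + 2\<close> legs start in classes of \<open>X\<close> and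
    \<open>h\<close> misses at most \<open>k\<close> first vertices, so among
    \<open>4 * k + 10\<close> legs two are left.\<close>
  have hub2: "\<exists>i\<in>J - Z. \<exists>j\<in>J - Z. i \<noteq> j \<and> E h (b i) \<and> E h (b j)" if h: "h \<in> H" for h
  proof -
    let ?G = "J - Z - {j \<in> J. \<not> E h (b j)}"
    have "card J - card Z \<le> card (J - Z)"
      using J(1) by (intro diff_card_le_card_Diff) (auto simp: Z_def)
    moreover have "card (J - Z) - card {j \<in> J. \<not> E h (b j)} \<le> card ?G"
      using J(1) by (intro diff_card_le_card_Diff) auto
    ultimately have c: "2 \<le> card ?G" using cZ hub_adj[OF h] J(2) by linarith
    have "\<exists>i\<in>?G. \<exists>j\<in>?G. i \<noteq> j"
    proof (rule ccontr)
      assume "\<not> ?thesis"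
      then have "card ?G \<le> 1" by (intro card_le_1I) blast
      then show False using c by simp
    qed
    then show ?thesis by blast
  qed
  have "\<exists>u\<in>D'. E v u" if v: "v \<in> V" for v
  proof (cases "v \<in> H")
    case True
    then show ?thesis using hub2 bD' by blast
  next
    case False
    then obtain m where m: "m \<in> M" "near H m v" using M(3)[of v] v by blast
    show ?thesis
    proof (cases "m \<in> N")
      case True
      then obtain x where "x \<in> X" "near H x m" unfolding N_def by blast
      then show ?thesis using dom[of x v] trans[OF _ m(2), of x] unfolding D'_def by blast
    next
      case False
      then show ?thesis using fg'[OF m(1)] m unfolding D'_def by blast
    qed
  qed
  moreover have "D' \<subseteq> V"
  proof -
    have "f m \<in> V" "g m \<in> V" if "m \<in> M" for m using fg'[OF that] near_V[of H m] by blast+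
    then show ?thesis unfolding D'_def using T(1) by blast
  qed
  ultimately have "tds D'" unfolding tds_def by blast
  then have np3: "\<not> has_p3 D'" using no_p3 cD' by blast
  obtain h where h: "h \<in> T" "h \<in> H" using T(3) by blast
  then obtain i j where ij: "i \<in> J - Z" "j \<in> J - Z" "i \<noteq> j" "E h (b i)" "E h (b j)" using hub2 by blast
  have hD: "h \<in> D'" unfolding D'_def using h by blast
  have bb: "b i \<noteq> b j" using b_indep[of i j] ij(1-3) by blast
  have "has_p3 D'"
    by (rule has_p3I[OF bD'[OF ij(1)] hD bD'[OF ij(2)] sym[OF ij(4)] ij(5) bb])
  with np3 show False by contradiction
qed

section \<open>Components that do not suit a hub\<close>

lemma single_hub_costly:
  assumes "h \<in> H" "x \<in> V - H" "t \<in> V"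
  shows "\<exists>y. near H x y \<and> \<not> E y h \<and> \<not> E y t"
proof -
  have "card {h, t} \<le> 2" by (simp add: card_insert_if)
  then show ?thesis
    using hub_sets_costly[of "{x}" "{h, t}"] assms unfolding far_def H_def by auto
qed

text \<open>Let there be no such path. If \<open>h\<close> misses two nonadjacent vertices, they lie
  on the same side of the join, so \<open>h\<close> sees the whole other side, and \<open>h\<close>
  with one vertex of that side dominates the class. If the missed vertices form a clique, then
  \<open>h\<close> has no neighbour in the class, which is therefore a clique, and it is dominated
  by any edge that joins it to a hub. Either way a hub dominates a class too cheaply.\<close>

lemma bad_class_p3:
  assumes h: "h \<in> H" and x: "x \<in> V - H" and bad: "\<not> good H h x"
  obtains p q r where "ip3 p q r" "near H x p" "near H x q" "near H x r"
    "\<not> E h p" "\<not> E h q" "\<not> E h r"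
proof (rule ccontr)
  assume "\<not> thesis"
  then have np3: "\<And>p q r. near H x p \<Longrightarrow> near H x q \<Longrightarrow> near H x r \<Longrightarrow>
      \<not> E h p \<Longrightarrow> \<not> E h q \<Longrightarrow> \<not> E h r \<Longrightarrow> \<not> ip3 p q r" using that by blast
  have xx: "near H x x" using near_refl x by blast
  show False
  proof (cases "\<exists>u v. near H x u \<and> near H x v \<and> \<not> E h u \<and> \<not> E h v \<and> u \<noteq> v \<and> \<not> E u v")
    case True
    then obtain u v where uv: "near H x u" "near H x v" "\<not> E h u" "\<not> E h v" "u \<noteq> v" "\<not> E u v" by blast
    have "\<exists>w. near H x w \<and> x \<noteq> w" using uv by metis
    then obtain w where "near H x w" "x \<noteq> w" by blast
    then obtain A B where AB: "A \<noteq> {}" "B \<noteq> {}" "A \<union> B = {y. near H x y}" "A \<inter> B = {}"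
      and join: "\<And>a b. a \<in> A \<Longrightarrow> b \<in> B \<Longrightarrow> E a b"
      using class_join[of H x w] p4_free_off_H by metis
    have main: False
      if AB: "A \<noteq> {}" "B \<noteq> {}" "A \<union> B = {y. near H x y}"
        and join: "\<And>a b. a \<in> A \<Longrightarrow> b \<in> B \<Longrightarrow> E a b" and uA: "u \<in> A" for A B
    proof -
      have nb: "near H x y" if "y \<in> A \<union> B" for y using that AB(3) by blast
      have "v \<notin> B" using join[OF uA] uv(6) by blast
      then have vA: "v \<in> A" using uv(2) AB(3) by blast
      have hB: "E h t" if "t \<in> B" for t
        using np3[OF uv(1) nb[of t] uv(2,3) _ uv(4)] that join[OF uA that] sym[OF join[OF vA that]] uv(5,6)
        unfolding ip3_def by blast
      obtain t where t: "t \<in> B" using AB(2) by blast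
      have tV: "t \<in> V" using near_V[OF nb[of t]] t by blast
      obtain y where y: "near H x y" "\<not> E y h" "\<not> E y t" using single_hub_costly[OF h x tV] by blast
      then have "y \<in> A" using AB(3) hB sym by blast
      then show False using join[OF _ t] y by blast
    qed
    show False
    proof (cases "u \<in> A")
      case True
      then show False using main[OF AB(1-3)] join by blast
    next
      case False
      then have "u \<in> B" using uv(1) AB(3) by blast
      moreover have "B \<union> A = {y. near H x y}" using AB(3) by blast
      ultimately show False using main[OF AB(2,1), of] join sym by blast
    qed
  next
    case False
    then have clique: "\<And>u v. near H x u \<Longrightarrow> near H x v \<Longrightarrow> \<not> E h u \<Longrightarrow> \<not> E h v \<Longrightarrow> u \<noteq> v \<Longrightarrow> E u v" by blast
    then have un: "\<not> E h u" if "near H x u" for u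
      using bad that unfolding good_def by blast
    let ?Y = "{y. near H x y}"
    have YV: "?Y \<subseteq> V - H" using near_V[of H x] by blast
    moreover have "h \<in> V" "h \<notin> ?Y" using h YV unfolding H_def by blast+
    ultimately have "?Y \<subseteq> V" "?Y \<noteq> V" "?Y \<noteq> {}" using xx by blast+
    \<comment> \<open>Connectedness of the whole graph: an edge leaves the class, and it can only
      lead to a hub.\<close>
    then obtain s t where st: "near H x s" "t \<in> V" "\<not> near H x t" "E s t"
      using conn unfolding conn_def by blast
    have sH: "s \<in> V - H" using near_V[OF st(1)] by blast
    have "t \<in> H"
    proof (rule ccontr)
      assume "t \<notin> H"
      then have "near H s t" using E_near[OF st(4)] sH by blast
      then show False using trans[OF st(1)] st(3) by blast
    qed
    then obtain y where y: "near H x y" "\<not> E y t" "\<not> E y s"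
      using single_hub_costly[OF _ x, of t s] sH by blast
    then have "y \<noteq> s" using st(4) by blast
    then show False using clique[OF y(1) st(1) un[OF y(1)] un[OF st(1)]] y(3) by blast
  qed
qed

text \<open>The paths from \<open>bad_class_p3\<close> lie in different components and are missed by
  \<open>h\<close>, so they extend the P4 formed by a leg and \<open>h\<close> to the excluded
  subgraph. The class of that leg is set aside, hence \<open>k\<close> and not
  \<open>k - 1\<close>.\<close>

lemma bad_classes:
  assumes h: "h \<in> H" and X: "far H X" "\<forall>x\<in>X. \<not> good H h x"
  shows "card X \<le> k"
proof (rule ccontr)
  assume *: "\<not> ?thesis"
  obtain i where i: "i \<in> J" "E h (b i)" "ip4 (y i) (z i) (b i) h" using hub_p4[OF h] .
  have XV: "X \<subseteq> V - H" using X(1) unfolding far_def by blast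
  have finX: "finite X" using XV fin finite_subset by blast
  have "\<forall>x\<in>X. \<exists>p q r. ip3 p q r \<and> near H x p \<and> near H x q \<and> near H x r \<and> \<not> E h p \<and> \<not> E h q \<and> \<not> E h r"
  proof
    fix x assume "x \<in> X"
    then have "x \<in> V - H" "\<not> good H h x" using XV X(2) by blast+
    then obtain p q r where "ip3 p q r" "near H x p" "near H x q" "near H x r"
      "\<not> E h p" "\<not> E h q" "\<not> E h r" by (rule bad_class_p3[OF h])
    then show "\<exists>p q r. ip3 p q r \<and> near H x p \<and> near H x q \<and> near H x r \<and> \<not> E h p \<and> \<not> E h q \<and> \<not> E h r"
      by blast
  qed
  then have "\<exists>p q r. \<forall>x\<in>X. ip3 (p x) (q x) (r x) \<and> near H x (p x) \<and> near H x (q x)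
      \<and> near H x (r x) \<and> \<not> E h (p x) \<and> \<not> E h (q x) \<and> \<not> E h (r x)"
    by (simp only: bchoice_iff) 
  then obtain p q r where pqr0: "\<forall>x\<in>X. ip3 (p x) (q x) (r x) \<and> near H x (p x) \<and> near H x (q x)
      \<and> near H x (r x) \<and> \<not> E h (p x) \<and> \<not> E h (q x) \<and> \<not> E h (r x)" by blast
  note pqr = bspec[OF pqr0]
  let ?B = "{x \<in> X. near H x (b i)}"
  have far': "x = x'" if "x \<in> X" "x' \<in> X" "near H x u" "near H x' u" for x x' u
    using trans[OF that(3) near_sym[OF that(4)]] X(1) that(1,2) unfolding far_def by blast
  have "card ?B \<le> 1" by (rule card_le_1I) (use far' in blast)
  moreover have "card X - card ?B \<le> card (X - ?B)" using finX by (intro diff_card_le_card_Diff) auto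
  ultimately have k: "k \<le> card (X - ?B)" using * by linarith
  have sep: "u \<noteq> v \<and> \<not> E u v" if "near H x u" "near H x' v" "x \<in> X" "x' \<in> X" "x \<noteq> x'" for u v x x'
  proof -
    have "\<not> near H x v" using far'[of x x' v] that by blast
    then show ?thesis
      using trans[OF that(1), of v] E_near[of u v H] near_V[OF that(1)] near_V[OF that(2)] that(1) by blast
  qed
  have bH: "b i \<notin> H" and zH: "z i \<notin> H" and yH: "y i \<notin> H"
    using b_nonhub[OF i(1)] E_zb[OF i(1)] E_yb[OF i(1)] unfolding H_def by blast+
  have bz: "near H (b i) (z i)" using E_near[OF leg_E(1)[OF i(1)] bH zH] .
  have by': "near H (b i) (y i)" using trans[OF bz E_near[OF leg_E(2)[OF i(1)] zH yH]] .
  have bb: "near H (b i) (b i)" using near_refl b_nonhub[OF i(1)] by blast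
  have sep': "u \<noteq> v \<and> \<not> E u v" if u: "near H (b i) u" and x: "near H x v" "x \<in> X - ?B" for u v x
  proof -
    have "\<not> near H (b i) v"
      using trans[OF x(1), of "b i"] near_sym[of H "b i" v] x(2) by blast
    then show ?thesis
      using trans[OF u, of v] E_near[of u v H] near_V[OF u] near_V[OF x(1)] u by blast
  qed
  show False
  proof (rule p4kp3_freeD[OF free i(3) _ k])
    show "finite (X - ?B)" using finX by simp
    show "ip3 (p x) (q x) (r x)" if "x \<in> X - ?B" for x using pqr that by blast
    show "anti {y i, z i, b i, h} {p x, q x, r x}" if x: "x \<in> X - ?B" for x
    proof -
      have P: "near H x v" "\<not> E h v" if "v \<in> {p x, q x, r x}" for v using pqr[of x] x that by blast+
      have "u \<noteq> v \<and> \<not> E u v" if uv: "u \<in> {y i, z i, b i, h}" "v \<in> {p x, q x, r x}" for u v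
      proof (cases "u = h")
        case True
        then show ?thesis using P[OF uv(2)] near_V[OF P(1)[OF uv(2)]] h by blast
      next
        case False
        then have "near H (b i) u" using uv(1) bb bz by' by blast
        then show ?thesis using sep'[OF _ P(1)[OF uv(2)] x] by blast
      qed
      then show ?thesis unfolding anti_def by (intro ballI)
    qed
    show "anti {p x, q x, r x} {p x', q x', r x'}" if "x \<in> X - ?B" "x' \<in> X - ?B" "x \<noteq> x'" for x x'
    proof -
      have "near H x u" if "u \<in> {p x, q x, r x}" for u using pqr[of x] \<open>x \<in> X - ?B\<close> that by blast
      moreover have "near H x' u" if "u \<in> {p x', q x', r x'}" for u using pqr[of x'] \<open>x' \<in> X - ?B\<close> that by blast
      ultimately have "u \<noteq> v \<and> \<not> E u v" if "u \<in> {p x, q x, r x}" "v \<in> {p x', q x', r x'}" for u v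
        using sep[of x u x' v] that \<open>x \<in> X - ?B\<close> \<open>x' \<in> X - ?B\<close> \<open>x \<noteq> x'\<close> by simp
      then show ?thesis unfolding anti_def by (intro ballI)
    qed
  qed
qed

theorem family_cert: "cert H k"
  unfolding cert_def
proof (intro conjI allI impI ballI)
  show "H \<subseteq> V" unfolding H_def by blast
  show "near H u w" if "near H u v" "near H v w" for u v w using trans that .
  show "\<exists>w\<in>V - H. E v w \<and> (\<forall>y. near H v y \<longrightarrow> E y v \<or> E y w)" if v: "v \<in> V - H" for v
  proof -
    have c: "2 \<le> card (D \<inter> {x. near H v x})" using class_D_ge_2[OF v] .
    have "\<exists>u. near H v u \<and> v \<noteq> u"
    proof (rule ccontr)
      assume *: "\<not> ?thesis"
      have "card (D \<inter> {x. near H v x}) \<le> 1" by (rule card_le_1I) (use * in blast)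
      then show False using c by simp
    qed
    then show ?thesis using class_pair[of H v] p4_free_off_H by blast
  qed
  show "card X \<le> k" if "h \<in> H" "far H X" "\<forall>x\<in>X. \<not> good H h x" for h X
    using bad_classes that .
  show "\<exists>x\<in>X. \<exists>y. near H x y \<and> (\<forall>t\<in>T. \<not> E y t)"
    if "far H X" "X \<noteq> {}" "card X \<le> 3 * k + 2" "T \<subseteq> V" "card T \<le> 2 * card X" "T \<inter> H \<noteq> {}" for X T
    using hub_sets_costly that .
  show "\<exists>X. far H X \<and> card X = 2 * k + 2"
  proof -
    have "2 * k + 2 \<le> card J" using J(2) by linarith
    then obtain J' where J': "J' \<subseteq> J" "card J' = 2 * k + 2" using obtain_subset_with_card_n by metis
    have "inj_on b J'" using b_indep J'(1) by (intro inj_onI) blast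
    then have "card (b ` J') = 2 * k + 2" using J'(2) card_image by metis
    moreover have "far H (b ` J')"
      unfolding far_def using b_nonhub b_far J'(1) by blast
    ultimately show ?thesis by blast
  qed
qed

end

section \<open>Finding legs in a large minimum total dominating set\<close>

text \<open>\<open>A\<close> will be the vertex set of an induced \<open>P\<^sub>4 + jP\<^sub>3\<close> with \<open>j\<close> maximal. The set \<open>C\<close> of its
  non-neighbours induces a disjoint union of cliques, and a set that dominates \<open>C\<close> becomes a total
  dominating set when \<open>A\<close> is added, so it cannot be smaller than \<open>D\<close> by \<open>a\<close>.\<close>

locale p3_complement = sgraph V E for V :: "'a set" and E +
  fixes k a :: nat and A D :: "'a set"
  assumes no: no_inst
    and free: "p4kp3_free k"
    and conn: "conn V"
    and D: "tds D" "\<And>D'. tds D' \<Longrightarrow> card D \<le> card D'"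
    and A: "A \<subseteq> V" "card A \<le> a" "has_p3 A" "\<And>x. x \<in> A \<Longrightarrow> \<exists>y\<in>A. E x y"
    and C_no_p3: "\<And>p q r. \<lbrakk>p \<in> V - A; q \<in> V - A; r \<in> V - A; \<forall>x\<in>A. \<not> E p x; \<forall>x\<in>A. \<not> E q x;
      \<forall>x\<in>A. \<not> E r x\<rbrakk> \<Longrightarrow> \<not> ip3 p q r"
begin

section \<open>The cliques that do not see the excluded part\<close>

definition C :: "'a set" where "C = {v \<in> V - A. \<forall>x\<in>A. \<not> E v x}"

text \<open>These are the vertices outside \<open>A\<close> with a neighbour in
  \<open>A\<close>.\<close>

definition B :: "'a set" where "B = V - A - C"

definition same_clique :: "'a \<Rightarrow> 'a \<Rightarrow> bool" where
  "same_clique c c' \<longleftrightarrow> c \<in> C \<and> c' \<in> C \<and> (c = c' \<or> E c c')"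

definition dominates_C :: "'a set \<Rightarrow> bool" where
  "dominates_C S \<longleftrightarrow> (\<forall>c\<in>C. \<exists>s\<in>S. E c s)"

definition hits :: "'a \<Rightarrow> 'a \<Rightarrow> bool" where
  "hits b c \<longleftrightarrow> (\<exists>c'. same_clique c c' \<and> E b c')"

lemma finA: "finite A" using A(1) fin finite_subset by blast

lemma DV: "D \<subseteq> V" using D(1) unfolding tds_def by blast

lemma finD: "finite D" using DV fin finite_subset by blast

lemma C_V: "C \<subseteq> V" unfolding C_def by blast

lemma same_clique_sym: "same_clique c c' \<Longrightarrow> same_clique c' c" unfolding same_clique_def using sym[of c c'] by blast

lemma same_clique_refl: "c \<in> C \<Longrightarrow> same_clique c c" unfolding same_clique_def by blast

text \<open>A failure would be an induced P3 without neighbours in \<open>A\<close>.\<close>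

lemma same_clique_trans:
  assumes "same_clique c c'" "same_clique c' c''" shows "same_clique c c''"
proof -
  have mem: "c \<in> C" "c' \<in> C" "c'' \<in> C" using assms unfolding same_clique_def by blast+
  have "\<not> ip3 c c' c''" using C_no_p3[of c c' c''] mem unfolding C_def by blast
  then show ?thesis using assms mem unfolding same_clique_def ip3_def by blast
qed

lemma same_clique_C: "same_clique c c' \<Longrightarrow> c \<in> C \<and> c' \<in> C" unfolding same_clique_def by blast

lemma E_same_clique: "E c c' \<Longrightarrow> c \<in> C \<Longrightarrow> c' \<in> C \<Longrightarrow> same_clique c c'" unfolding same_clique_def by blast

lemma same_clique_E: "same_clique c c' \<Longrightarrow> c \<noteq> c' \<Longrightarrow> E c c'" unfolding same_clique_def by blast

lemma E_C_cases:
  assumes "c \<in> C" "E c v" shows "v \<in> B \<or> same_clique c v"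
  using assms E_V[OF assms(2)] unfolding B_def same_clique_def C_def by blast

text \<open>Together with \<open>A\<close>, such a set is totally dominating and contains the P3
  inside \<open>A\<close>; in a no-instance it is therefore not minimum.\<close>

lemma slack:
  assumes "S \<subseteq> V" "dominates_C S"
  shows "card D + 1 \<le> card S + a"
proof -
  have "\<exists>u\<in>S \<union> A. E v u" if v: "v \<in> V" for v
  proof (cases "v \<in> A")
    case True
    then show ?thesis using A(4)[of v] by blast
  next
    case False
    then show ?thesis using assms(2) v unfolding dominates_C_def C_def by blast
  qed
  then have t: "tds (S \<union> A)" using assms(1) A(1) unfolding tds_def by blast
  have "has_p3 (S \<union> A)" using A(3) unfolding has_p3_def by blast
  then obtain D' where "tds D'" "card D' < card (S \<union> A)" using no t unfolding no_inst_def by blast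
  then have "card D < card (S \<union> A)" using D(2)[of D'] by simp
  also have "\<dots> \<le> card S + card A" by (rule card_Un_le)
  finally show ?thesis using A(2) by simp
qed

section \<open>The perfect matching induced by the minimum set\<close>

lemma D_no_p3: "\<not> has_p3 D"
proof
  assume "has_p3 D"
  then obtain D' where "tds D'" "card D' < card D" using no D(1) unfolding no_inst_def by blast
  then show False using D(2)[of D'] by simp
qed

definition mate :: "'a \<Rightarrow> 'a" where "mate d = (SOME d'. d' \<in> D \<and> E d d')"

lemma mate:
  assumes "d \<in> D"
  shows "mate d \<in> D" "E d (mate d)" "E (mate d) d" "mate d \<noteq> d"
proof -
  have "\<exists>d'. d' \<in> D \<and> E d d'" using D(1) assms DV unfolding tds_def by blast
  then have "mate d \<in> D \<and> E d (mate d)" unfolding mate_def by (rule someI_ex)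
  then show "mate d \<in> D" "E d (mate d)" "E (mate d) d" "mate d \<noteq> d"
    using sym[of d "mate d"] irr[of d] by auto
qed

lemma mate_eq: "d \<in> D \<Longrightarrow> d' \<in> D \<Longrightarrow> E d d' \<Longrightarrow> d' = mate d"
  using D_no_p3 has_p3I[of d' D d "mate d"] mate[of d] sym[of d d'] by blast

lemma mate_mate: "d \<in> D \<Longrightarrow> mate (mate d) = d"
  using mate_eq[of "mate d" d] mate[of d] by simp

lemma mate_inj: "d \<in> D \<Longrightarrow> d' \<in> D \<Longrightarrow> mate d = mate d' \<Longrightarrow> d = d'"
  using mate_mate by metis

section \<open>Private neighbours and local exchanges\<close>

lemma dominates_C_D: "dominates_C D" using D(1) C_V unfolding dominates_C_def tds_def by blast

text \<open>\<open>W\<close> is a part that has to be kept. Every other vertex that survives has a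
  private neighbour in \<open>C\<close>, by \<open>dominates_C_private\<close>.\<close>

lemma dominates_C_minimal:
  assumes "dominates_C S" "W \<subseteq> S" "S \<subseteq> V"
  obtains S' where "W \<subseteq> S'" "S' \<subseteq> S" "dominates_C S'" "\<And>u. u \<in> S' - W \<Longrightarrow> \<not> dominates_C (S' - {u})"
proof -
  define P where "P S' \<longleftrightarrow> W \<subseteq> S' \<and> S' \<subseteq> S \<and> dominates_C S'" for S'
  have "P S" unfolding P_def using assms by blast
  then obtain S' where P: "P S'" and min: "\<And>T. P T \<Longrightarrow> card S' \<le> card T"
    using ex_has_least_nat[of P S card] by blast
  have S': "W \<subseteq> S'" "S' \<subseteq> S" "dominates_C S'" using P unfolding P_def by blast+
  have fS: "finite S'" using finite_subset[OF S'(2) finite_subset[OF assms(3) fin]] .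
  have "\<not> dominates_C (S' - {u})" if u: "u \<in> S' - W" for u
  proof
    assume "dominates_C (S' - {u})"
    then have "P (S' - {u})" unfolding P_def using S' u by blast
    then have "card S' \<le> card (S' - {u})" by (rule min)
    moreover have "card (S' - {u}) < card S'" using u fS by (intro card_Diff1_less) auto
    ultimately show False by simp
  qed
  then show ?thesis using that[of S'] S' by blast
qed

lemma dominates_C_private:
  assumes "dominates_C S" "\<not> dominates_C (S - {u})"
  obtains c where "c \<in> C" "E c u" "\<And>s. s \<in> S \<Longrightarrow> E c s \<Longrightarrow> s = u"
  using assms unfolding dominates_C_def by blast

text \<open>\<open>J\<close> names edges of \<open>D\<close> by one end, and
  \<open>\<kappa> i\<close> stands for a clique assigned to the edge at \<open>i\<close>. The last
  condition makes exchanges local: if at most \<open>2 * a\<close> of these edges are removed from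
  \<open>D\<close>, only the cliques assigned to them can lose their domination.\<close>

definition units :: "'a set \<Rightarrow> ('a \<Rightarrow> 'a) \<Rightarrow> bool" where
  "units J \<kappa> \<longleftrightarrow> J \<subseteq> D \<and> (\<forall>i\<in>J. \<kappa> i \<in> C \<and> mate i \<notin> J) \<and> (\<forall>i\<in>J. \<forall>j\<in>J. i \<noteq> j \<longrightarrow> \<not> same_clique (\<kappa> i) (\<kappa> j)) \<and>
     (\<forall>L\<subseteq>J. card L \<le> 2 * a \<longrightarrow> (\<forall>c\<in>C. (\<forall>i\<in>L. \<not> same_clique (\<kappa> i) c) \<longrightarrow> (\<exists>s\<in>D - (L \<union> mate ` L). E c s)))"

lemma unitsD:
  assumes "units J \<kappa>"
  shows "J \<subseteq> D" "finite J" "\<And>i. i \<in> J \<Longrightarrow> \<kappa> i \<in> C" "\<And>i. i \<in> J \<Longrightarrow> mate i \<notin> J"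
    "\<And>i j. i \<in> J \<Longrightarrow> j \<in> J \<Longrightarrow> i \<noteq> j \<Longrightarrow> \<not> same_clique (\<kappa> i) (\<kappa> j)"
    "\<And>L c. L \<subseteq> J \<Longrightarrow> card L \<le> 2 * a \<Longrightarrow> c \<in> C \<Longrightarrow> (\<And>i. i \<in> L \<Longrightarrow> \<not> same_clique (\<kappa> i) c) \<Longrightarrow>
      \<exists>s\<in>D - (L \<union> mate ` L). E c s"
proof -
  note u = assms[unfolded units_def]
  show J: "J \<subseteq> D" using u by (rule conjunct1)
  show "finite J" using finite_subset[OF J finD] .
  note u = u[THEN conjunct2]
  show "\<kappa> i \<in> C" "mate i \<notin> J" if "i \<in> J" for i using bspec[OF u[THEN conjunct1] that] by simp_all
  note u = u[THEN conjunct2]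
  show "\<not> same_clique (\<kappa> i) (\<kappa> j)" if "i \<in> J" "j \<in> J" "i \<noteq> j" for i j
    using u[THEN conjunct1, rule_format, OF that] .
  show "\<exists>s\<in>D - (L \<union> mate ` L). E c s"
    if "L \<subseteq> J" "card L \<le> 2 * a" "c \<in> C" "\<And>i. i \<in> L \<Longrightarrow> \<not> same_clique (\<kappa> i) c" for L c
  proof -
    have "\<forall>i\<in>L. \<not> same_clique (\<kappa> i) c" using that(4) by blast
    with bspec[OF mp[OF mp[OF spec[OF u[THEN conjunct2]] that(1)] that(2)] that(3)]
    show ?thesis by (rule mp)
  qed
qed

lemma card_edges:
  assumes "L \<subseteq> D" "\<And>i. i \<in> L \<Longrightarrow> mate i \<notin> L"
  shows "card (D - (L \<union> mate ` L)) + 2 * card L = card D"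
proof -
  have fL: "finite L" using finite_subset[OF assms(1) finD] .
  have "inj_on mate L" using mate_inj assms(1) by (intro inj_onI) blast
  then have "card (mate ` L) = card L" by (rule card_image)
  moreover have "L \<inter> mate ` L = {}" using assms(2) by blast
  ultimately have "card (L \<union> mate ` L) = 2 * card L" using fL by (simp add: card_Un_disjoint)
  moreover have sub: "L \<union> mate ` L \<subseteq> D" using assms(1) mate(1) by blast
  moreover have "card (D - (L \<union> mate ` L)) = card D - card (L \<union> mate ` L)"
    by (rule card_Diff_subset[OF _ sub]) (use fL in simp)
  moreover have "card (L \<union> mate ` L) \<le> card D" by (rule card_mono[OF finD sub])
  ultimately show ?thesis by linarith
qed

text \<open>Exchanging the edges of \<open>L\<close> for \<open>S\<close> leaves \<open>C\<close>
  dominated, by the last condition of \<open>units\<close>; so \<open>slack\<close> bounds the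
  gain.\<close>

lemma units_cost:
  assumes u: "units J \<kappa>" and L: "L \<subseteq> J" "card L \<le> 2 * a"
    and S: "S \<subseteq> V" "\<And>i c. i \<in> L \<Longrightarrow> same_clique (\<kappa> i) c \<Longrightarrow> \<exists>s\<in>S. E c s"
  shows "2 * card L + 1 \<le> card S + a"
proof -
  have LD: "L \<subseteq> D" using unitsD(1)[OF u] L(1) by blast
  have Lm: "mate i \<notin> L" if "i \<in> L" for i using unitsD(4)[OF u, of i] L(1) that by blast
  have star: "\<exists>s\<in>D - (L \<union> mate ` L). E c s" if "c \<in> C" "\<forall>i\<in>L. \<not> same_clique (\<kappa> i) c" for c
    by (rule unitsD(6)[OF u L that(1)]) (use that(2) in simp)
  have "dominates_C (D - (L \<union> mate ` L) \<union> S)"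
    unfolding dominates_C_def
  proof
    fix c assume c: "c \<in> C"
    show "\<exists>s\<in>D - (L \<union> mate ` L) \<union> S. E c s"
    proof (cases "\<forall>i\<in>L. \<not> same_clique (\<kappa> i) c")
      case True
      then show ?thesis using star[OF c] by blast
    next
      case False
      then show ?thesis using S(2) by blast
    qed
  qed
  moreover have "D - (L \<union> mate ` L) \<union> S \<subseteq> V" using DV S(1) by blast
  ultimately have "card D + 1 \<le> card (D - (L \<union> mate ` L) \<union> S) + a" by (rule slack[rotated])
  also have "card (D - (L \<union> mate ` L) \<union> S) \<le> card (D - (L \<union> mate ` L)) + card S" by (rule card_Un_le)
  finally show ?thesis using card_edges[OF LD Lm] by linarith
qed

text \<open>A clique that is hit at \<open>z i\<close> is dominated by \<open>z i\<close>, except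
  for \<open>z i\<close> itself, which is dominated by the vertex that hits it. So each clique costs
  one new vertex in place of the two ends of its edge.\<close>

lemma units_hit_cost:
  assumes u: "units J \<kappa>" and L: "L \<subseteq> J" "card L \<le> 2 * a"
    and S: "S \<subseteq> V" "\<And>i. i \<in> L \<Longrightarrow> \<exists>s\<in>S. hits s (\<kappa> i)"
  shows "card L + 1 \<le> card S + a"
proof -
  have fL: "finite L" using finite_subset[OF L(1) unitsD(2)[OF u]] .
  have "\<forall>i\<in>L. \<exists>z. same_clique (\<kappa> i) z \<and> (\<exists>s\<in>S. E s z)" using S(2) unfolding hits_def by blast
  then obtain z where z: "\<forall>i\<in>L. same_clique (\<kappa> i) (z i) \<and> (\<exists>s\<in>S. E s (z i))"
    using bchoice[of L "\<lambda>i z. same_clique (\<kappa> i) z \<and> (\<exists>s\<in>S. E s z)"] by blast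
  have "2 * card L + 1 \<le> card (S \<union> z ` L) + a"
  proof (rule units_cost[OF u L])
    have "z i \<in> V" if "i \<in> L" for i using bspec[OF z that] same_clique_C[of "\<kappa> i" "z i"] C_V by blast
    then show "S \<union> z ` L \<subseteq> V" using S(1) by blast
    show "\<exists>s\<in>S \<union> z ` L. E c s" if i: "i \<in> L" and c: "same_clique (\<kappa> i) c" for i c
    proof (cases "c = z i")
      case True
      obtain s where "s \<in> S" "E s (z i)" using z i by blast
      then show ?thesis using True sym[of s "z i"] by blast
    next
      case False
      have "same_clique c (z i)" using same_clique_trans[OF same_clique_sym[OF c]] z i by blast
      then show ?thesis using same_clique_E[OF _ False] i by blast
    qed
  qed
  also have "card (S \<union> z ` L) \<le> card S + card L"
    using card_Un_le[of S "z ` L"] card_image_le[OF fL, of z] by linarith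
  finally show ?thesis by linarith
qed

text \<open>Greedily removing vertices of \<open>B\<close> that hit two fresh units terminates, since each of them
  saves one vertex.\<close>

lemma units_reduce:
  assumes u: "units J \<kappa>"
  obtains J' where "J' \<subseteq> J" "card J \<le> card J' + 2 * a"
    "\<And>b i j. b \<in> B \<Longrightarrow> i \<in> J' \<Longrightarrow> j \<in> J' \<Longrightarrow> hits b (\<kappa> i) \<Longrightarrow> hits b (\<kappa> j) \<Longrightarrow> i = j"
proof -
  have fJ: "finite J" using unitsD(2)[OF u] .
  have BV: "B \<subseteq> V" unfolding B_def by blast
  define I where "I S = {i \<in> J. \<exists>b\<in>S. hits b (\<kappa> i)}" for S
  have fI: "finite (I S)" for S unfolding I_def using fJ by simp
  define P where "P S \<longleftrightarrow> S \<subseteq> B \<and> card S \<le> a \<and> 2 * card S \<le> card (I S)" for S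
  have "P {}" "\<forall>S. P S \<longrightarrow> card S < a + 1" unfolding P_def by auto
  then obtain S where P: "P S" and max: "\<And>T. P T \<Longrightarrow> card T \<le> card S"
    using ex_has_greatest_nat[of P "{}" card "a + 1"] by blast
  have S: "S \<subseteq> B" "card S \<le> a" "2 * card S \<le> card (I S)" using P unfolding P_def by blast+
  have cost: "card L + 1 \<le> card S + a" if "L \<subseteq> I S" "card L \<le> 2 * a" for L
  proof (rule units_hit_cost[OF u _ that(2)])
    show "L \<subseteq> J" using that(1) unfolding I_def by blast
    show "S \<subseteq> V" using S(1) BV by blast
    show "\<exists>s\<in>S. hits s (\<kappa> i)" if "i \<in> L" for i using that \<open>L \<subseteq> I S\<close> unfolding I_def by blast
  qed
  \<comment> \<open>Choosing \<open>2 * a\<close> of the units hit by \<open>S\<close> would give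
    \<open>2 * a + 1 \<le> card S + a\<close>, against \<open>card S \<le> a\<close>. This keeps
    \<open>card S\<close> strictly below \<open>a\<close>, so that \<open>S\<close> may
    grow.\<close>
  have IS: "card (I S) < 2 * a"
  proof (rule ccontr)
    assume "\<not> ?thesis"
    then obtain L where "L \<subseteq> I S" "card L = 2 * a"
      using obtain_subset_with_card_n[of "2 * a" "I S"] by auto
    then show False using cost[of L] S(2) by simp
  qed
  then have Sa: "card S < a" using S(3) by linarith
  have uniq: "i = j"
    if b: "b \<in> B" and ij: "i \<in> J - I S" "j \<in> J - I S" "hits b (\<kappa> i)" "hits b (\<kappa> j)" for b i j
  proof (rule ccontr)
    assume ne: "i \<noteq> j"
    have bS: "b \<notin> S" using ij unfolding I_def by blast
    have fS: "finite S" using finite_subset[OF S(1) finite_subset[OF BV fin]] .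
    have "I S \<union> {i, j} \<subseteq> I (insert b S)" using ij unfolding I_def by blast
    then have "card (I S \<union> {i, j}) \<le> card (I (insert b S))" by (rule card_mono[OF fI])
    moreover have "card (I S \<union> {i, j}) = card (I S) + card {i, j}"
      by (rule card_Un_disjoint) (use ij(1,2) fI in blast)+
    moreover have "card {i, j} = 2" using ne by simp
    moreover have "card (insert b S) = card S + 1" using bS fS by simp
    moreover have "insert b S \<subseteq> B" using b S(1) by blast
    ultimately have "P (insert b S)" unfolding P_def using S(3) Sa by linarith
    then have "card (insert b S) \<le> card S" by (rule max)
    then show False using bS fS by simp
  qed
  have cJ: "card J \<le> card (J - I S) + 2 * a"
    using diff_card_le_card_Diff[of "I S" J] fI[of S] IS by linarith
  show ?thesis
  proof (rule that[of "J - I S"])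
    show "i = j" if "b \<in> B" "i \<in> J - I S" "j \<in> J - I S" "hits b (\<kappa> i)" "hits b (\<kappa> j)" for b i j
      by (rule uniq[OF that])
    show "J - I S \<subseteq> J" by blast
    show "card J \<le> card (J - I S) + 2 * a" by (rule cJ)
  qed
qed

text \<open>By connectedness an edge leaves the clique, and it can lead neither to \<open>A\<close>
  nor to another clique.\<close>

lemma clique_hit:
  assumes "c \<in> C" obtains b where "b \<in> B" "hits b c"
proof -
  let ?K = "{c'. same_clique c c'}"
  obtain x where x: "x \<in> A" using A(3) unfolding has_p3_def by blast
  have "?K \<subseteq> V" using same_clique_C[of c] C_V by blast
  moreover have "x \<notin> ?K" using x same_clique_C[of c x] unfolding C_def by blast
  then have "?K \<noteq> V" using x A(1) by blast
  moreover have "?K \<noteq> {}" using same_clique_refl[OF assms] by blast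
  ultimately obtain u v where uv: "same_clique c u" "\<not> same_clique c v" "E u v"
    using conn unfolding conn_def by blast
  have "\<not> same_clique u v" using same_clique_trans[OF uv(1), of v] uv(2) by blast
  then have "v \<in> B" using E_C_cases[OF _ uv(3)] same_clique_C[OF uv(1)] by blast
  moreover have "hits v c" unfolding hits_def using uv(1) sym[OF uv(3)] by blast
  ultimately show ?thesis using that by blast
qed

text \<open>The last two vertices of a leg lie in its clique. A vertex that touches them lies in the
  clique or is a vertex of \<open>B\<close> that hits it; as the cliques are different and hits are
  unique, it touches no second leg.\<close>

lemma leg_familyI:
  fixes J :: "'i set"
  assumes J: "finite J" "4 * k + 10 \<le> card J"
    and leg: "\<And>i. i \<in> J \<Longrightarrow> ip3 (b i) (z i) (y i)" "\<And>i. i \<in> J \<Longrightarrow> same_clique (\<kappa> i) (z i)" "\<And>i. i \<in> J \<Longrightarrow> same_clique (\<kappa> i) (y i)"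
    and \<kappa>: "\<And>i j. i \<in> J \<Longrightarrow> j \<in> J \<Longrightarrow> i \<noteq> j \<Longrightarrow> \<not> same_clique (\<kappa> i) (\<kappa> j)"
    and hit: "\<And>v i j. v \<in> B \<Longrightarrow> i \<in> J \<Longrightarrow> j \<in> J \<Longrightarrow> hits v (\<kappa> i) \<Longrightarrow> hits v (\<kappa> j) \<Longrightarrow> i = j"
    and indep: "\<And>i j. i \<in> J \<Longrightarrow> j \<in> J \<Longrightarrow> i \<noteq> j \<Longrightarrow> b i \<noteq> b j \<and> \<not> E (b i) (b j)"
    and att: "\<And>i. i \<in> J \<Longrightarrow> \<exists>d\<in>D. \<exists>d'\<in>D. d \<noteq> d' \<and>
      (\<forall>d\<in>{d, d'}. (d = z i \<or> d = b i \<or> E d (z i) \<or> E d (b i)) \<and> (\<forall>j\<in>J. j \<noteq> i \<longrightarrow> \<not> E d (b j)))"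
  shows "leg_family V E k J b z y D"
proof unfold_locales
  show "i = j" if ij: "i \<in> J" "j \<in> J" and t: "touch v (z i) (y i)" "touch v (z j) (y j)" for v i j
  proof (rule ccontr)
    assume ne: "i \<noteq> j"
    have nb: "\<exists>c. same_clique (\<kappa> l) c \<and> (v = c \<or> E v c)" if "l \<in> J" "touch v (z l) (y l)" for l
      using leg(2,3)[OF that(1)] that(2) unfolding touch_def by blast
    obtain c c' where c: "same_clique (\<kappa> i) c" "v = c \<or> E v c" "same_clique (\<kappa> j) c'" "v = c' \<or> E v c'"
      using nb[OF ij(1) t(1)] nb[OF ij(2) t(2)] by blast
    have cC: "c \<in> C" "c' \<in> C" using same_clique_C[OF c(1)] same_clique_C[OF c(3)] by blast+
    show False
    proof (cases "v \<in> B")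
      case True
      then have "v \<noteq> c" "v \<noteq> c'" using cC unfolding B_def by blast+
      then have "hits v (\<kappa> i)" "hits v (\<kappa> j)" unfolding hits_def using c by blast+
      then show False using hit[OF True ij] ne by blast
    next
      case False
      have "v \<in> C"
      proof (cases "v = c")
        case True then show ?thesis using cC by simp
      next
        case ne: False
        then have "E c v" using c(2) sym[of v c] by blast
        then show ?thesis using E_C_cases[OF cC(1)] False same_clique_C[of c v] by blast
      qed
      then have "same_clique c v" "same_clique v c'"
        using c(2,4) cC same_clique_sym[of v c] unfolding same_clique_def using sym[of v c] by blast+
      then have "same_clique (\<kappa> i) (\<kappa> j)" using same_clique_trans[OF c(1)] same_clique_trans[of c v c'] same_clique_trans[of "\<kappa> i" c' "\<kappa> j"]
          same_clique_sym[OF c(3)] by blast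
      then show False using \<kappa>[OF ij ne] by blast
    qed
  qed
  show no_inst by (rule no)
  show "p4kp3_free k" by (rule free)
  show "conn V" by (rule conn)
  show "tds D" by (rule D(1))
  show "card D \<le> card D'" if "tds D'" for D' by (rule D(2)[OF that])
qed (fact J leg(1) indep att)+

section \<open>Edges of the minimum set that avoid A and have an end among its neighbours\<close>

definition b_ends :: "'a set" where "b_ends = {b \<in> D \<inter> B. mate b \<notin> A}"

text \<open>As \<open>q j\<close> is a private neighbour of \<open>mate j\<close> with respect to
  \<open>S\<close>, the vertices \<open>q j\<close>, \<open>mate j\<close>, \<open>j\<close> form an
  induced path. That \<open>q j\<close> itself belongs to \<open>S\<close> is the invariant that
  keeps later private neighbours away from it.\<close>

definition legs :: "'a set \<Rightarrow> 'a set \<Rightarrow> ('a \<Rightarrow> 'a) \<Rightarrow> bool" where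
  "legs S J q \<longleftrightarrow> S \<subseteq> D \<union> q ` J \<and> dominates_C S \<and> J \<subseteq> b_ends \<and>
     (\<forall>j\<in>J. j \<in> S \<and> mate j \<in> S \<and> mate j \<notin> J \<and> q j \<in> S \<and> q j \<in> C \<and> E (q j) (mate j) \<and>
       (\<forall>s\<in>S. E (q j) s \<longrightarrow> s = mate j))"

lemma legsD:
  assumes "legs S J q"
  shows "S \<subseteq> D \<union> q ` J" "dominates_C S" "J \<subseteq> b_ends" "J \<subseteq> D" "finite J" "S \<subseteq> V"
    "\<And>j. j \<in> J \<Longrightarrow> j \<in> S" "\<And>j. j \<in> J \<Longrightarrow> mate j \<in> S" "\<And>j. j \<in> J \<Longrightarrow> mate j \<notin> J"
    "\<And>j. j \<in> J \<Longrightarrow> q j \<in> S" "\<And>j. j \<in> J \<Longrightarrow> q j \<in> C" "\<And>j. j \<in> J \<Longrightarrow> E (q j) (mate j)"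
    "\<And>j s. j \<in> J \<Longrightarrow> s \<in> S \<Longrightarrow> E (q j) s \<Longrightarrow> s = mate j"
    "\<And>j. j \<in> J \<Longrightarrow> q j \<notin> D"
proof -
  note l = assms[unfolded legs_def]
  show 1: "S \<subseteq> D \<union> q ` J" using l by (rule conjunct1)
  note l = l[THEN conjunct2]
  show "dominates_C S" using l by (rule conjunct1)
  note l = l[THEN conjunct2]
  show 3: "J \<subseteq> b_ends" using l by (rule conjunct1)
  then show JD: "J \<subseteq> D" unfolding b_ends_def by auto
  show "finite J" using finite_subset[OF JD finD] .
  note l = bspec[OF l[THEN conjunct2]]
  show "j \<in> S" "mate j \<in> S" "mate j \<notin> J" "q j \<in> S" "E (q j) (mate j)" if "j \<in> J" for j
    using l[OF that] by simp_all
  show qC: "q j \<in> C" if "j \<in> J" for j using l[OF that] by simp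
  show "s = mate j" if "j \<in> J" "s \<in> S" "E (q j) s" for j s using l[OF that(1)] that(2,3) by simp
  show "S \<subseteq> V" using 1 DV qC C_V by auto
  show "q j \<notin> D" if j: "j \<in> J" for j
  proof
    assume qD: "q j \<in> D"
    have jD: "j \<in> D" and jB: "j \<in> B" using 3 j unfolding b_ends_def by auto
    have "mate j = mate (q j)" using mate_eq[OF qD mate(1)[OF jD]] l[OF j] by simp
    then have "j = q j" using mate_inj[OF jD qD] by simp
    then show False using qC[OF j] jB unfolding B_def by simp
  qed
qed

text \<open>Each step makes the current set minimal, picks an edge of \<open>D\<close> that is still present, and adds a
  private neighbour of its other end, so that later private neighbours lie in other cliques.\<close>

lemma legs_ex:
  assumes "2 * a + 4 * M < card b_ends"
  shows "\<exists>S J q. legs S J q \<and> card J = M"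
  using assms
proof (induction M)
  case 0
  have "legs D {} (\<lambda>x. x)" unfolding legs_def using dominates_C_D by simp
  then show ?case by (intro exI[of _ D] exI[of _ "{}"] exI[of _ "\<lambda>x. x"]) simp
next
  case (Suc M)
  then obtain S J q where l: "legs S J q" and cJ: "card J = M" by auto
  note lD = legsD[OF l]
  define W where "W = J \<union> mate ` J \<union> q ` J"
  have "W \<subseteq> S" unfolding W_def using lD(7,8,10) by auto
  then obtain S' where S': "W \<subseteq> S'" "S' \<subseteq> S" "dominates_C S'" and min: "\<And>u. u \<in> S' - W \<Longrightarrow> \<not> dominates_C (S' - {u})"
    using dominates_C_minimal[OF lD(2) _ lD(6)] by metis
  have S'V: "S' \<subseteq> V" using S'(2) lD(6) by simp
  have finS': "finite S'" using finite_subset[OF S'V fin] .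
  have "S' \<subseteq> (D \<inter> S') \<union> q ` J" using S'(2) lD(1) by auto
  then have "card S' \<le> card ((D \<inter> S') \<union> q ` J)" using finD lD(5) by (intro card_mono) auto
  also have "\<dots> \<le> card (D \<inter> S') + M"
    using card_Un_le[of "D \<inter> S'" "q ` J"] card_image_le[OF lD(5), of q] cJ by linarith
  finally have "card D + 1 \<le> card (D \<inter> S') + M + a" using slack[OF S'V S'(3)] by linarith
  moreover have "card D = card (D \<inter> S') + card (D - S')"
    using card_Int_Diff[OF finD, of S'] .
  ultimately have miss: "card (D - S') < a + M" by linarith
  \<comment> \<open>The ends to avoid: those of edges no longer complete in \<open>S'\<close> and
    those already used. There are at most \<open>2 * (a + M) + 2 * M\<close> of them, which explains
    the bound on \<open>card b_ends\<close>.\<close>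
  let ?X = "(D - S') \<union> mate ` (D - S') \<union> J \<union> mate ` J"
  have "card ?X \<le> card (D - S') + card (D - S') + M + M"
    using card_Un_le[of "(D - S') \<union> mate ` (D - S') \<union> J" "mate ` J"]
      card_Un_le[of "(D - S') \<union> mate ` (D - S')" J] card_Un_le[of "D - S'" "mate ` (D - S')"]
      card_image_le[of "D - S'" mate] card_image_le[OF lD(5), of mate] finD cJ by simp
  moreover have "2 * a + 4 * M < card b_ends" using Suc.prems by simp
  ultimately have cX: "card ?X < card b_ends" using miss by linarith
  have "finite ?X" using finD lD(5) by simp
  then have "\<not> b_ends \<subseteq> ?X" using cX card_mono[of ?X b_ends] by linarith
  then obtain b where b: "b \<in> b_ends" "b \<notin> ?X" by auto
  have bD: "b \<in> D" and bB: "b \<in> B" using b(1) unfolding b_ends_def by auto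
  have bS: "b \<in> S'" using b(2) bD by auto
  have mS: "mate b \<in> S'"
  proof (rule ccontr)
    assume "mate b \<notin> S'"
    then have "mate (mate b) \<in> mate ` (D - S')" using mate(1)[OF bD] by simp
    then show False using b(2) mate_mate[OF bD] by simp
  qed
  have mJ: "mate b \<notin> J"
  proof
    assume "mate b \<in> J"
    then have "mate (mate b) \<in> mate ` J" by simp
    then show False using b(2) mate_mate[OF bD] by simp
  qed
  have mne: "mate b \<noteq> mate j" if "j \<in> J" for j
    using mate_inj[OF bD, of j] that lD(4) b(2) by auto
  have mW: "mate b \<notin> W" unfolding W_def using mJ mne lD(14) mate(1)[OF bD] by auto
  obtain c where c: "c \<in> C" "E c (mate b)" "\<And>s. s \<in> S' \<Longrightarrow> E c s \<Longrightarrow> s = mate b"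
    using dominates_C_private[OF S'(3) min[of "mate b"]] mS mW by auto
  have cJq: "\<not> E c (q j)" if j: "j \<in> J" for j
  proof
    assume "E c (q j)"
    then have "q j = mate b" using c(3)[of "q j"] S'(1) j unfolding W_def by auto
    then show False using lD(14)[OF j] mate(1)[OF bD] by simp
  qed
  have "legs (insert c S') (insert b J) (q(b := c))"
    unfolding legs_def
  proof (intro conjI ballI impI)
    show "insert c S' \<subseteq> D \<union> q(b := c) ` insert b J" using S'(2) lD(1) b(2) by auto
    show "dominates_C (insert c S')" using S'(3) unfolding dominates_C_def by auto
    show "insert b J \<subseteq> b_ends" using b(1) lD(3) by simp
    fix j assume j: "j \<in> insert b J"
    have jb: "j \<in> J" "j \<noteq> b" if "j \<noteq> b" using j that by simp_all
    have jS: "j \<in> S'" "mate j \<in> S'" "q j \<in> S'" if "j \<in> J" for j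
      using S'(1) that unfolding W_def by auto
    show "j \<in> insert c S'" "mate j \<in> insert c S'"
      using jS[of j] bS mS jb by auto
    show "mate j \<notin> insert b J"
    proof (cases "j = b")
      case True
      then show ?thesis using mJ mate(4)[OF bD] by simp
    next
      case False
      then show ?thesis using lD(9)[OF jb(1)] b(2) jb by auto
    qed
    show "(q(b := c)) j \<in> insert c S'" "(q(b := c)) j \<in> C" "E ((q(b := c)) j) (mate j)"
      using jS[of j] jb c lD(11,12)[of j] by auto
    fix s assume s: "s \<in> insert c S'" "E ((q(b := c)) j) s"
    show "s = mate j"
    proof (cases "j = b")
      case True
      then show ?thesis using s c(3)[of s] irr[of c] by auto
    next
      case False
      then have "s \<noteq> c" using s(2) cJq[OF jb(1)] sym[of "q j" c] by auto
      then show ?thesis using s False lD(13)[OF jb(1), of s] S'(2) by auto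
    qed
  qed
  moreover have "card (insert b J) = Suc M" using b(2) lD(5) cJ by simp
  ultimately show ?case by blast
qed

lemma anti_Un: "anti (X \<union> X') Y \<longleftrightarrow> anti X Y \<and> anti X' Y"
  unfolding anti_def by blast

lemma anti_mono: "anti X Y \<Longrightarrow> X' \<subseteq> X \<Longrightarrow> anti X' Y"
  unfolding anti_def by blast

text \<open>An edge of \<open>D\<close> gets private neighbours twice: \<open>q j\<close> for
  \<open>mate j\<close>, and then \<open>p j\<close> for \<open>j\<close>. They are adjacent, since
  otherwise \<open>p j\<close>, \<open>j\<close>, \<open>mate j\<close>, \<open>q j\<close> is an
  induced P4 far from most of the other paths. So \<open>j\<close>, \<open>p j\<close>,
  \<open>q j\<close> is a leg whose last two vertices share a clique.\<close>

lemma b_family: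
  assumes big: "2 * a + 4 * (4 * k + 10 + 6 * a + k + 2) < card b_ends"
  shows "\<exists>J b z y. leg_family V E k (J :: 'a set) b z y D"
proof -
  \<comment> \<open>Of these paths at most \<open>2 * a\<close> are lost when \<open>D1\<close> is
    chosen and \<open>2 * a\<close> more in \<open>units_reduce\<close>, which leaves
    \<open>4 * k + 10\<close>; before the second loss there are enough for
    \<open>few\<close>.\<close>
  obtain S J0 q where l: "legs S J0 q" and cJ0: "card J0 = 4 * k + 10 + 6 * a + k + 2"
    using legs_ex[OF big] by auto
  note lD = legsD[OF l]
  obtain D1 where D1: "D1 \<subseteq> D" "dominates_C D1" and min: "\<And>u. u \<in> D1 \<Longrightarrow> \<not> dominates_C (D1 - {u})"
    using dominates_C_minimal[OF dominates_C_D _ DV, of "{}"] by auto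
  have "card D + 1 \<le> card D1 + a" using slack[of D1] D1 DV by auto
  then have miss: "card (D - D1) \<le> a"
    using card_Diff_subset[OF finite_subset[OF D1(1) finD] D1(1)] by linarith
  define J where "J = J0 - (D - D1) - mate ` (D - D1)"
  have JJ0: "J \<subseteq> J0" unfolding J_def by auto
  have finJ: "finite J" using finite_subset[OF JJ0 lD(5)] .
  have "card J0 - card (D - D1) - card (mate ` (D - D1)) \<le> card J"
    using diff_card_le_card_Diff[of "D - D1" J0] diff_card_le_card_Diff[of "mate ` (D - D1)" "J0 - (D - D1)"] finD
    unfolding J_def by simp
  then have cJ: "4 * k + 10 + 4 * a + k + 2 \<le> card J"
    using miss card_image_le[of "D - D1" mate] finD cJ0 by simp
  have jD: "j \<in> D" "j \<in> B" if "j \<in> J" for j using that JJ0 lD(3) unfolding b_ends_def by auto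
  have jD1: "j \<in> D1" "mate j \<in> D1" if j: "j \<in> J" for j
  proof -
    show "j \<in> D1" using j jD(1)[OF j] unfolding J_def by auto
    show "mate j \<in> D1"
    proof (rule ccontr)
      assume "mate j \<notin> D1"
      then have "mate (mate j) \<in> mate ` (D - D1)" using mate(1)[OF jD(1)[OF j]] by simp
      then show False using j mate_mate[OF jD(1)[OF j]] unfolding J_def by simp
    qed
  qed
  have jne: "i \<noteq> mate j" "mate i \<noteq> j" if "i \<in> J" "j \<in> J" for i j
    using lD(9)[of i] lD(9)[of j] that JJ0 by auto
  have mne: "mate i \<noteq> mate j" if "i \<in> J" "j \<in> J" "i \<noteq> j" for i j
    using mate_inj[of i j] jD that by auto
  have qC: "q j \<in> C" "E (q j) (mate j)" "q j \<notin> D" if "j \<in> J" for j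
    using lD(11,12,14)[of j] that JJ0 by auto
  have qS: "s = mate j" if "j \<in> J" "s \<in> S" "E (q j) s" for j s using lD(13)[of j s] that JJ0 by auto
  have inS: "j \<in> S" "mate j \<in> S" "q j \<in> S" if "j \<in> J" for j using lD(7,8,10)[of j] that JJ0 by auto
  have nqb: "\<not> E (q i) j" if "i \<in> J" "j \<in> J" for i j using qS[OF that(1) inS(1)[OF that(2)]] jne[of j i] that by auto
  have nqm: "\<not> E (q i) (mate j)" if "i \<in> J" "j \<in> J" "i \<noteq> j" for i j
    using qS[OF that(1) inS(2)[OF that(2)]] mne[OF that] by auto
  have nqq: "\<not> same_clique (q i) (q j)" if ij: "i \<in> J" "j \<in> J" "i \<noteq> j" for i j
  proof
    assume "same_clique (q i) (q j)"
    then consider "q i = q j" | "E (q i) (q j)" unfolding same_clique_def by auto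
    then show False
    proof cases
      case 1 then show False using nqm[OF ij] qC(2)[OF ij(2)] by simp
    next
      case 2 then show False using qS[OF ij(1) inS(3)[OF ij(2)] 2] qC(3)[OF ij(2)] mate(1)[OF jD(1)[OF ij(1)]] by simp
    qed
  qed
  have CB: "c \<noteq> b" if "c \<in> C" "b \<in> B" for c b using that unfolding B_def by auto
  have CD1: "c \<noteq> mate j" if "c \<in> C" "j \<in> J" "\<not> E c j" for c j
    using that mate(3)[OF jD(1)[OF that(2)]] by auto
  have nD: "\<not> E u v" if u: "u \<in> {i, mate i}" "v \<in> {j, mate j}" and ij: "i \<in> J" "j \<in> J" "i \<noteq> j" for u v i j
  proof
    assume E: "E u v"
    have uD: "u \<in> D" "mate u \<in> {i, mate i}" using u(1) jD(1)[OF ij(1)] mate(1)[of i] mate_mate[of i] by auto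
    have vD: "v \<in> D" using u(2) jD(1)[OF ij(2)] mate(1)[of j] by auto
    have "v = mate u" using mate_eq[OF uD(1) vD E] .
    then show False using uD(2) u(2) ij(3) jne[OF ij(1,2)] jne[OF ij(2,1)] mne[OF ij] by auto
  qed
  have anti_qmj: "anti {q i, mate i, i} {q j, mate j, j}" if ij: "i \<in> J" "j \<in> J" "i \<noteq> j" for i j
  proof -
    have "u \<noteq> v \<and> \<not> E u v" if uv: "u \<in> {q i, mate i, i}" "v \<in> {q j, mate j, j}" for u v
    proof (cases "u = q i")
      case True
      then show ?thesis
        using uv(2) nqq[OF ij] nqm[OF ij] nqb[OF ij(1,2)] qC(1,3)[OF ij(1)] qC(1)[OF ij(2)] jD(1)[OF ij(2)]
          mate(1)[OF jD(1)[OF ij(2)]] unfolding same_clique_def by auto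
    next
      case uq: False
      show ?thesis
      proof (cases "v = q j")
        case True
        then show ?thesis
          using uv(1) uq nqm[OF ij(2,1)] nqb[OF ij(2,1)] qC(3)[OF ij(2)] jD(1)[OF ij(1)] ij(3)
            mate(1)[OF jD(1)[OF ij(1)]] sym[of u v] by auto
      next
        case False
        then have uv': "u \<in> {i, mate i}" "v \<in> {j, mate j}" using uv uq by auto
        then show ?thesis using nD[OF uv' ij] ij(3) jne[OF ij(1,2)] jne[OF ij(2,1)] mne[OF ij] by auto
      qed
    qed
    then show ?thesis unfolding anti_def by (intro ballI)
  qed
  have leg: "ip3 (q j) (mate j) j" if j: "j \<in> J" for j
    unfolding ip3_def using qC[OF j] mate(3)[OF jD(1)[OF j]] nqb[OF j j] jD(1)[OF j] by auto
  \<comment> \<open>Besides the paths in \<open>L\<close>, only one path can have its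
    \<open>q l\<close> in the clique of \<open>c\<close>; the other ones complete the P4 to the
    excluded subgraph.\<close>
  have few: False
    if p4: "ip4 u v w x" and sub: "{u, v, w, x} \<subseteq> X" and L: "L \<subseteq> J" "card L \<le> 2 * a + 1"
      and c: "c \<in> C" and a: "\<And>l. l \<in> J - L \<Longrightarrow> \<not> same_clique c (q l) \<Longrightarrow> anti X {q l, mate l, l}" for u v w x X L c
  proof -
    let ?Z = "{l \<in> J. same_clique c (q l)}"
    have "card ?Z \<le> 1"
    proof (rule card_le_1I, rule ccontr)
      fix i j assume ij: "i \<in> ?Z" "j \<in> ?Z" "i \<noteq> j"
      then have "same_clique (q i) (q j)" using same_clique_trans[OF same_clique_sym, of c "q i" "q j"] by simp
      then show False using nqq[of i j] ij by simp
    qed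
    moreover have "card J - card L - card ?Z \<le> card (J - L - ?Z)"
      using diff_card_le_card_Diff[of L J] diff_card_le_card_Diff[of ?Z "J - L"] finJ finite_subset[OF L(1) finJ]
      by auto
    ultimately have k: "k \<le> card (J - L - ?Z)" using L(2) cJ by linarith
    show False
    proof (rule p4kp3_freeD[OF free p4 _ k])
      show "finite (J - L - ?Z)" using finJ by simp
      show "ip3 (q l) (mate l) l" if "l \<in> J - L - ?Z" for l using leg that by simp
      show "anti {u, v, w, x} {q l, mate l, l}" if "l \<in> J - L - ?Z" for l
        using anti_mono[OF a sub] that by auto
      show "anti {q i, mate i, i} {q j, mate j, j}" if "i \<in> J - L - ?Z" "j \<in> J - L - ?Z" "i \<noteq> j" for i j
        using anti_qmj that by simp
    qed
  qed
  have "\<forall>j\<in>J. \<exists>p. p \<in> C \<and> E p j \<and> (\<forall>s\<in>D1. E p s \<longrightarrow> s = j)"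
  proof
    fix j assume j: "j \<in> J"
    obtain p where "p \<in> C" "E p j" "\<And>s. s \<in> D1 \<Longrightarrow> E p s \<Longrightarrow> s = j"
      using dominates_C_private[OF D1(2) min[OF jD1(1)[OF j]]] by blast
    then show "\<exists>p. p \<in> C \<and> E p j \<and> (\<forall>s\<in>D1. E p s \<longrightarrow> s = j)" by blast
  qed
  then obtain p where "\<forall>j\<in>J. p j \<in> C \<and> E (p j) j \<and> (\<forall>s\<in>D1. E (p j) s \<longrightarrow> s = j)"
    using bchoice[of J "\<lambda>j p. p \<in> C \<and> E p j \<and> (\<forall>s\<in>D1. E p s \<longrightarrow> s = j)"] by blast
  then have pC: "p j \<in> C" "E (p j) j" and pD1: "\<And>s. s \<in> D1 \<Longrightarrow> E (p j) s \<Longrightarrow> s = j" if "j \<in> J" for j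
    using that by auto
  have pl: "anti {p j} {q l, mate l, l}" if "j \<in> J" "l \<in> J" "j \<noteq> l" "\<not> same_clique (p j) (q l)" for j l
  proof -
    have "\<not> E (p j) l" "\<not> E (p j) (mate l)"
      using pD1[OF that(1) jD1(1)[OF that(2)]] pD1[OF that(1) jD1(2)[OF that(2)]] that jne[OF that(1,2)] by auto
    moreover have "p j \<noteq> mate l" using CD1[OF pC(1)[OF that(1)] that(2)] calculation by simp
    moreover have "p j \<noteq> l" using CB[OF pC(1)[OF that(1)] jD(2)[OF that(2)]] .
    moreover have "p j \<noteq> q l" "\<not> E (p j) (q l)"
      using that(4) pC(1)[OF that(1)] qC(1)[OF that(2)] unfolding same_clique_def by blast+
    ultimately show ?thesis unfolding anti_def by blast
  qed
  have pq: "E (p j) (q j)" if j: "j \<in> J" for j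
  proof (rule ccontr)
    assume n: "\<not> E (p j) (q j)"
    have pm: "p j \<noteq> mate j" using n qC(2)[OF j] sym[of "q j" "mate j"] by auto
    have npm: "\<not> E (p j) (mate j)" using pD1[OF j jD1(2)[OF j]] mate(4)[OF jD(1)[OF j]] by auto
    have "ip4 (p j) j (mate j) (q j)"
      unfolding ip4_def
      using pC(2)[OF j] mate(2)[OF jD(1)[OF j]] sym[OF qC(2)[OF j]] npm n nqb[OF j j] sym[of j "q j"] by auto
    then show False
    proof (rule few[of _ _ _ _ "{p j} \<union> {q j, mate j, j}" "{j}" "p j"])
      show "{p j, j, mate j, q j} \<subseteq> {p j} \<union> {q j, mate j, j}" by auto
      show "{j} \<subseteq> J" "card {j} \<le> 2 * a + 1" using j by auto
      show "p j \<in> C" using pC(1)[OF j] .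
      show "anti ({p j} \<union> {q j, mate j, j}) {q l, mate l, l}" if "l \<in> J - {j}" "\<not> same_clique (p j) (q l)" for l
        unfolding anti_Un using pl[OF j, of l] anti_qmj[OF j, of l] that by (intro conjI) blast+
    qed
  qed
  have clpq: "same_clique (p j) (q j)" if "j \<in> J" for j using E_same_clique[OF pq[OF that] pC(1)[OF that] qC(1)[OF that]] .
  \<comment> \<open>If \<open>c\<close> were dominated by edges of \<open>L\<close> only, it would
    see \<open>i\<close> or \<open>mate i\<close> for some \<open>i\<close> in \<open>L\<close>.
    Then \<open>c\<close>, \<open>i\<close>, \<open>p i\<close>, \<open>q i\<close> or
    \<open>c\<close>, \<open>mate i\<close>, \<open>i\<close>, \<open>p i\<close> is an induced P4,
    against \<open>few\<close>.\<close>
  have u: "units J q"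
    unfolding units_def
  proof (intro conjI ballI allI impI)
    show "J \<subseteq> D" using jD by auto
    show "q i \<in> C" "mate i \<notin> J" if "i \<in> J" for i using qC(1)[OF that] lD(9)[of i] that JJ0 by auto
    show "\<not> same_clique (q i) (q j)" if "i \<in> J" "j \<in> J" "i \<noteq> j" for i j using nqq[OF that] .
    fix L c assume L: "L \<subseteq> J" "card L \<le> 2 * a" and c: "c \<in> C" "\<forall>i\<in>L. \<not> same_clique (q i) c"
    show "\<exists>s\<in>D - (L \<union> mate ` L). E c s"
    proof (rule ccontr)
      assume neg: "\<not> ?thesis"
      obtain s where s: "s \<in> D" "E c s" using dominates_C_D c(1) unfolding dominates_C_def by auto
      then obtain i where i: "i \<in> L" "s = i \<or> s = mate i" using neg by auto
      have iJ: "i \<in> J" using i L by auto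
      let ?X = "{c} \<union> ({p i} \<union> {q i, mate i, i})"
      have nc: "\<not> same_clique c (p i)" "\<not> same_clique c (q i)"
        using c(2) i(1) same_clique_sym[of c "q i"] same_clique_trans[of c "p i" "q i"] clpq[OF iJ] by auto
      then have nE: "\<not> E c (p i)" "\<not> E c (q i)" using c(1) pC(1)[OF iJ] qC(1)[OF iJ] unfolding same_clique_def by auto
      have aX: "anti ?X {q l, mate l, l}" if l: "l \<in> J - L" "\<not> same_clique c (q l)" for l
      proof -
        have lJ: "l \<in> J" and il: "i \<noteq> l" using l i by auto
        have "l \<notin> L \<union> mate ` L" "mate l \<notin> L \<union> mate ` L"
          using l L(1) lD(9) JJ0 mne[of l] jne[of l] jne[OF _ lJ] by auto
        then have "\<not> E c l" "\<not> E c (mate l)" using neg jD(1)[OF lJ] mate(1)[OF jD(1)[OF lJ]] by auto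
        moreover have "c \<noteq> mate l" using CD1[OF c(1) lJ] calculation by simp
        moreover have "c \<noteq> l" using CB[OF c(1) jD(2)[OF lJ]] .
        moreover have "c \<noteq> q l" "\<not> E c (q l)" using l(2) c(1) qC(1)[OF lJ] unfolding same_clique_def by blast+
        ultimately have ac: "anti {c} {q l, mate l, l}" unfolding anti_def by blast
        have ncl: "\<not> same_clique (p i) (q l)" using nqq[OF iJ lJ il] same_clique_trans[OF same_clique_sym[OF clpq[OF iJ]], of "q l"] by auto
        have ap: "anti {p i} {q l, mate l, l}" using pl[OF iJ lJ il ncl] .
        show ?thesis unfolding anti_Un using ac ap anti_qmj[OF iJ lJ il] by (intro conjI)
      qed
      have L': "card L \<le> 2 * a + 1" using L(2) by simp
      show False
      proof (cases "E c i")
        case True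
        have "ip4 c i (p i) (q i)"
          unfolding ip4_def using True sym[OF pC(2)[OF iJ]] pq[OF iJ] nE nqb[OF iJ iJ] sym[of i "q i"] by auto
        then show False by (rule few[OF _ _ L(1) L' c(1) aX]) auto
      next
        case False
        then have cm: "E c (mate i)" using s i by auto
        have pm: "p i \<noteq> mate i" using nE(1) cm by auto
        have npm: "\<not> E (mate i) (p i)"
          using pD1[OF iJ jD1(2)[OF iJ]] mate(4)[OF jD(1)[OF iJ]] sym[of "mate i" "p i"] by auto
        have "ip4 c (mate i) i (p i)"
          unfolding ip4_def using cm mate(3)[OF jD(1)[OF iJ]] sym[OF pC(2)[OF iJ]] False npm nE(1) by auto
        then show False by (rule few[OF _ _ L(1) L' c(1) aX]) auto
      qed
    qed
  qed
  obtain J2 where J2: "J2 \<subseteq> J" "card J \<le> card J2 + 2 * a"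
    and hit: "\<And>b i j. b \<in> B \<Longrightarrow> i \<in> J2 \<Longrightarrow> j \<in> J2 \<Longrightarrow> hits b (q i) \<Longrightarrow> hits b (q j) \<Longrightarrow> i = j"
    using units_reduce[OF u] by metis
  have "leg_family V E k J2 (\<lambda>j. j) p q D"
  proof (rule leg_familyI[where \<kappa> = q])
    show "finite J2" using finite_subset[OF J2(1) finJ] .
    show "4 * k + 10 \<le> card J2" using J2(2) cJ by linarith
  next
    fix i assume i2: "i \<in> J2"
    then have i: "i \<in> J" using J2(1) by auto
    show "ip3 i (p i) (q i)"
      unfolding ip3_def using sym[OF pC(2)[OF i]] pq[OF i] nqb[OF i i] sym[of i "q i"] qC(3)[OF i] jD(1)[OF i] by auto
    show "same_clique (q i) (p i)" using same_clique_sym[OF clpq[OF i]] .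
    show "same_clique (q i) (q i)" using same_clique_refl[OF qC(1)[OF i]] .
    show "\<exists>d\<in>D. \<exists>d'\<in>D. d \<noteq> d' \<and> (\<forall>d\<in>{d, d'}. (d = p i \<or> d = i \<or> E d (p i) \<or> E d i) \<and>
        (\<forall>j\<in>J2. j \<noteq> i \<longrightarrow> \<not> E d j))"
    proof (rule bexI[of _ i], rule bexI[of _ "mate i"], intro conjI ballI impI)
      show "i \<noteq> mate i" using mate(4)[OF jD(1)[OF i]] by auto
      show "d = p i \<or> d = i \<or> E d (p i) \<or> E d i" if "d \<in> {i, mate i}" for d
        using that mate(3)[OF jD(1)[OF i]] by auto
      show "\<not> E d j" if "d \<in> {i, mate i}" "j \<in> J2" "j \<noteq> i" for d j
        using nD[OF that(1), of j j] i that J2(1) by auto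
    qed (use jD(1)[OF i] mate(1)[OF jD(1)[OF i]] in auto)
  next
    show "\<not> same_clique (q i) (q j)" if "i \<in> J2" "j \<in> J2" "i \<noteq> j" for i j using nqq[of i j] that J2(1) by auto
    show "i = j" if "v \<in> B" "i \<in> J2" "j \<in> J2" "hits v (q i)" "hits v (q j)" for v i j using hit[OF that] .
    show "i \<noteq> j \<and> \<not> E i j" if "i \<in> J2" "j \<in> J2" "i \<noteq> j" for i j
      using nD[of i i j j] that J2(1) by auto
  qed
  then show ?thesis by blast
qed

section \<open>Edges of the minimum set inside the cliques\<close>

definition c_ends :: "'a set" where "c_ends = {u \<in> D \<inter> C. mate u \<in> C}"

text \<open>A largest choice of ends without matched pairs contains an end of every edge.\<close>

lemma c_reps:
  obtains R where "R \<subseteq> c_ends" "\<forall>u\<in>R. mate u \<notin> R" "card c_ends \<le> 2 * card R"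
proof -
  define P where "P R \<longleftrightarrow> R \<subseteq> c_ends \<and> (\<forall>u\<in>R. mate u \<notin> R)" for R
  have cD: "c_ends \<subseteq> D" unfolding c_ends_def by auto
  have fc: "finite c_ends" using finite_subset[OF cD finD] .
  have "P {}" unfolding P_def by simp
  moreover have "\<forall>R. P R \<longrightarrow> card R < card c_ends + 1"
    using card_mono[OF fc] unfolding P_def by (simp add: less_Suc_eq_le)
  ultimately obtain R where PR: "P R" and max: "\<And>R'. P R' \<Longrightarrow> card R' \<le> card R"
    using ex_has_greatest_nat[of P "{}" card "card c_ends + 1"] by blast
  have R: "R \<subseteq> c_ends" "\<forall>u\<in>R. mate u \<notin> R" using PR unfolding P_def by auto
  have fR: "finite R" using finite_subset[OF R(1) fc] .
  have "c_ends \<subseteq> R \<union> mate ` R"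
  proof
    fix u assume u: "u \<in> c_ends"
    then have uD: "u \<in> D" using cD by auto
    show "u \<in> R \<union> mate ` R"
    proof (rule ccontr)
      assume n: "u \<notin> R \<union> mate ` R"
      have mR: "mate u \<notin> R"
      proof
        assume "mate u \<in> R"
        then have "mate (mate u) \<in> mate ` R" by simp
        then show False using n mate_mate[OF uD] by simp
      qed
      have "P (insert u R)"
        unfolding P_def using u R n mR mate(4)[OF uD] by auto
      then have "card (insert u R) \<le> card R" by (rule max)
      then show False using n fR by simp
    qed
  qed
  then have "card c_ends \<le> card (R \<union> mate ` R)" using fR by (intro card_mono) auto
  also have "\<dots> \<le> 2 * card R" using card_Un_le[of R "mate ` R"] card_image_le[OF fR, of mate] by linarith
  finally show ?thesis using that R by blast
qed

text \<open>Candidates for the first vertices of legs, which have to be nonadjacent and to belong to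
  different cliques.\<close>

definition transversal :: "'a set \<Rightarrow> 'a set \<Rightarrow> bool" where
  "transversal X T \<longleftrightarrow> T \<subseteq> B \<and> (\<forall>b\<in>T. \<exists>i\<in>X. hits b i) \<and>
     (\<forall>b\<in>T. \<forall>b'\<in>T. b \<noteq> b' \<longrightarrow> \<not> E b b' \<and> (\<forall>i\<in>X. \<not> (hits b i \<and> hits b' i)))"

lemma transversalD:
  assumes "transversal X T"
  shows "T \<subseteq> B" "finite T" "\<And>b. b \<in> T \<Longrightarrow> \<exists>i\<in>X. hits b i"
    "\<And>b b'. b \<in> T \<Longrightarrow> b' \<in> T \<Longrightarrow> b \<noteq> b' \<Longrightarrow> \<not> E b b'"
    "\<And>b b' i. b \<in> T \<Longrightarrow> b' \<in> T \<Longrightarrow> i \<in> X \<Longrightarrow> hits b i \<Longrightarrow> hits b' i \<Longrightarrow> b = b'"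
proof -
  show T: "T \<subseteq> B" using assms unfolding transversal_def by simp
  then have "T \<subseteq> V" unfolding B_def by auto
  then show "finite T" using finite_subset fin by auto
  show "\<exists>i\<in>X. hits b i" if "b \<in> T" for b using assms that unfolding transversal_def by simp
  show "\<not> E b b'" if "b \<in> T" "b' \<in> T" "b \<noteq> b'" for b b' using assms that unfolding transversal_def by simp
  show "b = b'" if "b \<in> T" "b' \<in> T" "i \<in> X" "hits b i" "hits b' i" for b b' i
    using assms that unfolding transversal_def by blast
qed

definition twins :: "'a set \<Rightarrow> 'a set \<Rightarrow> 'a set \<Rightarrow> bool" where
  "twins X T T' \<longleftrightarrow> transversal X T \<and> transversal X T' \<and> card T' = card T \<and> T' \<noteq> {} \<and>
    (\<forall>T''. transversal X T'' \<longrightarrow> card T'' \<le> card T) \<and> (\<forall>b\<in>T. \<forall>b'\<in>T'. \<forall>i\<in>X. \<not> (hits b i \<and> hits b' i))"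

text \<open>Removing the cliques hit by a maximum transversal either lowers the maximum or yields a second,
  disjoint one of the same size.\<close>

lemma two_transversals:
  assumes "finite X" "X \<subseteq> C" "m * n < card X" "m \<le> n"
    and "\<And>T. transversal X T \<Longrightarrow> card T \<le> m"
    and hit1: "\<And>b i j. b \<in> B \<Longrightarrow> i \<in> X \<Longrightarrow> j \<in> X \<Longrightarrow> hits b i \<Longrightarrow> hits b j \<Longrightarrow> i = j"
  shows "\<exists>X'\<subseteq>X. \<exists>T T'. twins X' T T'"
  using assms
proof (induction m arbitrary: X)
  case 0
  then obtain i where i: "i \<in> X" by fastforce
  then have "i \<in> C" using 0 by auto
  then obtain b where b: "b \<in> B" "hits b i" by (rule clique_hit)
  then have "transversal X {b}" unfolding transversal_def using i by auto
  then have "card {b} \<le> 0" by (rule "0.prems"(5))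
  then show ?case by simp
next
  case (Suc m)
  have sub: ?case if X': "X' \<subseteq> X" "m * n < card X'" "\<And>T. transversal X' T \<Longrightarrow> card T \<le> m" for X'
  proof -
    have "finite X'" using finite_subset[OF X'(1) Suc.prems(1)] .
    moreover have "X' \<subseteq> C" using X'(1) Suc.prems(2) by simp
    moreover have "m \<le> n" using Suc.prems(4) by simp
    moreover have "i = j" if "b \<in> B" "i \<in> X'" "j \<in> X'" "hits b i" "hits b j" for b i j
      using Suc.prems(6)[of b i j] that X'(1) by auto
    ultimately obtain X'' T T' where "X'' \<subseteq> X'" "twins X'' T T'"
      using Suc.IH[of X'] X' by auto
    moreover from this have "X'' \<subseteq> X" using X'(1) by simp
    ultimately show ?thesis by blast
  qed
  show ?case
  proof (cases "\<forall>T. transversal X T \<longrightarrow> card T \<le> m")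
    case True
    then show ?thesis using sub[of X] Suc.prems(3) by simp
  next
    case False
    then obtain T where T: "transversal X T" "m < card T" by auto
    note TD = transversalD[OF T(1)]
    have cT: "card T = Suc m" using Suc.prems(5)[OF T(1)] T(2) by simp
    define I where "I = {i \<in> X. \<exists>b\<in>T. hits b i}"
    have "card I \<le> card T"
    proof (rule surj_card_le[OF TD(2)])
      show "I \<subseteq> (\<lambda>b. SOME i. i \<in> X \<and> hits b i) ` T"
      proof
        fix i assume "i \<in> I"
        then obtain b where b: "b \<in> T" "hits b i" and i: "i \<in> X" unfolding I_def by auto
        have "(SOME j. j \<in> X \<and> hits b j) \<in> X \<and> hits b (SOME j. j \<in> X \<and> hits b j)"
          by (rule someI[of "\<lambda>j. j \<in> X \<and> hits b j" i]) (use b i in simp)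
        then have "(SOME j. j \<in> X \<and> hits b j) = i"
          using Suc.prems(6)[of b _ i] b i TD(1) by auto
        then show "i \<in> (\<lambda>b. SOME i. i \<in> X \<and> hits b i) ` T" using b(1) by force
      qed
    qed
    moreover have "card X - card I \<le> card (X - I)"
      using Suc.prems(1) by (intro diff_card_le_card_Diff) (simp add: I_def)
    \<comment> \<open>By \<open>hit1\<close> the transversal uses up at most \<open>Suc m\<close>
      cliques, and \<open>Suc m \<le> n\<close>; so one factor can be lowered.\<close>
    ultimately have cX: "m * n < card (X - I)" using Suc.prems(3,4) cT by simp
    show ?thesis
    proof (cases "\<forall>T. transversal (X - I) T \<longrightarrow> card T \<le> m")
      case True
      then show ?thesis using sub[of "X - I"] cX by simp
    next
      case False
      then obtain T' where T': "transversal (X - I) T'" "m < card T'" by auto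
      note TD' = transversalD[OF T'(1)]
      have hI: "i \<in> X - I" if b: "b \<in> T'" "i \<in> X" "hits b i" for b i
      proof -
        obtain j where "j \<in> X - I" "hits b j" using TD'(3)[OF b(1)] by auto
        then show ?thesis using Suc.prems(6)[of b i j] b TD'(1) by auto
      qed
      have "transversal X T'"
        unfolding transversal_def
      proof (intro conjI ballI impI)
        show "T' \<subseteq> B" by (rule TD'(1))
        show "\<exists>i\<in>X. hits b i" if "b \<in> T'" for b using TD'(3)[OF that] by auto
        show "\<not> E b b'" if "b \<in> T'" "b' \<in> T'" "b \<noteq> b'" for b b' using TD'(4)[OF that] .
        show "\<not> (hits b i \<and> hits b' i)" if "b \<in> T'" "b' \<in> T'" "b \<noteq> b'" "i \<in> X" for b b' i
          using TD'(5)[OF that(1,2)] hI[OF that(1,4)] that(3) by auto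
      qed
      moreover from this have "card T' = Suc m" using Suc.prems(5) T'(2) by (simp add: le_antisym Suc_leI)
      moreover have "T' \<noteq> {}" using T'(2) by auto
      moreover have "\<not> (hits b i \<and> hits b' i)" if "b \<in> T" "b' \<in> T'" "i \<in> X" for b b' i
        using hI[OF that(2,3)] that unfolding I_def by auto
      ultimately have "twins X T T'" unfolding twins_def using T(1) cT Suc.prems(5) by simp
      then show ?thesis by blast
    qed
  qed
qed

text \<open>The edges of \<open>D\<close> in the cliques hit by \<open>T\<close> and
  \<open>T'\<close> are exchanged for \<open>T\<close>, \<open>T'\<close> and one neighbour of each
  of their vertices in its clique, at equal cost. A vertex of \<open>B\<close> that loses a
  dominator hits a clique of \<open>X\<close>; one of the two transversals avoids this clique and,
  being maximum, contains a neighbour of the vertex. For the same reason a vertex of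
  \<open>T'\<close> has a neighbour in \<open>T\<close>, which yields a path.\<close>

lemma no_two_transversals:
  assumes u: "units R (\<lambda>i. i)" and mC: "\<And>u. u \<in> R \<Longrightarrow> mate u \<in> C"
    and hit1: "\<And>b i j. b \<in> B \<Longrightarrow> i \<in> R \<Longrightarrow> j \<in> R \<Longrightarrow> hits b i \<Longrightarrow> hits b j \<Longrightarrow> i = j"
    and X: "X \<subseteq> R" "transversal X T" "transversal X T'" "card T' = card T" "T' \<noteq> {}"
    and max: "\<And>T''. transversal X T'' \<Longrightarrow> card T'' \<le> card T"
    and dis: "\<And>b b' i. b \<in> T \<Longrightarrow> b' \<in> T' \<Longrightarrow> i \<in> X \<Longrightarrow> \<not> (hits b i \<and> hits b' i)"
  shows False
proof -
  note uD = unitsD[OF u]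
  note T = transversalD[OF X(2)] and T' = transversalD[OF X(3)]
  have RC: "i \<in> C" if "i \<in> R" for i using uD(3)[OF that] .
  define S where "S = T \<union> T'"
  have SB: "S \<subseteq> B" using T(1) T'(1) unfolding S_def by simp
  have SV: "S \<subseteq> V" using SB unfolding B_def by auto
  have TT': "T \<inter> T' = {}"
  proof (rule ccontr)
    assume "T \<inter> T' \<noteq> {}"
    then obtain b where "b \<in> T" "b \<in> T'" by auto
    then show False using T(3)[of b] dis[of b b] by auto
  qed
  then have cS: "card S = 2 * card T" unfolding S_def using T(2) T'(2) X(4) by (simp add: card_Un_disjoint)
  have "\<forall>b\<in>S. \<exists>i. i \<in> X \<and> hits b i" using T(3) T'(3) unfolding S_def by auto
  then obtain idx where idx: "\<forall>b\<in>S. idx b \<in> X \<and> hits b (idx b)"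
    using bchoice[of S "\<lambda>b i. i \<in> X \<and> hits b i"] by blast
  have idx_eq: "idx b = i" if "b \<in> S" "i \<in> R" "hits b i" for b i
    using hit1[of b "idx b" i] idx that SB X(1) by auto
  have inj: "inj_on idx S"
  proof (rule inj_onI)
    fix b b' assume bb: "b \<in> S" "b' \<in> S" "idx b = idx b'"
    then have h: "idx b \<in> X" "hits b (idx b)" "hits b' (idx b)" using idx by auto
    consider "b \<in> T" "b' \<in> T" | "b \<in> T'" "b' \<in> T'" | "b \<in> T" "b' \<in> T'" | "b \<in> T'" "b' \<in> T"
      using bb unfolding S_def by auto
    then show "b = b'"
    proof cases
      case 1 then show ?thesis using T(5)[OF _ _ h] by simp
    next
      case 2 then show ?thesis using T'(5)[OF _ _ h] by simp
    next
      case 3 then show ?thesis using dis[of b b' "idx b"] h by simp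
    next
      case 4 then show ?thesis using dis[of b' b "idx b"] h by simp
    qed
  qed
  define L where "L = idx ` S"
  have LX: "L \<subseteq> X" using idx unfolding L_def by auto
  then have LR: "L \<subseteq> R" using X(1) by simp
  have cL: "card L = card S" unfolding L_def using card_image[OF inj] .
  have LD: "L \<subseteq> D" using LR uD(1) by simp
  have Lm: "mate i \<notin> L" if "i \<in> L" for i using uD(4)[of i] LR that by auto
  have "\<forall>b\<in>S. \<exists>z. same_clique (idx b) z \<and> E b z" using idx unfolding hits_def by auto
  then obtain z where z: "\<forall>b\<in>S. same_clique (idx b) (z b) \<and> E b (z b)"
    using bchoice[of S "\<lambda>b z. same_clique (idx b) z \<and> E b z"] by blast
  have edge_C: "e \<in> C \<and> (\<exists>i\<in>L. same_clique i e)" if e: "e \<in> L \<union> mate ` L" for e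
  proof -
    obtain i where i: "i \<in> L" "e = i \<or> e = mate i" using e by auto
    have iR: "i \<in> R" and iD: "i \<in> D" using i(1) LR LD by auto
    have "same_clique i (mate i)" using E_same_clique[OF mate(2)[OF iD] RC[OF iR] mC[OF iR]] .
    moreover have "same_clique i i" using same_clique_refl[OF RC[OF iR]] .
    ultimately show ?thesis using i same_clique_C[of i e] by auto
  qed
  define D' where "D' = (D - (L \<union> mate ` L)) \<union> (S \<union> z ` S)"
  have fS: "finite S" using finite_subset[OF SV fin] .
  have "card D' \<le> card (D - (L \<union> mate ` L)) + (card S + card S)"
    unfolding D'_def using card_Un_le[of "D - (L \<union> mate ` L)" "S \<union> z ` S"] card_Un_le[of S "z ` S"]
      card_image_le[OF fS, of z] by linarith
  then have cD': "card D' \<le> card D" using card_edges[OF LD Lm] cL by linarith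
  have dom: "\<exists>t\<in>S. E b t" if b: "b \<in> B" and i: "i \<in> X" "hits b i" for b i
  proof -
    have main: "\<exists>t\<in>U. E b t"
      if U: "transversal X U" "card U = card T" "\<And>t. t \<in> U \<Longrightarrow> \<not> hits t i" for U
    proof (rule ccontr)
      assume n: "\<not> ?thesis"
      note UD = transversalD[OF U(1)]
      have "transversal X (insert b U)"
        unfolding transversal_def
      proof (intro conjI ballI impI)
        show "insert b U \<subseteq> B" using b UD(1) by simp
        show "\<exists>j\<in>X. hits t j" if "t \<in> insert b U" for t using that i UD(3) by auto
        fix t t' assume t: "t \<in> insert b U" "t' \<in> insert b U" "t \<noteq> t'"
        show "\<not> E t t'" using t n UD(4)[of t t'] sym[of t t'] by auto
        show "\<not> (hits t j \<and> hits t' j)" if j: "j \<in> X" for j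
        proof
          assume h: "hits t j \<and> hits t' j"
          have bj: "j = i" if "hits b j" using hit1[OF b, of j i] j i X(1) that by auto
          show False
          proof (cases "t = b \<or> t' = b")
            case True
            then have "j = i" using bj h by auto
            then show False using True t h U(3) by auto
          next
            case False
            then show False using UD(5)[of t t' j] t h j by auto
          qed
        qed
      qed
      then have "card (insert b U) \<le> card T" by (rule max)
      moreover have "b \<notin> U" using U(3) i(2) by auto
      ultimately show False using UD(2) U(2) by simp
    qed
    show ?thesis
    proof (cases "\<exists>t\<in>T. hits t i")
      case True
      then obtain t0 where "t0 \<in> T" "hits t0 i" by auto
      then have "\<not> hits t i" if "t \<in> T'" for t using dis[of t0 t i] that i(1) by simp
      then show ?thesis using main[OF X(3,4)] unfolding S_def by auto
    next
      case False
      then show ?thesis using main[OF X(2)] unfolding S_def by auto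
    qed
  qed
  have "\<exists>u\<in>D'. E v u" if v: "v \<in> V" for v
  proof -
    obtain d where d: "d \<in> D" "E v d" using D(1) v unfolding tds_def by auto
    show ?thesis
    proof (cases "d \<in> L \<union> mate ` L")
      case False
      then show ?thesis using d unfolding D'_def by auto
    next
      case True
      then obtain i where i: "i \<in> L" "same_clique i d" and dC: "d \<in> C" using edge_C by auto
      then obtain b where b: "b \<in> S" "i = idx b" unfolding L_def by auto
      have zb: "same_clique i (z b)" "E b (z b)" using z b by auto
      consider "v \<in> B" | "same_clique d v" using E_C_cases[OF dC sym[OF d(2)]] by auto
      then show ?thesis
      proof cases
        case 1
        have "hits v i" unfolding hits_def using i(2) d(2) by auto
        then show ?thesis using dom[OF 1, of i] i(1) LX unfolding D'_def by auto
      next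
        case 2
        then have "same_clique v (z b)" using same_clique_trans[OF same_clique_sym[OF same_clique_trans[OF i(2) 2]] zb(1)] by simp
        then show ?thesis
          using same_clique_E[of v "z b"] b(1) sym[OF zb(2)] unfolding D'_def by (cases "v = z b") auto
      qed
    qed
  qed
  moreover have "D' \<subseteq> V"
  proof -
    have "z b \<in> V" if "b \<in> S" for b using z that same_clique_C[of "idx b" "z b"] C_V by auto
    then show ?thesis unfolding D'_def using DV SV by auto
  qed
  ultimately have t: "tds D'" unfolding tds_def by auto
  obtain b' where b': "b' \<in> T'" using X(5) by auto
  then obtain i where i: "i \<in> X" "hits b' i" using T'(3) by auto
  have "\<exists>t\<in>T. E b' t"
  proof (rule ccontr)
    assume n: "\<not> ?thesis"
    have "transversal X (insert b' T)"
      unfolding transversal_def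
    proof (intro conjI ballI impI)
      show "insert b' T \<subseteq> B" using b' T(1) T'(1) by auto
      show "\<exists>j\<in>X. hits t j" if "t \<in> insert b' T" for t using that i T(3) by auto
      fix t t' assume t: "t \<in> insert b' T" "t' \<in> insert b' T" "t \<noteq> t'"
      show "\<not> E t t'" using t n T(4)[of t t'] sym[of t t'] by auto
      show "\<not> (hits t j \<and> hits t' j)" if j: "j \<in> X" for j
        using t dis[OF _ b' j] T(5)[of t t' j] j by auto
    qed
    then have "card (insert b' T) \<le> card T" by (rule max)
    moreover have "b' \<notin> T" using b' TT' by auto
    ultimately show False using T(2) by simp
  qed
  then obtain t0 where t0: "t0 \<in> T" "E b' t0" by auto
  have "has_p3 D'"
  proof (rule has_p3I[of b' _ t0 "z t0"])
    show "b' \<in> D'" "t0 \<in> D'" "z t0 \<in> D'" unfolding D'_def S_def using b' t0 by auto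
    show "E b' t0" by (rule t0(2))
    show "E t0 (z t0)" using z t0 unfolding S_def by auto
    have "z t0 \<in> C" using z t0 same_clique_C[of "idx t0" "z t0"] unfolding S_def by auto
    then show "b' \<noteq> z t0" using b' T'(1) unfolding B_def by auto
  qed
  then obtain D'' where "tds D''" "card D'' < card D'" using no t unfolding no_inst_def by auto
  then show False using D(2)[of D''] cD' by simp
qed

text \<open>Cliques that a single vertex of \<open>B\<close> dominates are few, since each would
  save a vertex. In any other clique, a vertex \<open>b\<close> that hits it has a neighbour
  \<open>z\<close> and a nonneighbour \<open>y\<close>, and this is a leg. Nonadjacent first
  vertices come from a large transversal; without one, \<open>two_transversals\<close> would
  contradict \<open>no_two_transversals\<close>.\<close>

lemma c_family:
  assumes big: "2 * ((4 * k + 10) * (4 * k + 10) + 3 * a) < card c_ends"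
  shows "\<exists>J b z y. leg_family V E k (J :: 'a set) b z y D"
proof -
  obtain R0 where R0: "R0 \<subseteq> c_ends" "\<forall>u\<in>R0. mate u \<notin> R0" "card c_ends \<le> 2 * card R0"
    using c_reps by blast
  have RD: "i \<in> D" "i \<in> C" "mate i \<in> C" if "i \<in> R0" for i using R0(1) that unfolding c_ends_def by auto
  have u: "units R0 (\<lambda>i. i)"
    unfolding units_def
  proof (intro conjI ballI allI impI)
    show "R0 \<subseteq> D" using RD by auto
    show "i \<in> C" "mate i \<notin> R0" if "i \<in> R0" for i using RD R0(2) that by auto
    show "\<not> same_clique i j" if ij: "i \<in> R0" "j \<in> R0" "i \<noteq> j" for i j
    proof
      assume "same_clique i j"
      then have "E i j" using same_clique_E ij(3) by simp
      then have "j = mate i" using mate_eq RD(1) ij by simp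
      then show False using R0(2) ij by simp
    qed
    fix L c assume L: "L \<subseteq> R0" "card L \<le> 2 * a" and c: "c \<in> C" "\<forall>i\<in>L. \<not> same_clique i c"
    obtain s where s: "s \<in> D" "E c s" using dominates_C_D c(1) unfolding dominates_C_def by auto
    have "s \<notin> L \<union> mate ` L"
    proof
      assume "s \<in> L \<union> mate ` L"
      then obtain i where i: "i \<in> L" "s = i \<or> s = mate i" by auto
      have iR: "i \<in> R0" using i L by auto
      have "same_clique i s" using i(2) same_clique_refl[OF RD(2)[OF iR]] E_same_clique[OF mate(2)[OF RD(1)[OF iR]] RD(2,3)[OF iR]] by auto
      moreover have "same_clique s c" using E_same_clique[OF sym[OF s(2)] _ c(1)] same_clique_C[OF calculation] by simp
      ultimately have "same_clique i c" by (rule same_clique_trans)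
      then show False using c(2) i(1) by simp
    qed
    then show "\<exists>s\<in>D - (L \<union> mate ` L). E c s" using s by auto
  qed
  obtain R1 where R1: "R1 \<subseteq> R0" "card R0 \<le> card R1 + 2 * a"
    and hit: "\<And>b i j. b \<in> B \<Longrightarrow> i \<in> R1 \<Longrightarrow> j \<in> R1 \<Longrightarrow> hits b i \<Longrightarrow> hits b j \<Longrightarrow> i = j"
    using units_reduce[OF u] by metis
  have fR1: "finite R1" using finite_subset[OF R1(1) unitsD(2)[OF u]] .
  define F where "F = {i \<in> R1. \<exists>b\<in>B. \<forall>c. same_clique i c \<longrightarrow> E b c}"
  have BV: "B \<subseteq> V" unfolding B_def by auto
  have "card F \<le> a"
  proof (rule ccontr)
    assume n: "\<not> ?thesis"
    then obtain L where L: "L \<subseteq> F" "card L = a" "finite L" using obtain_subset_with_card_n[of a F] by auto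
    have "\<forall>i\<in>L. \<exists>b. b \<in> B \<and> (\<forall>c. same_clique i c \<longrightarrow> E b c)" using L(1) unfolding F_def by auto
    then obtain f where f: "\<forall>i\<in>L. f i \<in> B \<and> (\<forall>c. same_clique i c \<longrightarrow> E (f i) c)"
      using bchoice[of L "\<lambda>i b. b \<in> B \<and> (\<forall>c. same_clique i c \<longrightarrow> E b c)"] by blast
    have "2 * card L + 1 \<le> card (f ` L) + a"
    proof (rule units_cost[OF u])
      show "L \<subseteq> R0" using L(1) R1(1) unfolding F_def by auto
      show "card L \<le> 2 * a" using L(2) by simp
      show "f ` L \<subseteq> V" using f BV by auto
      show "\<exists>s\<in>f ` L. E c s" if "i \<in> L" "same_clique i c" for i c
        using f that sym[of "f i" c] by auto
    qed
    then show False using card_image_le[OF L(3), of f] L(2) by linarith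
  qed
  define R where "R = R1 - F"
  have RR1: "R \<subseteq> R1" unfolding R_def by auto
  have RR0: "R \<subseteq> R0" using RR1 R1(1) by simp
  have fR: "finite R" using finite_subset[OF RR1 fR1] .
  have cRF: "card R1 - card F \<le> card R"
    unfolding R_def using fR1 by (intro diff_card_le_card_Diff) (simp add: F_def)
  define N where "N = (4 * k + 10) * (4 * k + 10)"
  \<comment> \<open>Of the \<open>3 * a\<close> in the hypothesis, \<open>2 * a\<close> pay for
    \<open>units_reduce\<close> and \<open>a\<close> for \<open>F\<close>; the factor 2 stands for
    the two ends of an edge.\<close>
  have "card R1 \<le> card R + a" using cRF \<open>card F \<le> a\<close> by simp
  moreover have "2 * N + 6 * a < 2 * card R0" using R0(3) big[folded N_def] by simp
  ultimately have "N < card R" using R1(2) by simp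
  then have cR: "(4 * k + 10) * (4 * k + 10) < card R" unfolding N_def .
  have RC: "R \<subseteq> C" using RR0 RD by auto
  have hitR: "i = j" if "b \<in> B" "i \<in> R" "j \<in> R" "hits b i" "hits b j" for b i j
    using hit[of b i j] that RR1 by auto
  have uR: "units R (\<lambda>i. i)"
    unfolding units_def
  proof (intro conjI ballI allI impI)
    note uD = unitsD[OF u]
    show "R \<subseteq> D" using RR0 uD(1) by simp
    show "i \<in> C" "mate i \<notin> R" if "i \<in> R" for i using uD(3,4)[of i] RR0 that by auto
    show "\<not> same_clique i j" if "i \<in> R" "j \<in> R" "i \<noteq> j" for i j using uD(5)[of i j] RR0 that by auto
    fix L c assume L: "L \<subseteq> R" "card L \<le> 2 * a" "c \<in> C" "\<forall>i\<in>L. \<not> same_clique i c"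
    then show "\<exists>s\<in>D - (L \<union> mate ` L). E c s" using uD(6)[of L c] RR0 by simp
  qed
  have "\<exists>T. transversal R T \<and> 4 * k + 10 < card T"
  proof (rule ccontr)
    assume n: "\<not> ?thesis"
    have "\<exists>X\<subseteq>R. \<exists>T T'. twins X T T'"
    proof (rule two_transversals[OF fR RC cR order_refl])
      show "card T \<le> 4 * k + 10" if "transversal R T" for T using n that by auto
      show "i = j" if "b \<in> B" "i \<in> R" "j \<in> R" "hits b i" "hits b j" for b i j using hitR[OF that] .
    qed
    then obtain X T T' where X: "X \<subseteq> R" "transversal X T" "transversal X T'" "card T' = card T" "T' \<noteq> {}"
      and max: "\<forall>T''. transversal X T'' \<longrightarrow> card T'' \<le> card T"
      and dis: "\<forall>b\<in>T. \<forall>b'\<in>T'. \<forall>i\<in>X. \<not> (hits b i \<and> hits b' i)"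
      unfolding twins_def by (elim exE conjE)
    show False
    proof (rule no_two_transversals[OF uR _ _ X])
      show "mate u \<in> C" if "u \<in> R" for u using RD(3)[of u] RR0 that by auto
      show "i = j" if "b \<in> B" "i \<in> R" "j \<in> R" "hits b i" "hits b j" for b i j using hitR[OF that] .
      show "card T'' \<le> card T" if "transversal X T''" for T'' using max that by simp
      show "\<not> (hits b i \<and> hits b' i)" if "b \<in> T" "b' \<in> T'" "i \<in> X" for b b' i using dis that by simp
    qed
  qed
  then obtain T where T: "transversal R T" "4 * k + 10 < card T" by auto
  note TD = transversalD[OF T(1)]
  have TB: "b \<in> B" if "b \<in> T" for b using TD(1) that by auto
  have "\<forall>b\<in>T. \<exists>i. i \<in> R \<and> hits b i" using TD(3) by auto
  then obtain idx where idx: "\<forall>b\<in>T. idx b \<in> R \<and> hits b (idx b)"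
    using bchoice[of T "\<lambda>b i. i \<in> R \<and> hits b i"] by blast
  have idx_inj: "b = b'" if "b \<in> T" "b' \<in> T" "idx b = idx b'" for b b'
    using TD(5)[OF that(1,2), of "idx b"] bspec[OF idx that(1)] bspec[OF idx that(2)] that(3) by simp
  have "\<forall>b\<in>T. \<exists>z. same_clique (idx b) z \<and> E b z" using idx unfolding hits_def by auto
  then obtain z where z: "\<forall>b\<in>T. same_clique (idx b) (z b) \<and> E b (z b)"
    using bchoice[of T "\<lambda>b z. same_clique (idx b) z \<and> E b z"] by blast
  have "\<forall>b\<in>T. \<exists>y. same_clique (idx b) y \<and> \<not> E b y"
    using idx TB unfolding R_def F_def by auto
  then obtain y where y: "\<forall>b\<in>T. same_clique (idx b) (y b) \<and> \<not> E b (y b)"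
    using bchoice[of T "\<lambda>b y. same_clique (idx b) y \<and> \<not> E b y"] by blast
  have "leg_family V E k T (\<lambda>b. b) z y D"
  proof (rule leg_familyI[where \<kappa> = idx])
    show "finite T" by (rule TD(2))
    show "4 * k + 10 \<le> card T" using T(2) by simp
  next
    fix b assume b: "b \<in> T"
    have zy: "same_clique (idx b) (z b)" "E b (z b)" "same_clique (idx b) (y b)" "\<not> E b (y b)" using z y b by auto
    have "z b \<noteq> y b" using zy by auto
    then have "E (z b) (y b)" using same_clique_E[OF same_clique_trans[OF same_clique_sym[OF zy(1)] zy(3)]] by simp
    moreover have "b \<noteq> y b" using TB[OF b] same_clique_C[OF zy(3)] unfolding B_def by auto
    ultimately show "ip3 b (z b) (y b)" unfolding ip3_def using zy by simp
    show "same_clique (idx b) (z b)" "same_clique (idx b) (y b)" by (rule zy)+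
    have iR: "idx b \<in> R" using idx b by simp
    then have iR0: "idx b \<in> R0" using RR0 by auto
    note i = RD[OF iR0]
    show "\<exists>d\<in>D. \<exists>d'\<in>D. d \<noteq> d' \<and> (\<forall>d\<in>{d, d'}. (d = z b \<or> d = b \<or> E d (z b) \<or> E d b) \<and>
        (\<forall>j\<in>T. j \<noteq> b \<longrightarrow> \<not> E d j))"
    proof (rule bexI[of _ "idx b"], rule bexI[of _ "mate (idx b)"], intro conjI ballI impI)
      have cm: "same_clique (idx b) (mate (idx b))" using E_same_clique[OF mate(2)[OF i(1)] i(2,3)] .
      have dominates_C: "same_clique (idx b) d" if "d \<in> {idx b, mate (idx b)}" for d using that cm same_clique_refl[OF i(2)] by auto
      show "idx b \<noteq> mate (idx b)" using mate(4)[OF i(1)] by simp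
      show "d = z b \<or> d = b \<or> E d (z b) \<or> E d b" if "d \<in> {idx b, mate (idx b)}" for d
        using same_clique_E[OF same_clique_trans[OF same_clique_sym[OF dominates_C[OF that]] zy(1)]] by auto
      show "\<not> E d b'" if d: "d \<in> {idx b, mate (idx b)}" and b': "b' \<in> T" "b' \<noteq> b" for d b'
      proof
        assume "E d b'"
        then have "hits b' (idx b)" unfolding hits_def using dominates_C[OF d] sym[of d b'] by auto
        moreover have "hits b (idx b)" using idx b by simp
        ultimately have "b' = b" using TD(5)[OF b'(1) b iR] by simp
        then show False using b'(2) by simp
      qed
    qed (use mate(1)[OF i(1)] i(1) in auto)
  next
    fix b b' assume bb: "b \<in> T" "b' \<in> T" "b \<noteq> b'"
    then have "idx b \<noteq> idx b'" using idx_inj by auto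
    then show "\<not> same_clique (idx b) (idx b')" using unitsD(5)[OF uR] idx bb by simp
    show "b \<noteq> b' \<and> \<not> E b b'" using TD(4)[OF bb] bb(3) by simp
  next
    fix v b b' assume h: "v \<in> B" "b \<in> T" "b' \<in> T" "hits v (idx b)" "hits v (idx b')"
    then have "idx b = idx b'" using hitR[of v "idx b" "idx b'"] idx by simp
    then show "b = b'" using idx_inj h by simp
  qed
  then show ?thesis by blast
qed

text \<open>An edge of \<open>D\<close> meets \<open>A\<close>, or avoids \<open>A\<close> and meets
  \<open>B\<close>, or lies in \<open>C\<close>. At most \<open>a\<close> edges are of the first
  kind, so one of the other two kinds is frequent.\<close>

lemma family:
  assumes "2 * a + 2 * (2 * a + 4 * (4 * k + 10 + 6 * a + k + 2)) + 2 * ((4 * k + 10) * (4 * k + 10) + 3 * a) < card D"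
  shows "\<exists>J b z y. leg_family V E k (J :: 'a set) b z y D"
proof -
  have sub: "D \<subseteq> (D \<inter> A) \<union> mate ` (D \<inter> A) \<union> (b_ends \<union> mate ` b_ends) \<union> c_ends"
  proof
    fix d assume d: "d \<in> D"
    have md: "mate d \<in> D" "mate (mate d) = d" using mate(1)[OF d] mate_mate[OF d] by auto
    have V: "d \<in> A \<or> d \<in> B \<or> d \<in> C" "mate d \<in> A \<or> mate d \<in> B \<or> mate d \<in> C"
      using DV d md(1) unfolding B_def by auto
    have im: "d \<in> mate ` X" if "mate d \<in> X" for X using imageI[OF that, of mate] md(2) by simp
    show "d \<in> (D \<inter> A) \<union> mate ` (D \<inter> A) \<union> (b_ends \<union> mate ` b_ends) \<union> c_ends"
    proof (cases "d \<in> A \<or> mate d \<in> A")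
      case True
      then show ?thesis using d md im[of "D \<inter> A"] by auto
    next
      case nA: False
      show ?thesis
      proof (cases "d \<in> B \<or> mate d \<in> B")
        case True
        then show ?thesis using d md nA im[of b_ends] unfolding b_ends_def by auto
      next
        case False
        then show ?thesis using d nA V unfolding c_ends_def by auto
      qed
    qed
  qed
  have fb: "finite b_ends" "finite c_ends" using finD unfolding b_ends_def c_ends_def by auto
  have "card D \<le> card ((D \<inter> A) \<union> mate ` (D \<inter> A) \<union> (b_ends \<union> mate ` b_ends) \<union> c_ends)"
    using finD fb by (intro card_mono[OF _ sub]) auto
  also have "\<dots> \<le> 2 * card (D \<inter> A) + 2 * card b_ends + card c_ends"
    using card_Un_le[of "(D \<inter> A) \<union> mate ` (D \<inter> A) \<union> (b_ends \<union> mate ` b_ends)" c_ends]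
      card_Un_le[of "(D \<inter> A) \<union> mate ` (D \<inter> A)" "b_ends \<union> mate ` b_ends"]
      card_Un_le[of "D \<inter> A" "mate ` (D \<inter> A)"] card_Un_le[of b_ends "mate ` b_ends"]
      card_image_le[of "D \<inter> A" mate] card_image_le[of b_ends mate] finD fb by simp
  also have "card (D \<inter> A) \<le> a"
    using card_mono[OF finA, of "D \<inter> A"] A(2) by simp
  finally have cD: "card D \<le> 2 * a + 2 * card b_ends + card c_ends" by linarith
  define N where "N = (4 * k + 10) * (4 * k + 10)"
  have "2 * a + 4 * (4 * k + 10 + 6 * a + k + 2) < card b_ends \<or>
      2 * (N + 3 * a) < card c_ends" using cD assms[folded N_def] by arith
  then have "2 * a + 4 * (4 * k + 10 + 6 * a + k + 2) < card b_ends \<or>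
      2 * ((4 * k + 10) * (4 * k + 10) + 3 * a) < card c_ends" unfolding N_def .
  then show ?thesis using b_family c_family by auto
qed

end

section \<open>Characterisation of the no-instances\<close>

text \<open>All conditions pass to subfamilies, so a family can be cut down to exactly
  \<open>4 * k + 10\<close> legs, the number of vertices over which the formula quantifies.\<close>

lemma leg_family_subset:
  assumes "leg_family V E k J b z y D" "J' \<subseteq> J" "4 * k + 10 \<le> card J'"
  shows "leg_family V E k J' b z y D"
proof -
  interpret L: leg_family V E k J b z y D by (rule assms(1))
  show ?thesis
  proof unfold_locales
    show "finite J'" using finite_subset[OF assms(2) L.J(1)] .
    show "i = j" if "i \<in> J'" "j \<in> J'" "L.touch v (z i) (y i)" "L.touch v (z j) (y j)" for v i j
      using L.touch1[of i j v] that assms(2) by auto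
    show "L.ip3 (b i) (z i) (y i)" if "i \<in> J'" for i using L.leg assms(2) that by auto
    show "b i \<noteq> b j \<and> \<not> E (b i) (b j)" if "i \<in> J'" "j \<in> J'" "i \<noteq> j" for i j
      using L.b_indep[of i j] that assms(2) by auto
    show "\<exists>d\<in>D. \<exists>d'\<in>D. d \<noteq> d' \<and>
      (\<forall>d\<in>{d, d'}. (d = z i \<or> d = b i \<or> E d (z i) \<or> E d (b i)) \<and> (\<forall>j\<in>J'. j \<noteq> i \<longrightarrow> \<not> E d (b j)))"
      if i: "i \<in> J'" for i
    proof -
      have iJ: "i \<in> J" using i assms(2) by auto
      obtain d d' where d: "d \<in> D" "d' \<in> D" "d \<noteq> d'"
        "\<forall>d\<in>{d, d'}. (d = z i \<or> d = b i \<or> E d (z i) \<or> E d (b i)) \<and> (\<forall>j\<in>J. j \<noteq> i \<longrightarrow> \<not> E d (b j))"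
        using L.attached[OF iJ] by (elim bexE conjE)
      then show ?thesis using assms(2)
        by (intro bexI[OF _ d(1)] bexI[OF _ d(2)] conjI) auto
    qed
    show "L.tds D" by (rule L.D(1))
    show "card D \<le> card D'" if "L.tds D'" for D' by (rule L.D(2)[OF that])
  qed (use assms(3) L.no L.free L.conn in simp_all)
qed

text \<open>The bound of \<open>family\<close> for \<open>a = 3 * k + 1\<close>.\<close>

definition tds_bound :: "nat \<Rightarrow> nat" where
  "tds_bound k = 2 * (3 * k + 1) + 2 * (2 * (3 * k + 1) + 4 * (4 * k + 10 + 6 * (3 * k + 1) + k + 2)) +
     2 * ((4 * k + 10) * (4 * k + 10) + 3 * (3 * k + 1))"

context sgraph begin

definition hubs :: "'a set \<Rightarrow> 'a set" where
  "hubs X = {h \<in> V. \<exists>x\<in>X. \<exists>y\<in>X. x \<noteq> y \<and> E h x \<and> E h y}"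

text \<open>The whole graph is a complete join, and one vertex from each side dominates it.\<close>

lemma p4_free_small_tds:
  assumes "conn V" "\<And>a b c d. \<not> ip4 a b c d" "tds D" "\<And>D'. tds D' \<Longrightarrow> card D \<le> card D'"
  shows "card D \<le> 2"
proof (cases "2 \<le> card V")
  case False
  then show ?thesis using card_mono[OF fin, of D] assms(3) unfolding tds_def by auto
next
  case True
  obtain X Z where XZ: "X \<noteq> {}" "Z \<noteq> {}" "X \<union> Z = V" "X \<inter> Z = {}" "\<And>x z. x \<in> X \<Longrightarrow> z \<in> Z \<Longrightarrow> E x z"
    using conn_join[OF fin True assms(1)] assms(2) by metis
  obtain x z where xz: "x \<in> X" "z \<in> Z" using XZ by auto
  have "tds {x, z}"
    unfolding tds_def using XZ(3,5) xz sym[OF XZ(5)[OF xz(1)]] by fastforce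
  then have "card D \<le> card {x, z}" by (rule assms(4))
  also have "\<dots> \<le> 2" by (simp add: card_insert_if)
  finally show ?thesis .
qed

definition p4_p3s :: "nat \<Rightarrow> bool" where
  "p4_p3s m \<longleftrightarrow> (\<exists>a b c d p q r. ip4 a b c d \<and>
     (\<forall>i<m. ip3 (p i) (q i) (r i) \<and> anti {a, b, c, d} {p i, q i, r i}) \<and>
     (\<forall>i<m. \<forall>j<m. i \<noteq> j \<longrightarrow> anti {p i, q i, r i} {p j, q j, r j}))"

lemma anti_sym: "anti X Y \<Longrightarrow> anti Y X"
proof -
  assume a: "anti X Y"
  have "y \<noteq> x \<and> \<not> E y x" if "y \<in> Y" "x \<in> X" for x y
    using a that sym[of y x] unfolding anti_def by metis
  then show "anti Y X" unfolding anti_def by simp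
qed

text \<open>Let \<open>m\<close> be such that an induced P4 with \<open>m\<close> disjoint P3
  exists, but none with \<open>Suc m\<close>. Then a further P3 without neighbours in
  \<open>A\<close> is impossible, and \<open>m < k\<close> bounds the size by
  \<open>4 + 3 * (k - 1)\<close>.\<close>

lemma complement_ex:
  assumes free: "p4kp3_free k" and p4: "ip4 a0 b0 c0 d0"
  obtains A where "A \<subseteq> V" "card A \<le> 3 * k + 1" "has_p3 A" "\<And>x. x \<in> A \<Longrightarrow> \<exists>y\<in>A. E x y"
    "\<And>p q r. \<lbrakk>p \<in> V - A; q \<in> V - A; r \<in> V - A; \<forall>x\<in>A. \<not> E p x; \<forall>x\<in>A. \<not> E q x;
      \<forall>x\<in>A. \<not> E r x\<rbrakk> \<Longrightarrow> \<not> ip3 p q r"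
proof -
  have nk: "\<not> p4_p3s k" using free unfolding p4kp3_free_def p4_p3s_def .
  have "p4_p3s 0" unfolding p4_p3s_def using p4 by auto
  then have "\<exists>m<k. p4_p3s m \<and> \<not> p4_p3s (Suc m)" using nk
  proof (induction k)
    case (Suc k)
    then show ?case by (cases "p4_p3s k") (auto simp: less_Suc_eq)
  qed simp
  then obtain m where m: "m < k" "p4_p3s m" "\<not> p4_p3s (Suc m)" by auto
  obtain a b c d p q r where P0: "ip4 a b c d"
    "\<forall>i<m. ip3 (p i) (q i) (r i) \<and> anti {a, b, c, d} {p i, q i, r i}"
    "\<forall>i<m. \<forall>j<m. i \<noteq> j \<longrightarrow> anti {p i, q i, r i} {p j, q j, r j}"
    using m(2) unfolding p4_p3s_def by (elim exE conjE) (rule that)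
  have P: "ip4 a b c d" "\<And>i. i < m \<Longrightarrow> ip3 (p i) (q i) (r i)"
    "\<And>i. i < m \<Longrightarrow> anti {a, b, c, d} {p i, q i, r i}"
    "\<And>i j. i < m \<Longrightarrow> j < m \<Longrightarrow> i \<noteq> j \<Longrightarrow> anti {p i, q i, r i} {p j, q j, r j}"
    using P0 by simp_all
  define A where "A = {a, b, c, d} \<union> (\<Union>i<m. {p i, q i, r i})"
  have E4: "E a b" "E b c" "E c d" "E b a" "E c b" "E d c" "a \<noteq> c"
    using P(1) sym[of a b] sym[of b c] sym[of c d] unfolding ip4_def by auto
  have E3: "E (p i) (q i)" "E (q i) (r i)" "E (q i) (p i)" "E (r i) (q i)" if "i < m" for i
    using P(2)[OF that] sym[of "p i" "q i"] sym[of "q i" "r i"] unfolding ip3_def by auto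
  have inA: "p i \<in> A" "q i \<in> A" "r i \<in> A" if "i < m" for i using that unfolding A_def by auto
  have nbr: "\<exists>y\<in>A. E x y" if xA: "x \<in> A" for x
  proof -
    consider "x \<in> {a, b, c, d}" | i where "i < m" "x \<in> {p i, q i, r i}" using xA unfolding A_def by auto
    then show ?thesis
    proof cases
      case 1
      then show ?thesis using E4 unfolding A_def by auto
    next
      case 2
      then show ?thesis using E3[OF 2(1)] inA[OF 2(1)] by auto
    qed
  qed
  show ?thesis
  proof (rule that[of A])
    have "card A \<le> card {a, b, c, d} + card (\<Union>i<m. {p i, q i, r i})" unfolding A_def by (rule card_Un_le)
    also have "card (\<Union>i<m. {p i, q i, r i}) \<le> (\<Sum>i<m. card {p i, q i, r i})" by (rule card_UN_le) simp
    also have "\<dots> \<le> (\<Sum>i<m. 3)" by (intro sum_mono) (simp add: card_insert_if)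
    also have "card {a, b, c, d} \<le> 4" by (simp add: card_insert_if)
    finally show "card A \<le> 3 * k + 1" using m(1) by simp
    show "has_p3 A" by (rule has_p3I[of a _ b c]) (use E4 in \<open>auto simp: A_def\<close>)
    show "\<exists>y\<in>A. E x y" if "x \<in> A" for x by (rule nbr[OF that])
    show "A \<subseteq> V"
    proof
      fix x assume "x \<in> A"
      then obtain y where "E x y" using nbr by auto
      then show "x \<in> V" using E_V[of x y] by simp
    qed
    fix x y z assume xyz: "x \<in> V - A" "y \<in> V - A" "z \<in> V - A" "\<forall>u\<in>A. \<not> E x u" "\<forall>u\<in>A. \<not> E y u" "\<forall>u\<in>A. \<not> E z u"
    show "\<not> ip3 x y z"
    proof
      assume p3: "ip3 x y z"
      have an: "anti {x, y, z} U" if "U \<subseteq> A" for U unfolding anti_def using xyz that by auto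
      have "p4_p3s (Suc m)"
        unfolding p4_p3s_def
      proof (intro exI conjI allI impI)
        let ?p = "p(m := x)" and ?q = "q(m := y)" and ?r = "r(m := z)"
        show "ip4 a b c d" by (rule P(1))
        show "ip3 (?p i) (?q i) (?r i)" if "i < Suc m" for i using p3 P(2) that by (cases "i = m") auto
        show "anti {a, b, c, d} {?p i, ?q i, ?r i}" if "i < Suc m" for i
        proof (cases "i = m")
          case True
          have "{a, b, c, d} \<subseteq> A" unfolding A_def by auto
          then show ?thesis using anti_sym[OF an] True by simp
        qed (use P(3) that in simp)
        show "anti {?p i, ?q i, ?r i} {?p j, ?q j, ?r j}" if ij: "i < Suc m" "j < Suc m" "i \<noteq> j" for i j
        proof -
          have sub: "{p l, q l, r l} \<subseteq> A" if "l < m" for l using inA[OF that] by simp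
          consider "i = m" "j < m" | "j = m" "i < m" | "i < m" "j < m" using ij by linarith
          then show ?thesis
          proof cases
            case 1 then show ?thesis using an[OF sub[OF 1(2)]] by simp
          next
            case 2 then show ?thesis using anti_sym[OF an[OF sub[OF 2(2)]]] by simp
          next
            case 3 then show ?thesis using P(4)[OF 3 ij(3)] by simp
          qed
        qed
      qed
      then show False using m(3) by simp
    qed
  qed
qed

lemma no_inst_cert:
  assumes no: no_inst and free: "p4kp3_free k" and conn: "conn V"
    and D: "tds D" "\<And>D'. tds D' \<Longrightarrow> card D \<le> card D'" "tds_bound k < card D"
  obtains X where "X \<subseteq> V" "card X = 4 * k + 10" "cert (hubs X) k"
proof -
  have "\<exists>a b c d. ip4 a b c d"
  proof (rule ccontr)
    assume "\<not> ?thesis"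
    then have "\<not> ip4 a b c d" for a b c d by auto
    then have "card D \<le> 2" by (rule p4_free_small_tds[OF conn _ D(1,2)])
    then show False using D(3) unfolding tds_bound_def by simp
  qed
  then obtain a0 b0 c0 d0 where p4: "ip4 a0 b0 c0 d0" by auto
  obtain A where A: "A \<subseteq> V" "card A \<le> 3 * k + 1" "has_p3 A" "\<And>x. x \<in> A \<Longrightarrow> \<exists>y\<in>A. E x y"
    "\<And>p q r. \<lbrakk>p \<in> V - A; q \<in> V - A; r \<in> V - A; \<forall>x\<in>A. \<not> E p x; \<forall>x\<in>A. \<not> E q x;
      \<forall>x\<in>A. \<not> E r x\<rbrakk> \<Longrightarrow> \<not> ip3 p q r"
    using complement_ex[OF free p4] by blast
  interpret P: p3_complement V E k "3 * k + 1" A D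
  proof unfold_locales
    show no_inst by (rule no)
    show "p4kp3_free k" by (rule free)
    show "conn V" by (rule conn)
    show "tds D" by (rule D(1))
    show "card D \<le> card D'" if "tds D'" for D' by (rule D(2)[OF that])
    show "A \<subseteq> V" "card A \<le> 3 * k + 1" "has_p3 A" by (rule A)+
    show "\<exists>y\<in>A. E x y" if "x \<in> A" for x by (rule A(4)[OF that])
    show "\<not> ip3 p q r" if "p \<in> V - A" "q \<in> V - A" "r \<in> V - A" "\<forall>x\<in>A. \<not> E p x" "\<forall>x\<in>A. \<not> E q x"
      "\<forall>x\<in>A. \<not> E r x" for p q r by (rule A(5)[OF that])
  qed
  obtain J :: "'a set" and b z y where L: "leg_family V E k J b z y D"
    using P.family D(3) unfolding tds_bound_def by blast
  have "4 * k + 10 \<le> card J" using L leg_family.J(2) by blast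
  then obtain J' where J': "J' \<subseteq> J" "card J' = 4 * k + 10" using obtain_subset_with_card_n by metis
  interpret L: leg_family V E k J' b z y D using leg_family_subset[OF L J'(1)] J'(2) by simp
  have inj: "inj_on b J'" using L.b_indep by (intro inj_onI) blast
  have "hubs (b ` J') = L.H"
    unfolding hubs_def L.H_def using inj unfolding inj_on_def by auto metis
  moreover have "b ` J' \<subseteq> V" using L.leg_V by auto
  moreover have "card (b ` J') = 4 * k + 10" using card_image[OF inj] J'(2) by simp
  ultimately show ?thesis using that[of "b ` J'"] L.family_cert by simp
qed

text \<open>Shaped for \<open>fo_ex_set\<close>, which quantifies over nonempty sets of bounded
  size.\<close>

definition small_no_inst :: "nat \<Rightarrow> bool" where
  "small_no_inst l \<longleftrightarrow> (\<exists>S. S \<subseteq> V \<and> S \<noteq> {} \<and> card S \<le> l \<and> tds S) \<and>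
     \<not> (\<exists>S. S \<subseteq> V \<and> S \<noteq> {} \<and> card S \<le> l \<and> tds S \<and> has_p3 S)"

text \<open>If the minimum is small, \<open>l\<close> is that minimum. Conversely any
  \<open>l\<close> serves: a total dominating set with a path has more than \<open>l\<close>
  vertices and is beaten by one with at most \<open>l\<close>. If the minimum is large, there is a
  certificate. The edgeless case stands for graphs that may have no total dominating set.\<close>

theorem no_inst_iff:
  assumes free: "p4kp3_free k" and conn: "conn V"
  shows "no_inst \<longleftrightarrow> (\<forall>u v. \<not> E u v) \<or> (\<exists>l\<in>{1..tds_bound k}. small_no_inst l) \<or>
    (\<exists>X. X \<subseteq> V \<and> X \<noteq> {} \<and> card X \<le> 4 * k + 10 \<and> cert (hubs X) k)"
    (is "_ \<longleftrightarrow> ?E \<or> ?S \<or> ?C")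
proof (intro iffI)
  assume no: no_inst
  show "?E \<or> ?S \<or> ?C"
  proof (cases ?E)
    case False
    then obtain u0 v0 where uv: "E u0 v0" by auto
    have "tds V"
      unfolding tds_def
    proof (intro conjI ballI order_refl)
      fix v assume v: "v \<in> V"
      have "{v} \<noteq> V" using uv E_V[OF uv] irr[of u0] by auto
      then show "\<exists>u\<in>V. E v u" using conn v unfolding conn_def by blast
    qed
    then obtain D where D: "tds D" "\<And>D'. tds D' \<Longrightarrow> card D \<le> card D'"
      using ex_has_least_nat[of tds V card] by blast
    have DV: "D \<subseteq> V" "D \<noteq> {}" using D(1) E_V[OF uv] unfolding tds_def by auto
    then have D1: "1 \<le> card D" using tds_finite[OF D(1)] by (simp add: Suc_le_eq card_gt_0_iff)
    show ?thesis
    proof (cases "card D \<le> tds_bound k")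
      case True
      have "\<not> has_p3 S" if S: "tds S" "card S \<le> card D" for S
      proof
        assume "has_p3 S"
        then obtain D' where "tds D'" "card D' < card S" using no S(1) unfolding no_inst_def by auto
        then show False using D(2)[of D'] S(2) by simp
      qed
      then have "small_no_inst (card D)" unfolding small_no_inst_def using D(1) DV by auto
      then show ?thesis using True D1 by auto
    next
      case False
      then obtain X where X: "X \<subseteq> V" "card X = 4 * k + 10" "cert (hubs X) k"
        using no_inst_cert[OF no free conn D] by auto
      have "X \<noteq> {}" using X(2) by auto
      then have ?C using X by (intro exI[of _ X] conjI) simp_all
      then show ?thesis by (intro disjI2)
    qed
  qed simp
next
  assume "?E \<or> ?S \<or> ?C"
  then consider ?E | l where "small_no_inst l" | X where "cert (hubs X) k" by blast
  then show no_inst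
  proof cases
    case 1
    then show ?thesis unfolding no_inst_def has_p3_def by simp
  next
    case 2
    show ?thesis
      unfolding no_inst_def
    proof (intro allI impI)
      fix D assume D: "tds D" "has_p3 D"
      have DV: "D \<subseteq> V" "D \<noteq> {}" using D unfolding tds_def has_p3_def by auto
      have "l < card D"
      proof (rule ccontr)
        assume "\<not> l < card D"
        then have "card D \<le> l" by simp
        then show False using 2[unfolded small_no_inst_def, THEN conjunct2] DV D by blast
      qed
      moreover obtain S where "card S \<le> l" "tds S" using 2[unfolded small_no_inst_def, THEN conjunct1] by auto
      ultimately show "\<exists>D'. tds D' \<and> card D' < card D" by (intro exI[of _ S]) simp
    qed
  next
    case 3
    then show ?thesis by (rule cert_no_inst)
  qed
qed

end

section \<open>First-order formulas\<close>

definition valuation :: "nat \<Rightarrow> nat pair_pre_digraph \<Rightarrow> nat list \<Rightarrow> bool" where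
  "valuation n G e \<longleftrightarrow> input_graph G \<and> length e = n \<and> set e \<subseteq> pverts G"

text \<open>Formulas in the variables below \<open>n\<close> are represented by their truth functions. The quantifier binds
  variable \<open>n\<close>.\<close>

inductive fo :: "nat \<Rightarrow> (nat pair_pre_digraph \<Rightarrow> nat list \<Rightarrow> bool) \<Rightarrow> bool" where
  fo_adj: "i < n \<Longrightarrow> j < n \<Longrightarrow> fo n (\<lambda>G e. (e ! i, e ! j) \<in> parcs G)"
| fo_same: "i < n \<Longrightarrow> j < n \<Longrightarrow> fo n (\<lambda>G e. e ! i = e ! j)"
| fo_not: "fo n P \<Longrightarrow> fo n (\<lambda>G e. \<not> P G e)"
| fo_and: "fo n P \<Longrightarrow> fo n Q \<Longrightarrow> fo n (\<lambda>G e. P G e \<and> Q G e)"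
| fo_some: "fo (Suc n) P \<Longrightarrow> fo n (\<lambda>G e. \<exists>v\<in>pverts G. P G (e @ [v]))"
| fo_cong: "fo n P \<Longrightarrow> (\<And>G e. valuation n G e \<Longrightarrow> Q G e \<longleftrightarrow> P G e) \<Longrightarrow> fo n Q"

section \<open>Evaluation on the machine\<close>

definition matrix_in :: "nat pair_pre_digraph \<Rightarrow> nat \<Rightarrow> (nat \<Rightarrow> nat) \<Rightarrow> bool" where
  "matrix_in G N m \<longleftrightarrow> pverts G = {0..<N} \<and> (\<forall>u<N. \<forall>v<N. m (u * N + v) \<noteq> 0 \<longleftrightarrow> (u, v) \<in> parcs G)"

text \<open>Register 1 holds the number of vertices, register 2 the constant 1, and register 3 receives the
  truth value. The four registers from \<open>10 + 4 * i\<close> on belong to variable \<open>i\<close>: its value, the offset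
  of its matrix row, a loop counter, and the truth value accumulated by its quantifier.\<close>

definition regs_in :: "nat \<Rightarrow> nat \<Rightarrow> nat list \<Rightarrow> (nat \<Rightarrow> nat) \<Rightarrow> bool" where
  "regs_in N n e r \<longleftrightarrow> r 1 = N \<and> r 2 = 1 \<and> (\<forall>i<n. r (10 + 4 * i) = e ! i \<and> r (11 + 4 * i) = e ! i * N)"

text \<open>What a subprogram in \<open>n\<close> variables must preserve. Registers 0 and 3 to 9
  are scratch space, and those from \<open>10 + 4 * n\<close> on are left to inner
  quantifiers.\<close>

definition kept :: "nat \<Rightarrow> (nat \<Rightarrow> nat) \<Rightarrow> (nat \<Rightarrow> nat) \<Rightarrow> bool" where
  "kept n r r' \<longleftrightarrow> r' 1 = r 1 \<and> r' 2 = r 2 \<and> (\<forall>j. 10 \<le> j \<longrightarrow> j < 10 + 4 * n \<longrightarrow> r' j = r j)"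

definition evaluates :: "nat \<Rightarrow> com \<Rightarrow> nat poly \<Rightarrow> (nat pair_pre_digraph \<Rightarrow> nat list \<Rightarrow> bool) \<Rightarrow> bool" where
  "evaluates n c p P \<longleftrightarrow> (\<forall>G e N r m. valuation n G e \<longrightarrow> matrix_in G N m \<longrightarrow> regs_in N n e r \<longrightarrow>
     (\<exists>t r'. exec c (r, m) t (r', m) \<and> t \<le> poly p N \<and> kept n r r' \<and> (r' 3 \<noteq> 0 \<longleftrightarrow> P G e)))"

lemma evaluatesD:
  assumes "evaluates n c p P" "valuation n G e" "matrix_in G N m" "regs_in N n e r"
  obtains t r' where "exec c (r, m) t (r', m)" "t \<le> poly p N" "kept n r r'" "r' 3 \<noteq> 0 \<longleftrightarrow> P G e"
  using assms unfolding evaluates_def by blast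

lemma kept_regs: "kept n r r' \<Longrightarrow> regs_in N n e r \<Longrightarrow> regs_in N n e r'"
  unfolding kept_def regs_in_def by auto

lemma kept_trans: "kept n r r' \<Longrightarrow> kept n r' r'' \<Longrightarrow> kept n r r''"
  unfolding kept_def by auto

lemma kept_refl: "kept n r r"
  unfolding kept_def by simp

lemma kept_upd: "x = 0 \<or> (3 \<le> x \<and> x < 10) \<or> 10 + 4 * n \<le> x \<Longrightarrow> kept n r (r(x := v))"
  unfolding kept_def by auto

lemma kept_less: "kept (Suc n) r r' \<Longrightarrow> kept n r r'"
  unfolding kept_def by auto

text \<open>Since the machine cannot multiply, the row offset is kept in a register, and the address
  of the matrix entry is a single sum.\<close>

lemma evaluates_adj:
  assumes "i < n" "j < n"
  shows "evaluates n (Seq (Add 4 (11 + 4 * i) (10 + 4 * j)) (Load 3 4)) [:2:] (\<lambda>G e. (e ! i, e ! j) \<in> parcs G)"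
  unfolding evaluates_def
proof (intro allI impI)
  fix G e N and r m :: "nat \<Rightarrow> nat"
  assume v: "valuation n G e" and M: "matrix_in G N m" and R: "regs_in N n e r"
  let ?r1 = "r(4 := r (11 + 4 * i) + r (10 + 4 * j))"
  let ?r2 = "?r1(3 := m (?r1 4))"
  have "exec (Seq (Add 4 (11 + 4 * i) (10 + 4 * j)) (Load 3 4)) (r, m) (1 + 1) (?r2, m)"
    by (rule exec_Seq exec_Add exec_Load)+
  moreover have "kept n r ?r2"
    by (rule kept_trans[of n r ?r1]) (rule kept_upd, simp)+
  moreover have "e ! i \<in> pverts G" "e ! j \<in> pverts G" using v assms unfolding valuation_def by auto
  then have "e ! i < N" "e ! j < N" using M unfolding matrix_in_def by auto
  then have "?r2 3 \<noteq> 0 \<longleftrightarrow> (e ! i, e ! j) \<in> parcs G"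
    using M R assms unfolding matrix_in_def regs_in_def by simp
  ultimately show "\<exists>t r'. exec (Seq (Add 4 (11 + 4 * i) (10 + 4 * j)) (Load 3 4)) (r, m) t (r', m) \<and>
      t \<le> poly [:2:] N \<and> kept n r r' \<and> (r' 3 \<noteq> 0 \<longleftrightarrow> (e ! i, e ! j) \<in> parcs G)"
    by (intro exI[of _ "1 + 1"] exI[of _ ?r2]) simp
qed

definition neg_com :: com where "neg_com = Cond 3 (Const 3 0) (Const 3 1)"

lemma exec_neg:
  "\<exists>r'. exec neg_com (r, m) 2 (r', m) \<and> kept n r r' \<and> (r' 3 \<noteq> 0 \<longleftrightarrow> r 3 = 0)"
proof (cases "r 3 = 0")
  case True
  then have "exec neg_com (r, m) (1 + 1) (r(3 := 1), m)"
    unfolding neg_com_def by (intro exec_CondFalse exec_Const) simp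
  then show ?thesis using True by (intro exI[of _ "r(3 := 1)"]) (simp add: kept_upd numeral_2_eq_2)
next
  case False
  then have "exec neg_com (r, m) (1 + 1) (r(3 := 0), m)"
    unfolding neg_com_def by (intro exec_CondTrue exec_Const) simp
  then show ?thesis using False by (intro exI[of _ "r(3 := 0)"]) (simp add: kept_upd numeral_2_eq_2)
qed

text \<open>Subtraction is truncated, so the values agree iff both differences are 0.\<close>

lemma evaluates_same:
  assumes "i < n" "j < n"
  shows "evaluates n (Seq (Sub 3 (10 + 4 * i) (10 + 4 * j)) (Seq (Sub 4 (10 + 4 * j) (10 + 4 * i))
      (Seq (Add 3 3 4) neg_com))) [:5:] (\<lambda>G e. e ! i = e ! j)"
  unfolding evaluates_def
proof (intro allI impI)
  fix G e N and r m :: "nat \<Rightarrow> nat"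
  assume v: "valuation n G e" and M: "matrix_in G N m" and R: "regs_in N n e r"
  let ?c = "Seq (Sub 3 (10 + 4 * i) (10 + 4 * j)) (Seq (Sub 4 (10 + 4 * j) (10 + 4 * i))
      (Seq (Add 3 3 4) neg_com))"
  let ?r1 = "r(3 := r (10 + 4 * i) - r (10 + 4 * j))"
  let ?r2 = "?r1(4 := ?r1 (10 + 4 * j) - ?r1 (10 + 4 * i))"
  let ?r3 = "?r2(3 := ?r2 3 + ?r2 4)"
  obtain r' where r': "exec neg_com (?r3, m) 2 (r', m)" "kept n ?r3 r'" "r' 3 \<noteq> 0 \<longleftrightarrow> ?r3 3 = 0"
    using exec_neg by blast
  have "exec ?c (r, m) (1 + (1 + (1 + 2))) (r', m)"
    by (rule exec_Seq exec_Sub exec_Add r'(1))+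
  moreover have "kept n r ?r1" "kept n ?r1 ?r2" "kept n ?r2 ?r3" by (rule kept_upd, simp)+
  then have "kept n r r'" using r'(2) kept_trans by blast
  moreover have "r (10 + 4 * i) = e ! i" "r (10 + 4 * j) = e ! j" using R assms unfolding regs_in_def by auto
  then have "r' 3 \<noteq> 0 \<longleftrightarrow> e ! i = e ! j" using r'(3) by auto
  ultimately show "\<exists>t r'. exec ?c (r, m) t (r', m) \<and> t \<le> poly [:5:] N \<and> kept n r r' \<and> (r' 3 \<noteq> 0 \<longleftrightarrow> e ! i = e ! j)"
    by (intro exI[of _ "1 + (1 + (1 + 2))"] exI[of _ r']) simp
qed

lemma evaluates_not:
  assumes c: "evaluates n c p P"
  shows "evaluates n (Seq c neg_com) (p + [:2:]) (\<lambda>G e. \<not> P G e)"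
  unfolding evaluates_def
proof (intro allI impI)
  fix G e N and r m :: "nat \<Rightarrow> nat"
  assume H: "valuation n G e" "matrix_in G N m" "regs_in N n e r"
  obtain t r1 where r1: "exec c (r, m) t (r1, m)" "t \<le> poly p N" "kept n r r1" "r1 3 \<noteq> 0 \<longleftrightarrow> P G e"
    using evaluatesD[OF c H] .
  obtain r2 where r2: "exec neg_com (r1, m) 2 (r2, m)" "kept n r1 r2" "r2 3 \<noteq> 0 \<longleftrightarrow> r1 3 = 0"
    using exec_neg by blast
  have "r2 3 \<noteq> 0 \<longleftrightarrow> \<not> P G e" using r1(4) r2(3) by metis
  moreover have "t + 2 \<le> poly (p + [:2:]) N" using r1(2) by simp
  ultimately show "\<exists>t r'. exec (Seq c neg_com) (r, m) t (r', m) \<and> t \<le> poly (p + [:2:]) N \<and> kept n r r' \<and>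
      (r' 3 \<noteq> 0 \<longleftrightarrow> \<not> P G e)"
    using exec_Seq[OF r1(1) r2(1)] kept_trans[OF r1(3) r2(2)] by blast
qed

lemma evaluates_and:
  assumes c: "evaluates n c p P" and d: "evaluates n d q Q"
  shows "evaluates n (Seq c (Cond 3 d Skip)) (p + q + [:2:]) (\<lambda>G e. P G e \<and> Q G e)"
  unfolding evaluates_def
proof (intro allI impI)
  fix G e N and r m :: "nat \<Rightarrow> nat"
  assume H: "valuation n G e" "matrix_in G N m" "regs_in N n e r"
  obtain t r1 where r1: "exec c (r, m) t (r1, m)" "t \<le> poly p N" "kept n r r1" "r1 3 \<noteq> 0 \<longleftrightarrow> P G e"
    using evaluatesD[OF c H] .
  show "\<exists>t r'. exec (Seq c (Cond 3 d Skip)) (r, m) t (r', m) \<and> t \<le> poly (p + q + [:2:]) N \<and> kept n r r' \<and>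
      (r' 3 \<noteq> 0 \<longleftrightarrow> P G e \<and> Q G e)"
  proof (cases "r1 3 = 0")
    case True
    then have "exec (Cond 3 d Skip) (r1, m) (1 + 1) (r1, m)" by (intro exec_CondFalse exec_Skip) simp
    then have "exec (Seq c (Cond 3 d Skip)) (r, m) (t + (1 + 1)) (r1, m)" by (rule exec_Seq[OF r1(1)])
    moreover have "t + (1 + 1) \<le> poly (p + q + [:2:]) N" using r1(2) by simp
    moreover have "r1 3 \<noteq> 0 \<longleftrightarrow> P G e \<and> Q G e" using True r1(4) by metis
    ultimately show ?thesis using r1(3) by blast
  next
    case False
    obtain u r2 where r2: "exec d (r1, m) u (r2, m)" "u \<le> poly q N" "kept n r1 r2" "r2 3 \<noteq> 0 \<longleftrightarrow> Q G e"
      using evaluatesD[OF d H(1,2) kept_regs[OF r1(3) H(3)]] .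
    have "exec (Cond 3 d Skip) (r1, m) (1 + u) (r2, m)" using False r2(1) by (intro exec_CondTrue) simp
    then have "exec (Seq c (Cond 3 d Skip)) (r, m) (t + (1 + u)) (r2, m)" by (rule exec_Seq[OF r1(1)])
    moreover have "t + (1 + u) \<le> poly (p + q + [:2:]) N" using r1(2) r2(2) by simp
    moreover have "r2 3 \<noteq> 0 \<longleftrightarrow> P G e \<and> Q G e" using False r1(4) r2(4) by metis
    ultimately show ?thesis using kept_trans[OF r1(3) r2(3)] by blast
  qed
qed

text \<open>The row offset in \<open>b + 1\<close> grows by the number of vertices along with the
  variable in \<open>b\<close>, in place of a multiplication. Register \<open>b + 3\<close> is set
  but not reset, and so collects the disjunction.\<close>

definition step_com :: "nat \<Rightarrow> com \<Rightarrow> com" where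
  "step_com b c = Seq c (Seq (Cond 3 (Const (b + 3) 1) Skip)
     (Seq (Add b b 2) (Seq (Add (b + 1) (b + 1) 1) (Sub (b + 2) (b + 2) 2))))"

text \<open>Adding a register that holds 0 serves as a copy: \<open>b + 3\<close> is 0 when the loop
  counter is initialised, and \<open>b + 2\<close> is 0 after the loop.\<close>

definition some_com :: "nat \<Rightarrow> com \<Rightarrow> com" where
  "some_com b c = Seq (Const b 0) (Seq (Const (b + 1) 0) (Seq (Const (b + 3) 0) (Seq (Add (b + 2) 1 (b + 3))
     (Seq (Loop (b + 2) (step_com b c)) (Add 3 (b + 3) (b + 2))))))"

text \<open>The body is evaluated for \<open>Suc n\<close> variables, so it preserves all four
  registers of variable \<open>n\<close>, including the loop counter and the accumulated
  value.\<close>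

lemma exec_step:
  assumes c: "evaluates (Suc n) c p P" and b: "b = 10 + 4 * n"
    and v: "valuation n G e" and M: "matrix_in G N m" and R: "regs_in N n e r"
    and x: "x < N" "r b = x" "r (b + 1) = x * N"
  obtains t r' where "exec (step_com b c) (r, m) t (r', m)" "t \<le> poly p N + 5" "kept n r r'"
    "r' b = Suc x" "r' (b + 1) = Suc x * N" "r' (b + 2) = r (b + 2) - 1"
    "r' (b + 3) \<noteq> 0 \<longleftrightarrow> r (b + 3) \<noteq> 0 \<or> P G (e @ [x])"
proof -
  have v': "valuation (Suc n) G (e @ [x])" using v x(1) M unfolding valuation_def matrix_in_def by auto
  have R': "regs_in N (Suc n) (e @ [x]) r"
    using R x v b unfolding regs_in_def valuation_def by (auto simp: nth_append less_Suc_eq)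
  obtain t r1 where r1: "exec c (r, m) t (r1, m)" "t \<le> poly p N" "kept (Suc n) r r1"
    "r1 3 \<noteq> 0 \<longleftrightarrow> P G (e @ [x])"
    using evaluatesD[OF c v' M R'] .
  have same: "r1 b = r b" "r1 (b + 1) = r (b + 1)" "r1 (b + 2) = r (b + 2)" "r1 (b + 3) = r (b + 3)"
    "r1 1 = N" "r1 2 = 1"
    using r1(3) R b unfolding kept_def regs_in_def by auto
  define r2 where "r2 = (if r1 3 \<noteq> 0 then r1(b + 3 := 1) else r1)"
  have e2: "exec (Cond 3 (Const (b + 3) 1) Skip) (r1, m) (1 + 1) (r2, m)"
  proof (cases "r1 3 = 0")
    case True
    then show ?thesis unfolding r2_def using exec_CondFalse[OF _ exec_Skip, of "(r1, m)" 3] by simp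
  next
    case False
    then show ?thesis unfolding r2_def using exec_CondTrue[OF _ exec_Const, of r1 m 3] by simp
  qed
  let ?r3 = "r2(b := r2 b + r2 2)"
  let ?r4 = "?r3(b + 1 := ?r3 (b + 1) + ?r3 1)"
  let ?r5 = "?r4(b + 2 := ?r4 (b + 2) - ?r4 2)"
  have ex: "exec (step_com b c) (r, m) (t + ((1 + 1) + (1 + (1 + 1)))) (?r5, m)"
    unfolding step_com_def by (rule exec_Seq r1(1) e2 exec_Add exec_Sub)+
  have k: "kept n r1 r2" unfolding r2_def using b by (simp add: kept_upd kept_refl)
  have "kept n r2 ?r3" "kept n ?r3 ?r4" "kept n ?r4 ?r5" using b by (simp_all add: kept_upd)
  then have kr: "kept n r ?r5" using kept_trans kept_less[OF r1(3)] k by blast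
  have r2: "r2 b = x" "r2 (b + 1) = x * N" "r2 (b + 2) = r (b + 2)" "r2 1 = N" "r2 2 = 1"
    "r2 (b + 3) \<noteq> 0 \<longleftrightarrow> r (b + 3) \<noteq> 0 \<or> P G (e @ [x])"
    unfolding r2_def using same x r1(4) b by auto
  show ?thesis
    by (rule that[OF ex _ kr]) (use r1(2) r2 b in auto)
qed

lemma ex_from_Suc:
  assumes "(x :: nat) < N"
  shows "(\<exists>v. x \<le> v \<and> v < N \<and> R v) \<longleftrightarrow> R x \<or> (\<exists>v. Suc x \<le> v \<and> v < N \<and> R v)"
proof
  assume "\<exists>v. x \<le> v \<and> v < N \<and> R v"
  then obtain v where v: "x \<le> v" "v < N" "R v" by blast
  then show "R x \<or> (\<exists>v. Suc x \<le> v \<and> v < N \<and> R v)" by (cases "v = x") auto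
next
  assume "R x \<or> (\<exists>v. Suc x \<le> v \<and> v < N \<and> R v)"
  then show "\<exists>v. x \<le> v \<and> v < N \<and> R v"
  proof
    assume "R x"
    then show ?thesis using assms by blast
  next
    assume "\<exists>v. Suc x \<le> v \<and> v < N \<and> R v"
    then obtain v where "Suc x \<le> v" "v < N" "R v" by blast
    then show ?thesis by (intro exI[of _ v]) simp
  qed
qed

text \<open>\<open>d\<close> counts the values still to be tried. A round costs the body, five steps
  around it and the loop test.\<close>

lemma exec_loop:
  assumes c: "evaluates (Suc n) c p P" and b: "b = 10 + 4 * n"
    and v: "valuation n G e" and M: "matrix_in G N m"
    and "regs_in N n e r" "r b = x" "r (b + 1) = x * N" "r (b + 2) = d" "x + d = N"
  shows "\<exists>t r'. exec (Loop (b + 2) (step_com b c)) (r, m) t (r', m) \<and> t \<le> d * (poly p N + 6) + 1 \<and> kept n r r' \<and>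
    r' (b + 2) = 0 \<and> (r' (b + 3) \<noteq> 0 \<longleftrightarrow> r (b + 3) \<noteq> 0 \<or> (\<exists>v. x \<le> v \<and> v < N \<and> P G (e @ [v])))"
  using assms(5-)
proof (induction d arbitrary: r x)
  case 0
  have "exec (Loop (b + 2) (step_com b c)) (r, m) 1 (r, m)" using 0 by (intro exec_LoopFalse) simp
  then show ?case using 0 by (intro exI[of _ 1] exI[of _ r]) (auto simp: kept_refl)
next
  case (Suc d)
  have xN: "x < N" using Suc.prems by simp
  obtain t r1 where r1: "exec (step_com b c) (r, m) t (r1, m)" "t \<le> poly p N + 5" "kept n r r1"
    "r1 b = Suc x" "r1 (b + 1) = Suc x * N" "r1 (b + 2) = r (b + 2) - 1"
    "r1 (b + 3) \<noteq> 0 \<longleftrightarrow> r (b + 3) \<noteq> 0 \<or> P G (e @ [x])"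
    using exec_step[OF c b v M Suc.prems(1) xN Suc.prems(2,3)] .
  have "r1 (b + 2) = d" "Suc x + d = N" using r1(6) Suc.prems by simp_all
  then obtain u r2 where r2: "exec (Loop (b + 2) (step_com b c)) (r1, m) u (r2, m)"
    "u \<le> d * (poly p N + 6) + 1" "kept n r1 r2" "r2 (b + 2) = 0"
    "r2 (b + 3) \<noteq> 0 \<longleftrightarrow> r1 (b + 3) \<noteq> 0 \<or> (\<exists>v. Suc x \<le> v \<and> v < N \<and> P G (e @ [v]))"
    using Suc.IH[OF kept_regs[OF r1(3) Suc.prems(1)] r1(4,5)] by blast
  have "exec (Loop (b + 2) (step_com b c)) (r, m) (1 + t + u) (r2, m)"
    using exec_LoopTrue[OF _ r1(1) r2(1)] Suc.prems by simp
  moreover have "1 + t + u \<le> Suc d * (poly p N + 6) + 1" using r1(2) r2(2) by simp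
  moreover have "kept n r r2" using kept_trans[OF r1(3) r2(3)] .
  moreover have "r2 (b + 3) \<noteq> 0 \<longleftrightarrow> r (b + 3) \<noteq> 0 \<or> (\<exists>v. x \<le> v \<and> v < N \<and> P G (e @ [v]))"
    unfolding ex_from_Suc[OF xN, of "\<lambda>v. P G (e @ [v])"] using r2(5) r1(7) by argo
  ultimately show ?case using r2(4) by blast
qed

lemma evaluates_some:
  assumes c: "evaluates (Suc n) c p P"
  shows "evaluates n (some_com (10 + 4 * n) c) ([:0, 1:] * (p + [:6:]) + [:6:])
    (\<lambda>G e. \<exists>v\<in>pverts G. P G (e @ [v]))"
  unfolding evaluates_def
proof (intro allI impI)
  fix G e N and r m :: "nat \<Rightarrow> nat"
  assume v: "valuation n G e" and M: "matrix_in G N m" and R: "regs_in N n e r"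
  define b where "b = 10 + 4 * n"
  let ?r1 = "r(b := 0)" let ?r2 = "?r1(b + 1 := 0)" let ?r3 = "?r2(b + 3 := 0)"
  let ?r4 = "?r3(b + 2 := ?r3 1 + ?r3 (b + 3))"
  have "kept n r ?r1" "kept n ?r1 ?r2" "kept n ?r2 ?r3" "kept n ?r3 ?r4"
    unfolding b_def by (simp_all add: kept_upd)
  then have k4: "kept n r ?r4" using kept_trans by blast
  have v4: "?r4 b = 0" "?r4 (b + 1) = 0 * N" "?r4 (b + 2) = N" "?r4 (b + 3) = 0" "0 + N = N"
    using R unfolding regs_in_def b_def by simp_all
  obtain t r5 where r5: "exec (Loop (b + 2) (step_com b c)) (?r4, m) t (r5, m)" "t \<le> N * (poly p N + 6) + 1"
    "kept n ?r4 r5" "r5 (b + 2) = 0"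
    "r5 (b + 3) \<noteq> 0 \<longleftrightarrow> ?r4 (b + 3) \<noteq> 0 \<or> (\<exists>v. 0 \<le> v \<and> v < N \<and> P G (e @ [v]))"
    using exec_loop[OF c b_def v M kept_regs[OF k4 R] v4(1-3,5)] by blast
  let ?r6 = "r5(3 := r5 (b + 3) + r5 (b + 2))"
  have "exec (some_com b c) (r, m) (1 + (1 + (1 + (1 + (t + 1))))) (?r6, m)"
    unfolding some_com_def by (rule exec_Seq exec_Const exec_Add r5(1))+
  moreover have "kept n r5 ?r6" by (simp add: kept_upd)
  then have "kept n r ?r6" using kept_trans k4 r5(3) by blast
  moreover have "(\<exists>v. 0 \<le> v \<and> v < N \<and> P G (e @ [v])) \<longleftrightarrow> (\<exists>v\<in>pverts G. P G (e @ [v]))"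
    using M unfolding matrix_in_def by auto
  then have "?r6 3 \<noteq> 0 \<longleftrightarrow> (\<exists>v\<in>pverts G. P G (e @ [v]))" using r5(4,5) v4(4) by simp
  moreover have "1 + (1 + (1 + (1 + (t + 1)))) \<le> poly ([:0, 1:] * (p + [:6:]) + [:6:]) N"
    using r5(2) by simp
  ultimately show "\<exists>t r'. exec (some_com (10 + 4 * n) c) (r, m) t (r', m) \<and>
      t \<le> poly ([:0, 1:] * (p + [:6:]) + [:6:]) N \<and> kept n r r' \<and> (r' 3 \<noteq> 0 \<longleftrightarrow> (\<exists>v\<in>pverts G. P G (e @ [v])))"
    unfolding b_def by blast
qed

lemma fo_evaluates: "fo n P \<Longrightarrow> \<exists>c p. evaluates n c p P"
proof (induction rule: fo.induct)
  case (fo_cong n P Q)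
  then obtain c p where "evaluates n c p P" by blast
  then have "evaluates n c p Q" using fo_cong.hyps(2) unfolding evaluates_def by simp
  then show ?case by blast
next
  case (fo_adj i n j)
  show ?case using evaluates_adj[OF fo_adj] by (intro exI)
next
  case (fo_same i n j)
  show ?case using evaluates_same[OF fo_same] by (intro exI)
next
  case (fo_not n P)
  then obtain c p where "evaluates n c p P" by blast
  from evaluates_not[OF this] show ?case by (intro exI)
next
  case (fo_and n P Q)
  then obtain c p d q where "evaluates n c p P" "evaluates n d q Q" by blast
  from evaluates_and[OF this] show ?case by (intro exI)
next
  case (fo_some n P)
  then obtain c p where "evaluates (Suc n) c p P" by blast
  from evaluates_some[OF this] show ?case by (intro exI)
qed

text \<open>The square root of the input length, from \<open>(n + 1)\<^sup>2 = n\<^sup>2 + n + n + 1\<close>.\<close>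

definition sqrt_com :: com where
  "sqrt_com = Seq (Const 2 1) (Seq (Add 5 0 1) (Loop 5
     (Seq (Add 4 4 1) (Seq (Add 4 4 1) (Seq (Add 4 4 2) (Seq (Add 1 1 2) (Sub 5 0 4)))))))"

text \<open>The invariant: register 1 holds \<open>x\<close>, register 4 its square and register 5
  the distance to the input length, which vanishes exactly at \<open>x = N\<close>.\<close>

lemma exec_sqrt_loop:
  assumes "r 0 = N * N" "r 1 = x" "r 2 = 1" "r 4 = x * x" "r 5 = N * N - x * x" "x + d = N"
  shows "\<exists>t r'. exec (Loop 5 (Seq (Add 4 4 1) (Seq (Add 4 4 1) (Seq (Add 4 4 2) (Seq (Add 1 1 2) (Sub 5 0 4))))))
    (r, m) t (r', m) \<and> t \<le> 6 * d + 1 \<and> r' 1 = N \<and> r' 2 = 1"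
  using assms
proof (induction d arbitrary: r x)
  case 0
  then have "exec (Loop 5 (Seq (Add 4 4 1) (Seq (Add 4 4 1) (Seq (Add 4 4 2) (Seq (Add 1 1 2) (Sub 5 0 4))))))
    (r, m) 1 (r, m)" by (intro exec_LoopFalse) simp
  then show ?case using 0 by (intro exI[of _ 1] exI[of _ r]) simp
next
  case (Suc d)
  let ?B = "Seq (Add 4 4 1) (Seq (Add 4 4 1) (Seq (Add 4 4 2) (Seq (Add 1 1 2) (Sub 5 0 4))))"
  let ?r1 = "r(4 := r 4 + r 1)" let ?r2 = "?r1(4 := ?r1 4 + ?r1 1)" let ?r3 = "?r2(4 := ?r2 4 + ?r2 2)"
  let ?r4 = "?r3(1 := ?r3 1 + ?r3 2)" let ?r5 = "?r4(5 := ?r4 0 - ?r4 4)"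
  have "exec ?B (r, m) (1 + (1 + (1 + (1 + 1)))) (?r5, m)"
    by (rule exec_Seq exec_Add exec_Sub)+
  then have B: "exec ?B (r, m) 5 (?r5, m)" by (simp add: numeral_eq_Suc)
  have "\<exists>t r'. exec (Loop 5 ?B) (?r5, m) t (r', m) \<and> t \<le> 6 * d + 1 \<and> r' 1 = N \<and> r' 2 = 1"
    by (rule Suc.IH[of _ "Suc x"]) (use Suc.prems in simp_all)
  then obtain t r' where r': "exec (Loop 5 ?B) (?r5, m) t (r', m)" "t \<le> 6 * d + 1" "r' 1 = N" "r' 2 = 1" by blast
  have "x * x < N * N" using Suc.prems(6) by (intro mult_strict_mono) auto
  then have "fst (r, m) 5 \<noteq> 0" using Suc.prems(5) by simp
  then have "exec (Loop 5 ?B) (r, m) (1 + 5 + t) (r', m)" by (rule exec_LoopTrue[OF _ B r'(1)])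
  then show ?case using r'(2-4) by (intro exI[of _ "1 + 5 + t"] exI[of _ r']) simp
qed

lemma poly_nat_mono: "x \<le> y \<Longrightarrow> poly p x \<le> poly (p :: nat poly) y"
  by (induction p) (auto intro!: add_mono mult_mono)

text \<open>Time polynomial in the number \<open>N\<close> of vertices is polynomial in the input
  length \<open>N * N\<close>, since polynomials over \<open>nat\<close> are monotone. The summand
  \<open>6 * N\<close> is for the square root; the last two instructions copy the truth value to
  register 0.\<close>

theorem fo_poly_time:
  assumes P: "fo 0 P" and Q: "\<And>G. G \<in> C \<Longrightarrow> input_graph G \<and> (Q G \<longleftrightarrow> P G [])"
  shows "poly_time_solvable_on adjacency_matrix Q C"
proof -
  obtain c p where c: "evaluates 0 c p P" using fo_evaluates[OF P] by blast
  have "\<exists>t s. exec (Seq sqrt_com (Seq c (Seq (Const 4 0) (Add 0 3 4)))) (init_state (adjacency_matrix G)) t s \<and>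
      t \<le> poly (p + [:0, 6:] + [:10:]) (length (adjacency_matrix G)) \<and> (accepting s \<longleftrightarrow> Q G)" if G: "G \<in> C" for G
  proof -
    have ig: "input_graph G" using Q[OF G] by blast
    then obtain N where N: "pverts G = {0..<N}" unfolding input_graph_def by blast
    have len: "length (adjacency_matrix G) = N * N" using N by (simp add: adjacency_matrix_def Let_def)
    define m where "m = snd (init_state (adjacency_matrix G))"
    define r where "r = fst (init_state (adjacency_matrix G))"
    have i: "init_state (adjacency_matrix G) = (r, m)" unfolding r_def m_def by simp
    have r: "r 0 = N * N" "\<And>x. x \<noteq> 0 \<Longrightarrow> r x = 0" unfolding r_def init_state_def len by simp_all
    have M: "matrix_in G N m"
      unfolding matrix_in_def
    proof (intro conjI allI impI)
      fix u v assume uv: "u < N" "v < N"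
      have "u * N + v < Suc u * N" using uv(2) by simp
      also have "\<dots> \<le> N * N" using uv(1) by (intro mult_le_mono1) simp
      finally have l: "u * N + v < N * N" .
      then have "adjacency_matrix G ! (u * N + v) \<longleftrightarrow> (u, v) \<in> parcs G"
        using N uv by (simp add: adjacency_matrix_def Let_def)
      then show "m (u * N + v) \<noteq> 0 \<longleftrightarrow> (u, v) \<in> parcs G"
        unfolding m_def init_state_def using len l by simp
    qed (rule N)
    let ?r1 = "r(2 := 1)" let ?r2 = "?r1(5 := ?r1 0 + ?r1 1)"
    have "\<exists>t r'. exec (Loop 5 (Seq (Add 4 4 1) (Seq (Add 4 4 1) (Seq (Add 4 4 2) (Seq (Add 1 1 2) (Sub 5 0 4))))))
        (?r2, m) t (r', m) \<and> t \<le> 6 * N + 1 \<and> r' 1 = N \<and> r' 2 = 1"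
      by (rule exec_sqrt_loop[of _ _ 0]) (use r in simp_all)
    then obtain t1 r3 where r3: "exec (Loop 5 (Seq (Add 4 4 1) (Seq (Add 4 4 1) (Seq (Add 4 4 2) (Seq (Add 1 1 2) (Sub 5 0 4))))))
        (?r2, m) t1 (r3, m)" "t1 \<le> 6 * N + 1" "r3 1 = N" "r3 2 = 1" by blast
    have e1: "exec sqrt_com (r, m) (1 + (1 + t1)) (r3, m)"
      unfolding sqrt_com_def by (rule exec_Seq exec_Const exec_Add r3(1))+
    have "valuation 0 G []" "regs_in N 0 [] r3" using ig r3 unfolding valuation_def regs_in_def by auto
    then obtain t2 r4 where r4: "exec c (r3, m) t2 (r4, m)" "t2 \<le> poly p N" "r4 3 \<noteq> 0 \<longleftrightarrow> P G []"
      using evaluatesD[OF c _ M] by metis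
    let ?r5 = "r4(4 := 0)" let ?r6 = "?r5(0 := ?r5 3 + ?r5 4)"
    have "exec (Seq sqrt_com (Seq c (Seq (Const 4 0) (Add 0 3 4)))) (r, m) ((1 + (1 + t1)) + (t2 + (1 + 1))) (?r6, m)"
      by (rule exec_Seq e1 r4(1) exec_Const exec_Add)+
    moreover have "accepting (?r6, m) \<longleftrightarrow> Q G" using r4(3) Q[OF G] unfolding accepting_def by simp
    moreover have "(1 + (1 + t1)) + (t2 + (1 + 1)) \<le> poly (p + [:0, 6:] + [:10:]) N"
      using r3(2) r4(2) by simp
    moreover have "poly (p + [:0, 6:] + [:10:]) N \<le> poly (p + [:0, 6:] + [:10:]) (N * N)"
      by (rule poly_nat_mono) (cases N, simp_all)
    ultimately show ?thesis unfolding i len by (meson order_trans)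
  qed
  then show ?thesis unfolding poly_time_solvable_on_def by blast
qed

section \<open>The characterisation as a formula\<close>

context sgraph begin

text \<open>A formula quantifies over vertices one at a time, so far sets become lists. Their
  entries are distinct because \<open>near\<close> is reflexive outside \<open>H\<close>.\<close>

definition farl :: "'a set \<Rightarrow> 'a list \<Rightarrow> bool" where
  "farl H xs \<longleftrightarrow> (\<forall>i<length xs. xs ! i \<notin> H) \<and> (\<forall>i<length xs. \<forall>j<length xs. i \<noteq> j \<longrightarrow> \<not> near H (xs ! i) (xs ! j))"

lemma farl_far:
  assumes "farl H xs" "set xs \<subseteq> V"
  shows "far H (set xs)" "card (set xs) = length xs"
proof -
  have sub: "set xs \<subseteq> V - H" using assms unfolding farl_def by (auto simp: in_set_conv_nth)
  moreover have "\<not> near H x y" if xy: "x \<in> set xs" "y \<in> set xs" "x \<noteq> y" for x y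
  proof -
    obtain i j where "i < length xs" "x = xs ! i" "j < length xs" "y = xs ! j"
      using xy(1,2) by (metis in_set_conv_nth)
    then show ?thesis using assms(1) xy(3) unfolding farl_def by auto
  qed
  ultimately show "far H (set xs)" unfolding far_def by simp
  have "distinct xs"
    unfolding distinct_conv_nth
  proof (intro allI impI notI)
    fix i j assume ij: "i < length xs" "j < length xs" "i \<noteq> j" "xs ! i = xs ! j"
    have "xs ! i \<in> V - H" using sub nth_mem[OF ij(1)] by blast
    then have "near H (xs ! i) (xs ! j)" using near_refl ij(4) by simp
    then show False using assms(1) ij unfolding farl_def by auto
  qed
  then show "card (set xs) = length xs" by (rule distinct_card)
qed

lemma far_farl:
  assumes "far H X" "m \<le> card X"
  obtains xs where "length xs = m" "set xs \<subseteq> X" "farl H xs"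
proof -
  obtain X' where X': "X' \<subseteq> X" "card X' = m" "finite X'" using obtain_subset_with_card_n[OF assms(2)] by metis
  obtain xs where xs: "set xs = X'" "distinct xs" using finite_distinct_list[OF X'(3)] by auto
  then have len: "length xs = m" using distinct_card[of xs] X'(2) by simp
  have "farl H xs"
    unfolding farl_def
  proof (intro conjI allI impI)
    show "xs ! i \<notin> H" if "i < length xs" for i
      using nth_mem[OF that] xs(1) X'(1) assms(1) unfolding far_def by auto
    show "\<not> near H (xs ! i) (xs ! j)" if ij: "i < length xs" "j < length xs" "i \<noteq> j" for i j
    proof -
      have "xs ! i \<noteq> xs ! j" using xs(2) ij nth_eq_iff_index_eq by auto
      moreover have "xs ! i \<in> X" "xs ! j \<in> X" using nth_mem[OF ij(1)] nth_mem[OF ij(2)] xs(1) X'(1) by auto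
      ultimately show ?thesis using assms(1) unfolding far_def by auto
    qed
  qed
  then show ?thesis using that[of xs] len xs(1) X'(1) by simp
qed

text \<open>Far sets are closed under subsets, so a bound on their size is the absence of a list of
  length \<open>Suc c\<close>, and a lower bound is the presence of a list. The condition on
  \<open>X\<close> and \<open>T\<close> is split according to the size \<open>r\<close> of
  \<open>X\<close>, which fixes the number of quantifiers.\<close>

lemma cert_iff:
  assumes HV: "H \<subseteq> V"
  shows "cert H c \<longleftrightarrow>
    (\<forall>x\<in>V. \<forall>y\<in>V. \<forall>z\<in>V. near H x y \<longrightarrow> near H y z \<longrightarrow> near H x z) \<and>
    (\<forall>v\<in>V. v \<in> H \<or> (\<exists>w\<in>V. w \<notin> H \<and> E v w \<and> (\<forall>y\<in>V. near H v y \<longrightarrow> E y v \<or> E y w))) \<and>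
    (\<forall>h\<in>V. h \<in> H \<longrightarrow> \<not> (\<exists>xs. length xs = Suc c \<and> set xs \<subseteq> V \<and> farl H xs \<and> (\<forall>i<Suc c. \<not> good H h (xs ! i)))) \<and>
    (\<forall>r\<in>{1..3 * c + 2}. \<not> (\<exists>xs. length xs = r \<and> set xs \<subseteq> V \<and> farl H xs \<and>
      (\<exists>T. T \<subseteq> V \<and> T \<noteq> {} \<and> card T \<le> 2 * r \<and>
        (\<exists>t\<in>T. t \<in> H) \<and> (\<forall>i<r. \<forall>y\<in>V. near H (xs ! i) y \<longrightarrow> (\<exists>t\<in>T. E y t))))) \<and>
    (\<exists>xs. length xs = 2 * c + 2 \<and> set xs \<subseteq> V \<and> farl H xs)"
    (is "_ \<longleftrightarrow> ?trans \<and> ?pair \<and> ?bad \<and> ?cost \<and> ?many")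
proof -
  have 1: "(\<forall>x y z. near H x y \<longrightarrow> near H y z \<longrightarrow> near H x z) \<longleftrightarrow> ?trans"
    unfolding near_def by blast
  have 2: "(\<forall>v\<in>V - H. \<exists>w\<in>V - H. E v w \<and> (\<forall>y. near H v y \<longrightarrow> E y v \<or> E y w)) \<longleftrightarrow> ?pair"
  proof -
    have y: "(\<forall>y. near H v y \<longrightarrow> E y v \<or> E y w) \<longleftrightarrow> (\<forall>y\<in>V. near H v y \<longrightarrow> E y v \<or> E y w)" for v w
      using near_V[of H v] by blast
    show ?thesis unfolding y by blast
  qed
  have 3: "(\<forall>h\<in>H. \<forall>X. far H X \<longrightarrow> (\<forall>x\<in>X. \<not> good H h x) \<longrightarrow> card X \<le> c) \<longleftrightarrow> ?bad"
  proof
    assume l: "\<forall>h\<in>H. \<forall>X. far H X \<longrightarrow> (\<forall>x\<in>X. \<not> good H h x) \<longrightarrow> card X \<le> c"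
    show ?bad
    proof (intro ballI impI notI)
      fix h assume h: "h \<in> H"
      assume "\<exists>xs. length xs = Suc c \<and> set xs \<subseteq> V \<and> farl H xs \<and> (\<forall>i<Suc c. \<not> good H h (xs ! i))"
      then obtain xs where xs: "length xs = Suc c" "set xs \<subseteq> V" "farl H xs" "\<forall>i<Suc c. \<not> good H h (xs ! i)" by auto
      have "\<forall>x\<in>set xs. \<not> good H h x" using xs(1,4) by (auto simp: in_set_conv_nth)
      then have "card (set xs) \<le> c" using l h farl_far(1)[OF xs(3,2)] by blast
      then show False using farl_far(2)[OF xs(3,2)] xs(1) by simp
    qed
  next
    assume r: ?bad
    show "\<forall>h\<in>H. \<forall>X. far H X \<longrightarrow> (\<forall>x\<in>X. \<not> good H h x) \<longrightarrow> card X \<le> c"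
    proof (intro ballI allI impI, rule ccontr)
      fix h X assume h: "h \<in> H" and X: "far H X" "\<forall>x\<in>X. \<not> good H h x" "\<not> card X \<le> c"
      then have "Suc c \<le> card X" by simp
      then obtain xs where xs: "length xs = Suc c" "set xs \<subseteq> X" "farl H xs" by (rule far_farl[OF X(1)])
      have "set xs \<subseteq> V" using xs(2) X(1) unfolding far_def by auto
      moreover have "\<forall>i<Suc c. \<not> good H h (xs ! i)"
      proof (intro allI impI)
        fix i assume "i < Suc c"
        then have "xs ! i \<in> X" using xs(1,2) nth_mem[of i xs] by auto
        then show "\<not> good H h (xs ! i)" using X(2) by blast
      qed
      moreover have "h \<in> V" using h HV by auto
      ultimately show False using mp[OF bspec[OF r] h] xs(1,3) by blast
    qed
  qed
  have 4: "(\<forall>X T. far H X \<longrightarrow> X \<noteq> {} \<longrightarrow> card X \<le> 3 * c + 2 \<longrightarrow> T \<subseteq> V \<longrightarrow> card T \<le> 2 * card X \<longrightarrow>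
      T \<inter> H \<noteq> {} \<longrightarrow> (\<exists>x\<in>X. \<exists>y. near H x y \<and> (\<forall>t\<in>T. \<not> E y t))) \<longleftrightarrow> ?cost" (is "?L \<longleftrightarrow> _")
  proof
    assume l: ?L
    show ?cost
    proof (intro ballI notI)
      fix r assume r: "r \<in> {1..3 * c + 2}"
      assume "\<exists>xs. length xs = r \<and> set xs \<subseteq> V \<and> farl H xs \<and>
        (\<exists>T. T \<subseteq> V \<and> T \<noteq> {} \<and> card T \<le> 2 * r \<and>
          (\<exists>t\<in>T. t \<in> H) \<and> (\<forall>i<r. \<forall>y\<in>V. near H (xs ! i) y \<longrightarrow> (\<exists>t\<in>T. E y t)))"
      then obtain xs T where xs: "length xs = r" "set xs \<subseteq> V" "farl H xs" and T: "T \<subseteq> V" "card T \<le> 2 * r"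
        "\<exists>t\<in>T. t \<in> H" "\<forall>i<r. \<forall>y\<in>V. near H (xs ! i) y \<longrightarrow> (\<exists>t\<in>T. E y t)" by auto
      note f = farl_far[OF xs(3,2)]
      have "set xs \<noteq> {}" using xs(1) r by auto
      moreover have "card (set xs) \<le> 3 * c + 2" "card T \<le> 2 * card (set xs)" using f(2) xs(1) r T(2) by auto
      moreover have "T \<inter> H \<noteq> {}" using T(3) by auto
      ultimately have "\<exists>x\<in>set xs. \<exists>y. near H x y \<and> (\<forall>t\<in>T. \<not> E y t)" using l f(1) T(1) by blast
      then obtain x y where x: "x \<in> set xs" "near H x y" "\<forall>t\<in>T. \<not> E y t" by auto
      then obtain i where "i < r" "x = xs ! i" using xs(1) by (auto simp: in_set_conv_nth)
      then show False using T(4) x near_V[OF x(2)] by auto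
    qed
  next
    assume r: ?cost
    show ?L
    proof (intro allI impI, rule ccontr)
      fix X T assume X: "far H X" "X \<noteq> {}" "card X \<le> 3 * c + 2" and T: "T \<subseteq> V" "card T \<le> 2 * card X" "T \<inter> H \<noteq> {}"
        and n: "\<not> (\<exists>x\<in>X. \<exists>y. near H x y \<and> (\<forall>t\<in>T. \<not> E y t))"
      have XV: "X \<subseteq> V" using X(1) unfolding far_def by auto
      have "card X \<noteq> 0" using X(2) finite_subset[OF XV fin] by simp
      then have rX: "card X \<in> {1..3 * c + 2}" using X(3) by auto
      obtain xs where xs: "length xs = card X" "set xs \<subseteq> X" "farl H xs" by (rule far_farl[OF X(1) order_refl])
      have "\<forall>i<card X. \<forall>y\<in>V. near H (xs ! i) y \<longrightarrow> (\<exists>t\<in>T. E y t)"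
      proof (intro allI ballI impI)
        fix i y assume "i < card X" "near H (xs ! i) y"
        moreover from this have "xs ! i \<in> X" using xs(1,2) nth_mem[of i xs] by auto
        ultimately show "\<exists>t\<in>T. E y t" using n by blast
      qed
      moreover have "set xs \<subseteq> V" using xs(2) XV by simp
      moreover have "T \<noteq> {}" "\<exists>t\<in>T. t \<in> H" using T(3) by auto
      ultimately show False using bspec[OF r rX] xs(1,3) T(1,2) by blast
    qed
  qed
  have 5: "(\<exists>X. far H X \<and> card X = 2 * c + 2) \<longleftrightarrow> ?many"
  proof
    assume "\<exists>X. far H X \<and> card X = 2 * c + 2"
    then obtain X where X: "far H X" "2 * c + 2 \<le> card X" by auto
    obtain xs where "length xs = 2 * c + 2" "set xs \<subseteq> X" "farl H xs" by (rule far_farl[OF X])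
    moreover from this have "set xs \<subseteq> V" using X(1) unfolding far_def by auto
    ultimately show ?many by blast
  next
    assume ?many
    then show "\<exists>X. far H X \<and> card X = 2 * c + 2" using farl_far by metis
  qed
  show ?thesis unfolding cert_def 1 2 3 4 5 using HV by simp
qed

end

section \<open>Terms, sets of terms and derived quantifiers\<close>

definition var :: "nat \<Rightarrow> (nat list \<Rightarrow> nat) \<Rightarrow> bool" where
  "var n t \<longleftrightarrow> (\<exists>i<n. \<forall>e. length e = n \<longrightarrow> t e = e ! i)"

text \<open>A set listed by variables at fixed positions \<open>J\<close>, such as the vertices that
  determine the hubs.\<close>

definition set_var :: "nat \<Rightarrow> (nat list \<Rightarrow> nat set) \<Rightarrow> bool" where
  "set_var n S \<longleftrightarrow> (\<exists>J\<subseteq>{..<n}. \<forall>e. length e = n \<longrightarrow> S e = (!) e ` J)"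

text \<open>Below a quantifier the bound vertex is \<open>last e\<close> and the outer variables are
  read from \<open>butlast e\<close>; below a block of quantifiers, \<open>drop n e\<close> and
  \<open>take n e\<close> take these roles.\<close>

lemma var_last: "var (Suc n) last"
  unfolding var_def
proof (intro exI[of _ n] conjI allI impI)
  fix e :: "nat list" assume "length e = Suc n"
  moreover from this have "e \<noteq> []" by auto
  ultimately show "last e = e ! n" by (simp add: last_conv_nth)
qed simp

lemma var_butlast:
  assumes "var n t" shows "var (Suc n) (\<lambda>e. t (butlast e))"
proof -
  obtain i where i: "i < n" "\<And>e. length e = n \<Longrightarrow> t e = e ! i" using assms unfolding var_def by auto
  then show ?thesis unfolding var_def by (intro exI[of _ i]) (simp add: nth_butlast)
qed

lemma set_var_butlast: 
  assumes "set_var n S" shows "set_var (Suc n) (\<lambda>e. S (butlast e))"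
proof -
  obtain J where J: "J \<subseteq> {..<n}" "\<And>e. length e = n \<Longrightarrow> S e = (!) e ` J" using assms unfolding set_var_def by auto
  have "S (butlast e) = (!) e ` J" if "length e = Suc n" for e
  proof -
    have "S (butlast e) = (!) (butlast e) ` J" using J(2)[of "butlast e"] that by simp
    also have "\<dots> = (!) e ` J" using J(1) that by (intro image_cong) (auto simp: nth_butlast)
    finally show ?thesis .
  qed
  then show ?thesis unfolding set_var_def using J(1) by (intro exI[of _ J]) auto
qed

lemma var_take:
  assumes "var n t" shows "var (n + l) (\<lambda>e. t (take n e))"
proof -
  obtain i where i: "i < n" "\<And>e. length e = n \<Longrightarrow> t e = e ! i" using assms unfolding var_def by auto
  then show ?thesis unfolding var_def by (intro exI[of _ i]) simp
qed

lemma set_var_take: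
  assumes "set_var n S" shows "set_var (n + l) (\<lambda>e. S (take n e))"
proof -
  obtain J where J: "J \<subseteq> {..<n}" "\<And>e. length e = n \<Longrightarrow> S e = (!) e ` J" using assms unfolding set_var_def by auto
  have "S (take n e) = (!) e ` J" if "length e = n + l" for e
  proof -
    have "S (take n e) = (!) (take n e) ` J" using J(2)[of "take n e"] that by simp
    also have "\<dots> = (!) e ` J" using J(1) by (intro image_cong) auto
    finally show ?thesis .
  qed
  then show ?thesis unfolding set_var_def using J(1) by (intro exI[of _ J]) auto
qed

lemma set_var_drop: "set_var (n + l) (\<lambda>e. set (drop n e))"
  unfolding set_var_def
proof (intro exI[of _ "{n..<n + l}"] conjI allI impI)
  fix e :: "nat list" assume len: "length e = n + l"
  have "set (drop n e) = (!) (drop n e) ` {0..<l}" using len by (auto simp: set_conv_nth image_def)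
  also have "\<dots> = (\<lambda>i. e ! (n + i)) ` {0..<l}" using len by (intro image_cong) auto
  also have "\<dots> = (!) e ` ((+) n ` {0..<l})" by (simp only: image_image)
  also have "(+) n ` {0..<l} = {n..<n + l}" by (simp add: add.commute)
  finally show "set (drop n e) = (!) e ` {n..<n + l}" .
qed auto

lemma var_drop_nth: "i < l \<Longrightarrow> var (n + l) (\<lambda>e. drop n e ! i)"
  unfolding var_def by (intro exI[of _ "n + i"]) auto

lemma var_mem: "var n t \<Longrightarrow> valuation n G e \<Longrightarrow> t e \<in> pverts G"
  unfolding var_def valuation_def by fastforce

lemma fo_edge:
  assumes "var n s" "var n t" shows "fo n (\<lambda>G e. (s e, t e) \<in> parcs G)"
proof -
  obtain i j where ij: "i < n" "j < n" and st: "\<And>e. length e = n \<Longrightarrow> s e = e ! i" "\<And>e. length e = n \<Longrightarrow> t e = e ! j"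
    using assms unfolding var_def by auto
  show ?thesis by (rule fo_cong[OF fo_adj[OF ij]]) (simp add: st valuation_def)
qed

lemma fo_eq:
  assumes "var n s" "var n t" shows "fo n (\<lambda>G e. s e = t e)"
proof -
  obtain i j where ij: "i < n" "j < n" and st: "\<And>e. length e = n \<Longrightarrow> s e = e ! i" "\<And>e. length e = n \<Longrightarrow> t e = e ! j"
    using assms unfolding var_def by auto
  show ?thesis by (rule fo_cong[OF fo_same[OF ij]]) (simp add: st valuation_def)
qed

lemma fo_or: "fo n P \<Longrightarrow> fo n Q \<Longrightarrow> fo n (\<lambda>G e. P G e \<or> Q G e)"
  by (rule fo_cong[OF fo_not[OF fo_and[OF fo_not fo_not]], of n P Q]) auto

lemma fo_imp: "fo n P \<Longrightarrow> fo n Q \<Longrightarrow> fo n (\<lambda>G e. P G e \<longrightarrow> Q G e)"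
  by (rule fo_cong[OF fo_or[OF fo_not], of n P Q]) auto

lemma fo_ex: "fo (Suc n) (\<lambda>G e. P G (butlast e) (last e)) \<Longrightarrow> fo n (\<lambda>G e. \<exists>v\<in>pverts G. P G e v)"
  by (rule fo_cong[OF fo_some]) auto

lemma fo_all: "fo (Suc n) (\<lambda>G e. P G (butlast e) (last e)) \<Longrightarrow> fo n (\<lambda>G e. \<forall>v\<in>pverts G. P G e v)"
  by (rule fo_cong[OF fo_not[OF fo_ex[OF fo_not]], of n P]) auto

lemma fo_False: "fo n (\<lambda>G e. False)"
  by (rule fo_cong[OF fo_ex[OF fo_not[OF fo_eq[OF var_last var_last]]]]) auto

lemma fo_bex_fin:
  assumes "finite I" "\<And>i. i \<in> I \<Longrightarrow> fo n (P i)" shows "fo n (\<lambda>G e. \<exists>i\<in>I. P i G e)"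
  using assms
proof (induction I rule: finite_induct)
  case empty
  show ?case by (rule fo_cong[OF fo_False]) simp
next
  case (insert i I)
  then have "fo n (\<lambda>G e. P i G e \<or> (\<exists>i\<in>I. P i G e))" by (intro fo_or) auto
  then show ?case by (rule fo_cong) auto
qed

lemma fo_ball_fin:
  assumes "finite I" "\<And>i. i \<in> I \<Longrightarrow> fo n (P i)" shows "fo n (\<lambda>G e. \<forall>i\<in>I. P i G e)"
  by (rule fo_cong[OF fo_not[OF fo_bex_fin[OF assms(1) fo_not[OF assms(2)]]]]) auto

lemma fo_all_less:
  assumes "\<And>i. i < (l :: nat) \<Longrightarrow> fo n (P i)" shows "fo n (\<lambda>G e. \<forall>i<l. P i G e)"
  by (rule fo_cong[OF fo_ball_fin[OF finite_lessThan, of l n P]]) (use assms in auto)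

lemma fo_bex_set:
  assumes S: "set_var n S" and P: "\<And>t. var n t \<Longrightarrow> fo n (\<lambda>G e. P G e (t e))"
  shows "fo n (\<lambda>G e. \<exists>x\<in>S e. P G e x)"
proof -
  obtain J where J: "J \<subseteq> {..<n}" "\<And>e. length e = n \<Longrightarrow> S e = (!) e ` J" using S unfolding set_var_def by auto
  have "fo n (\<lambda>G e. \<exists>i\<in>J. P G e (e ! i))"
  proof (rule fo_bex_fin)
    show "finite J" using finite_subset[OF J(1)] by simp
    show "fo n (\<lambda>G e. P G e (e ! i))" if "i \<in> J" for i
      using that J(1) by (intro P) (auto simp: var_def)
  qed
  then show ?thesis by (rule fo_cong) (simp add: J(2) valuation_def)
qed

text \<open>One quantifier for each entry; the induction peels off the first entry and counts it
  among the outer variables.\<close>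

lemma fo_ex_list:
  "fo (n + l) (\<lambda>G e. P G (take n e) (drop n e)) \<Longrightarrow>
    fo n (\<lambda>G e. \<exists>xs. length xs = l \<and> set xs \<subseteq> pverts G \<and> P G e xs)"
proof (induction l arbitrary: n P)
  case 0
  then have "fo n (\<lambda>G e. P G (take n e) (drop n e))" by simp
  then show ?case by (rule fo_cong) (auto simp: valuation_def)
next
  case (Suc l)
  have "fo (Suc n + l) (\<lambda>G e. P G (butlast (take (Suc n) e)) (last (take (Suc n) e) # drop (Suc n) e))"
    by (rule fo_cong[OF Suc.prems[unfolded add_Suc_right add_Suc[symmetric]]])
      (simp add: valuation_def take_Suc_conv_app_nth Cons_nth_drop_Suc)
  from Suc.IH[OF this]
  have "fo n (\<lambda>G e. \<exists>v\<in>pverts G. \<exists>xs. length xs = l \<and> set xs \<subseteq> pverts G \<and> P G e (v # xs))"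
    by (rule fo_ex)
  then show ?case by (rule fo_cong) (auto simp: length_Suc_conv; fastforce)
qed

text \<open>A nonempty set with at most \<open>l\<close> elements is listed by exactly
  \<open>l\<close> entries if one of its elements is repeated as padding.\<close>

lemma fo_ex_set:
  assumes l: "1 \<le> l" and P: "fo (n + l) (\<lambda>G e. P G (take n e) (set (drop n e)))"
  shows "fo n (\<lambda>G e. \<exists>S. S \<subseteq> pverts G \<and> S \<noteq> {} \<and> card S \<le> l \<and> P G e S)"
proof (rule fo_cong[OF fo_ex_list[of n l "\<lambda>G e xs. P G e (set xs)", OF P]])
  fix G e assume v: "valuation n G e"
  have fin: "finite (pverts G)" using v unfolding valuation_def input_graph_def by auto
  show "(\<exists>S. S \<subseteq> pverts G \<and> S \<noteq> {} \<and> card S \<le> l \<and> P G e S) \<longleftrightarrow>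
    (\<exists>xs. length xs = l \<and> set xs \<subseteq> pverts G \<and> P G e (set xs))"
  proof
    assume "\<exists>S. S \<subseteq> pverts G \<and> S \<noteq> {} \<and> card S \<le> l \<and> P G e S"
    then obtain S where S: "S \<subseteq> pverts G" "S \<noteq> {}" "card S \<le> l" "P G e S" by blast
    obtain ys where ys: "set ys = S" "distinct ys" using finite_distinct_list[OF finite_subset[OF S(1) fin]] by auto
    have len: "length ys \<le> l" using distinct_card[OF ys(2)] ys(1) S(3) by simp
    have "ys \<noteq> []" using ys(1) S(2) by auto
    then have "set (ys @ replicate (l - length ys) (hd ys)) = S" using ys(1) by (auto simp: set_replicate_conv_if)
    then show "\<exists>xs. length xs = l \<and> set xs \<subseteq> pverts G \<and> P G e (set xs)"
      using S(1,4) len by (intro exI[of _ "ys @ replicate (l - length ys) (hd ys)"]) simp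
  next
    assume "\<exists>xs. length xs = l \<and> set xs \<subseteq> pverts G \<and> P G e (set xs)"
    then obtain xs where xs: "length xs = l" "set xs \<subseteq> pverts G" "P G e (set xs)" by blast
    moreover have "set xs \<noteq> {}" using xs(1) l by auto
    moreover have "card (set xs) \<le> l" using card_length[of xs] xs(1) by simp
    ultimately show "\<exists>S. S \<subseteq> pverts G \<and> S \<noteq> {} \<and> card S \<le> l \<and> P G e S" by blast
  qed
qed

lemmas fo_intros = fo_edge fo_eq fo_not fo_and fo_or fo_imp fo_ex fo_all fo_bex_set
  var_last var_butlast set_var_butlast var_take set_var_take set_var_drop var_drop_nth

section \<open>Formulas for the notions of the characterisation\<close>

abbreviation adj :: "'a pair_pre_digraph \<Rightarrow> 'a \<Rightarrow> 'a \<Rightarrow> bool" where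
  "adj G u v \<equiv> (u, v) \<in> parcs G"

lemma pair_graph_sgraph:
  assumes "pair_graph G" shows "sgraph (pverts G) (adj G)"
proof -
  interpret pair_graph G by (rule assms)
  show ?thesis
  proof
    show "finite (pverts G)" by (rule pair_finite_verts)
    show "u \<in> pverts G \<and> v \<in> pverts G" if "adj G u v" for u v using that in_arcsD1 in_arcsD2 by blast
    show "adj G v u" if "adj G u v" for u v using that pair_sym_arcs by (auto simp: symmetric_def sym_def)
    show "\<not> adj G u u" for u using pair_no_loops[of "(u, u)"] by auto
  qed
qed

lemma valuation_sgraph: "valuation n G e \<Longrightarrow> sgraph (pverts G) (adj G)"
  using pair_graph_sgraph unfolding valuation_def input_graph_def by blast

abbreviation hub_set :: "nat pair_pre_digraph \<Rightarrow> nat set \<Rightarrow> nat set" where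
  "hub_set G \<equiv> sgraph.hubs (pverts G) (adj G)"

lemma fo_hub:
  assumes x: "var n x" and S: "set_var n S"
  shows "fo n (\<lambda>G e. x e \<in> hub_set G (S e))"
proof (rule fo_cong)
  show "fo n (\<lambda>G e. \<exists>u\<in>S e. \<exists>v\<in>S e. u \<noteq> v \<and> adj G (x e) u \<and> adj G (x e) v)"
    by (intro fo_intros x S)
qed (use var_mem[OF x] in \<open>auto simp: sgraph.hubs_def[OF valuation_sgraph]\<close>)

lemma fo_near:
  assumes x: "var n x" and y: "var n y" and S: "set_var n S"
  shows "fo n (\<lambda>G e. sgraph.near (pverts G) (adj G) (hub_set G (S e)) (x e) (y e))"
proof (rule fo_cong)
  show "fo n (\<lambda>G e. \<not> x e \<in> hub_set G (S e) \<and> \<not> y e \<in> hub_set G (S e) \<and> (x e = y e \<or> adj G (x e) (y e) \<or>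
      (\<exists>w\<in>pverts G. \<not> w \<in> hub_set G (S e) \<and> adj G (x e) w \<and> adj G w (y e))))"
    by (intro fo_intros fo_hub x y S)
qed (use var_mem[OF x] var_mem[OF y] in \<open>auto simp: sgraph.near_def[OF valuation_sgraph]\<close>)

lemma fo_good:
  assumes h: "var n h" and x: "var n x" and S: "set_var n S"
  shows "fo n (\<lambda>G e. sgraph.good (pverts G) (adj G) (hub_set G (S e)) (h e) (x e))"
proof (rule fo_cong)
  show "fo n (\<lambda>G e. (\<exists>y\<in>pverts G. sgraph.near (pverts G) (adj G) (hub_set G (S e)) (x e) y \<and> adj G (h e) y) \<and>
    (\<forall>y\<in>pverts G. \<forall>z\<in>pverts G. sgraph.near (pverts G) (adj G) (hub_set G (S e)) (x e) y \<longrightarrow>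
      sgraph.near (pverts G) (adj G) (hub_set G (S e)) (x e) z \<longrightarrow> \<not> adj G (h e) y \<longrightarrow> \<not> adj G (h e) z \<longrightarrow>
      \<not> y = z \<longrightarrow> adj G y z))"
    by (intro fo_intros fo_near h x S)
next
  fix G e assume v: "valuation n G e"
  interpret sgraph "pverts G" "adj G" by (rule valuation_sgraph[OF v])
  show "good (hub_set G (S e)) (h e) (x e) \<longleftrightarrow> (\<exists>y\<in>pverts G. near (hub_set G (S e)) (x e) y \<and> adj G (h e) y) \<and>
    (\<forall>y\<in>pverts G. \<forall>z\<in>pverts G. near (hub_set G (S e)) (x e) y \<longrightarrow>
      near (hub_set G (S e)) (x e) z \<longrightarrow> \<not> adj G (h e) y \<longrightarrow> \<not> adj G (h e) z \<longrightarrow>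
      \<not> y = z \<longrightarrow> adj G y z)"
    unfolding good_def using near_V[of "hub_set G (S e)" "x e"] by blast
qed

lemma fo_farl:
  assumes S: "set_var n S" and xs: "\<And>e. length e = n \<Longrightarrow> length (xs e) = l"
    and x: "\<And>i. i < l \<Longrightarrow> var n (\<lambda>e. xs e ! i)"
  shows "fo n (\<lambda>G e. sgraph.farl (pverts G) (adj G) (hub_set G (S e)) (xs e))"
proof (rule fo_cong)
  show "fo n (\<lambda>G e. (\<forall>i<l. \<not> xs e ! i \<in> hub_set G (S e)) \<and> (\<forall>i<l. \<forall>j<l.
      i = j \<or> \<not> sgraph.near (pverts G) (adj G) (hub_set G (S e)) (xs e ! i) (xs e ! j)))"
  proof (intro fo_and fo_all_less)
    show "fo n (\<lambda>G e. \<not> xs e ! i \<in> hub_set G (S e))" if "i < l" for i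
      by (intro fo_not fo_hub x S that)
    show "fo n (\<lambda>G e. i = j \<or> \<not> sgraph.near (pverts G) (adj G) (hub_set G (S e)) (xs e ! i) (xs e ! j))"
      if "i < l" "j < l" for i j
    proof (cases "i = j")
      case True
      then show ?thesis by (intro fo_cong[OF fo_not[OF fo_False]]) simp
    next
      case False
      then show ?thesis by (intro fo_cong[OF fo_not[OF fo_near[OF x[OF that(1)] x[OF that(2)] S]]]) simp
    qed
  qed
next
  fix G e assume v: "valuation n G e"
  then have "length (xs e) = l" using xs unfolding valuation_def by blast
  then show "sgraph.farl (pverts G) (adj G) (hub_set G (S e)) (xs e) \<longleftrightarrow>
    (\<forall>i<l. \<not> xs e ! i \<in> hub_set G (S e)) \<and> (\<forall>i<l. \<forall>j<l.
      i = j \<or> \<not> sgraph.near (pverts G) (adj G) (hub_set G (S e)) (xs e ! i) (xs e ! j))"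
    unfolding sgraph.farl_def[OF valuation_sgraph[OF v]] by blast
qed

lemma fo_cert:
  assumes S: "set_var n S"
  shows "fo n (\<lambda>G e. sgraph.cert (pverts G) (adj G) (hub_set G (S e)) c)"
proof (rule fo_cong)
  let ?near = "\<lambda>G. sgraph.near (pverts G) (adj G)" and ?farl = "\<lambda>G. sgraph.farl (pverts G) (adj G)"
    and ?good = "\<lambda>G. sgraph.good (pverts G) (adj G)"
  have 1: "fo n (\<lambda>G e. \<forall>x\<in>pverts G. \<forall>y\<in>pverts G. \<forall>z\<in>pverts G.
      ?near G (hub_set G (S e)) x y \<longrightarrow> ?near G (hub_set G (S e)) y z \<longrightarrow> ?near G (hub_set G (S e)) x z)"
    by (intro fo_intros fo_near S)
  have 2: "fo n (\<lambda>G e. \<forall>v\<in>pverts G. v \<in> hub_set G (S e) \<or> (\<exists>w\<in>pverts G. \<not> w \<in> hub_set G (S e) \<and> adj G v w \<and>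
      (\<forall>y\<in>pverts G. ?near G (hub_set G (S e)) v y \<longrightarrow> adj G y v \<or> adj G y w)))"
    by (intro fo_intros fo_near fo_hub S)
  have 3: "fo n (\<lambda>G e. \<forall>h\<in>pverts G. h \<in> hub_set G (S e) \<longrightarrow> \<not> (\<exists>xs. length xs = Suc c \<and> set xs \<subseteq> pverts G \<and>
      (?farl G (hub_set G (S e)) xs \<and> (\<forall>i<Suc c. \<not> ?good G (hub_set G (S e)) h (xs ! i)))))"
    by (intro fo_intros fo_ex_list fo_all_less fo_farl[where l = "Suc c"] fo_good fo_hub S) auto
  have 4: "fo n (\<lambda>G e. \<forall>r\<in>{1..3 * c + 2}. \<not> (\<exists>xs. length xs = r \<and> set xs \<subseteq> pverts G \<and> (?farl G (hub_set G (S e)) xs \<and>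
      (\<exists>T. T \<subseteq> pverts G \<and> T \<noteq> {} \<and> card T \<le> 2 * r \<and>
        ((\<exists>t\<in>T. t \<in> hub_set G (S e)) \<and>
        (\<forall>i<r. \<forall>y\<in>pverts G. ?near G (hub_set G (S e)) (xs ! i) y \<longrightarrow> (\<exists>t\<in>T. adj G y t)))))))"
  proof (rule fo_ball_fin)
    fix r assume r: "r \<in> {1..3 * c + 2}"
    then have l: "1 \<le> 2 * r" by auto
    show "fo n (\<lambda>G e. \<not> (\<exists>xs. length xs = r \<and> set xs \<subseteq> pverts G \<and> (?farl G (hub_set G (S e)) xs \<and>
      (\<exists>T. T \<subseteq> pverts G \<and> T \<noteq> {} \<and> card T \<le> 2 * r \<and>
        ((\<exists>t\<in>T. t \<in> hub_set G (S e)) \<and>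
        (\<forall>i<r. \<forall>y\<in>pverts G. ?near G (hub_set G (S e)) (xs ! i) y \<longrightarrow> (\<exists>t\<in>T. adj G y t)))))))"
      by (intro fo_not fo_ex_list fo_and fo_ex_set[OF l] fo_bex_set fo_all_less fo_all fo_imp fo_edge
          fo_farl[where l = r] fo_near fo_hub S var_last var_butlast set_var_butlast var_take set_var_take
          set_var_drop var_drop_nth) auto
  qed simp
  have 5: "fo n (\<lambda>G e. \<exists>xs. length xs = 2 * c + 2 \<and> set xs \<subseteq> pverts G \<and> ?farl G (hub_set G (S e)) xs)"
    by (intro fo_ex_list fo_farl[where l = "2 * c + 2"] set_var_take S var_drop_nth) auto
  note fo_and[OF 1 fo_and[OF 2 fo_and[OF 3 fo_and[OF 4 5]]]]
  then show "fo n (\<lambda>G e. (\<forall>x\<in>pverts G. \<forall>y\<in>pverts G. \<forall>z\<in>pverts G.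
      ?near G (hub_set G (S e)) x y \<longrightarrow> ?near G (hub_set G (S e)) y z \<longrightarrow> ?near G (hub_set G (S e)) x z) \<and>
    (\<forall>v\<in>pverts G. v \<in> hub_set G (S e) \<or> (\<exists>w\<in>pverts G. w \<notin> hub_set G (S e) \<and> adj G v w \<and>
      (\<forall>y\<in>pverts G. ?near G (hub_set G (S e)) v y \<longrightarrow> adj G y v \<or> adj G y w))) \<and>
    (\<forall>h\<in>pverts G. h \<in> hub_set G (S e) \<longrightarrow> \<not> (\<exists>xs. length xs = Suc c \<and> set xs \<subseteq> pverts G \<and>
      ?farl G (hub_set G (S e)) xs \<and> (\<forall>i<Suc c. \<not> ?good G (hub_set G (S e)) h (xs ! i)))) \<and>
    (\<forall>r\<in>{1..3 * c + 2}. \<not> (\<exists>xs. length xs = r \<and> set xs \<subseteq> pverts G \<and> ?farl G (hub_set G (S e)) xs \<and>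
      (\<exists>T. T \<subseteq> pverts G \<and> T \<noteq> {} \<and> card T \<le> 2 * r \<and> (\<exists>t\<in>T. t \<in> hub_set G (S e)) \<and>
        (\<forall>i<r. \<forall>y\<in>pverts G. ?near G (hub_set G (S e)) (xs ! i) y \<longrightarrow> (\<exists>t\<in>T. adj G y t))))) \<and>
    (\<exists>xs. length xs = 2 * c + 2 \<and> set xs \<subseteq> pverts G \<and> ?farl G (hub_set G (S e)) xs))" .
next
  fix G e assume v: "valuation n G e"
  interpret sgraph "pverts G" "adj G" by (rule valuation_sgraph[OF v])
  have "hubs (S e) \<subseteq> pverts G" unfolding hubs_def by auto
  from cert_iff[OF this] show "cert (hubs (S e)) c \<longleftrightarrow> (\<forall>x\<in>pverts G. \<forall>y\<in>pverts G. \<forall>z\<in>pverts G.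
      near (hubs (S e)) x y \<longrightarrow> near (hubs (S e)) y z \<longrightarrow> near (hubs (S e)) x z) \<and>
    (\<forall>v\<in>pverts G. v \<in> hubs (S e) \<or> (\<exists>w\<in>pverts G. w \<notin> hubs (S e) \<and> adj G v w \<and>
      (\<forall>y\<in>pverts G. near (hubs (S e)) v y \<longrightarrow> adj G y v \<or> adj G y w))) \<and>
    (\<forall>h\<in>pverts G. h \<in> hubs (S e) \<longrightarrow> \<not> (\<exists>xs. length xs = Suc c \<and> set xs \<subseteq> pverts G \<and>
      farl (hubs (S e)) xs \<and> (\<forall>i<Suc c. \<not> good (hubs (S e)) h (xs ! i)))) \<and>
    (\<forall>r\<in>{1..3 * c + 2}. \<not> (\<exists>xs. length xs = r \<and> set xs \<subseteq> pverts G \<and> farl (hubs (S e)) xs \<and>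
      (\<exists>T. T \<subseteq> pverts G \<and> T \<noteq> {} \<and> card T \<le> 2 * r \<and> (\<exists>t\<in>T. t \<in> hubs (S e)) \<and>
        (\<forall>i<r. \<forall>y\<in>pverts G. near (hubs (S e)) (xs ! i) y \<longrightarrow> (\<exists>t\<in>T. adj G y t))))) \<and>
    (\<exists>xs. length xs = 2 * c + 2 \<and> set xs \<subseteq> pverts G \<and> farl (hubs (S e)) xs)" .
qed

lemma fo_tds:
  assumes S: "set_var n S"
  shows "fo n (\<lambda>G e. sgraph.tds (pverts G) (adj G) (S e))"
proof (rule fo_cong)
  show "fo n (\<lambda>G e. \<forall>v\<in>pverts G. \<exists>u\<in>S e. adj G v u)" by (intro fo_intros S)
next
  fix G e assume v: "valuation n G e"
  have "S e \<subseteq> pverts G" using S v unfolding set_var_def valuation_def by fastforce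
  then show "sgraph.tds (pverts G) (adj G) (S e) \<longleftrightarrow> (\<forall>v\<in>pverts G. \<exists>u\<in>S e. adj G v u)"
    unfolding sgraph.tds_def[OF valuation_sgraph[OF v]] by blast
qed

lemma fo_has_p3:
  assumes S: "set_var n S"
  shows "fo n (\<lambda>G e. sgraph.has_p3 (adj G) (S e))"
proof (rule fo_cong)
  show "fo n (\<lambda>G e. \<exists>x\<in>S e. \<exists>y\<in>S e. \<exists>z\<in>S e. adj G x y \<and> adj G y z \<and> \<not> x = z)" by (intro fo_intros S)
qed (simp add: sgraph.has_p3_def[OF valuation_sgraph])

lemma fo_small_no_inst:
  assumes "1 \<le> l" shows "fo n (\<lambda>G e. sgraph.small_no_inst (pverts G) (adj G) l)"
proof (rule fo_cong)
  show "fo n (\<lambda>G e. (\<exists>S. S \<subseteq> pverts G \<and> S \<noteq> {} \<and> card S \<le> l \<and> sgraph.tds (pverts G) (adj G) S) \<and>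
     \<not> (\<exists>S. S \<subseteq> pverts G \<and> S \<noteq> {} \<and> card S \<le> l \<and> (sgraph.tds (pverts G) (adj G) S \<and> sgraph.has_p3 (adj G) S)))"
    by (intro fo_and fo_not fo_ex_set[OF assms] fo_tds fo_has_p3 set_var_drop)
qed (simp add: sgraph.small_no_inst_def[OF valuation_sgraph])

text \<open>The right-hand side of \<open>no_inst_iff\<close>, with quantifiers over vertices
  only.\<close>

definition no_inst_formula :: "nat \<Rightarrow> nat pair_pre_digraph \<Rightarrow> nat list \<Rightarrow> bool" where
  "no_inst_formula k G e \<longleftrightarrow> (\<forall>u\<in>pverts G. \<forall>v\<in>pverts G. \<not> adj G u v) \<or>
     (\<exists>l\<in>{1..tds_bound k}. sgraph.small_no_inst (pverts G) (adj G) l) \<or>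
     (\<exists>X. X \<subseteq> pverts G \<and> X \<noteq> {} \<and> card X \<le> 4 * k + 10 \<and> sgraph.cert (pverts G) (adj G) (hub_set G X) k)"

lemma fo_no_inst: "fo n (no_inst_formula k)"
  unfolding no_inst_formula_def
  by (intro fo_or fo_bex_fin fo_small_no_inst fo_ex_set fo_cert set_var_drop fo_intros) auto

section \<open>Connectedness and induced subgraphs\<close>

text \<open>A walk that starts in \<open>X\<close> cannot leave it without an edge leaving
  \<open>X\<close>. Since the arcs are symmetric already, the symmetric closure in the definition of
  connectedness adds no arcs.\<close>

lemma input_graph_conn:
  assumes "input_graph G" shows "sgraph.conn (adj G) (pverts G)"
proof -
  have pg: "pair_graph G" and con: "connected (with_proj G)" using assms unfolding input_graph_def by auto
  interpret sgraph "pverts G" "adj G" by (rule pair_graph_sgraph[OF pg])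
  have sub: "parcs (mk_symmetric (with_proj G)) \<subseteq> parcs G"
    using sym by (auto simp: parcs_mk_symmetric)
  show ?thesis
    unfolding conn_def
  proof (intro allI impI, rule ccontr)
    fix X assume X: "X \<subseteq> pverts G" "X \<noteq> {}" "X \<noteq> pverts G" and n: "\<not> (\<exists>x\<in>X. \<exists>y\<in>pverts G - X. adj G x y)"
    obtain x y where xy: "x \<in> X" "y \<in> pverts G" "y \<notin> X" using X by auto
    have "(x, y) \<in> rtrancl_on (pverts G) (parcs (mk_symmetric (with_proj G)))"
      using con xy X(1) unfolding connected_def strongly_connected_def reachable_def by auto
    then have "y \<in> X"
    proof (induction rule: rtrancl_on_induct)
      case (step y z)
      then show ?case using n sub by auto
    qed (use xy in simp)
    then show False using xy by simp
  qed
qed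

text \<open>The witness is the image of \<open>H\<close> under the isomorphism that applies
  \<open>g\<close> to vertices and componentwise to arcs.\<close>

lemma embedding_not_induced_free:
  assumes G: "pair_graph G" and H: "parcs H \<subseteq> pverts H \<times> pverts H"
    and g: "inj_on g (pverts H)" "g ` pverts H \<subseteq> pverts G"
    and iff: "\<And>u v. u \<in> pverts H \<Longrightarrow> v \<in> pverts H \<Longrightarrow> (u, v) \<in> parcs H \<longleftrightarrow> adj G (g u) (g v)"
  shows "\<not> induced_free H G"
proof -
  define f where "f = \<lparr>iso_verts = g, iso_arcs = map_prod g g, iso_head = snd, iso_tail = fst\<rparr>"
  let ?K = "app_iso f (with_proj H)"
  interpret G: pair_graph G by (rule G)
  have wfH: "wf_digraph (with_proj H)" using H by unfold_locales auto
  have wfG: "wf_digraph (with_proj G)" by unfold_locales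
  have "inj_on (map_prod g g) (parcs H)"
    by (rule inj_on_subset[OF map_prod_inj_on[OF g(1) g(1)] H])
  then have "pre_digraph.digraph_isomorphism (with_proj H) f"
    unfolding pre_digraph.digraph_isomorphism_def using wfH g(1) by (simp add: f_def)
  then have iso: "digraph_iso (with_proj H) ?K" unfolding digraph_iso_def by blast
  have arcs: "arcs ?K = {e \<in> parcs G. fst e \<in> g ` pverts H \<and> snd e \<in> g ` pverts H}"
  proof (intro equalityI subsetI)
    fix e assume "e \<in> arcs ?K"
    then obtain u v where uv: "(u, v) \<in> parcs H" "e = (g u, g v)" by (auto simp: f_def)
    then show "e \<in> {e \<in> parcs G. fst e \<in> g ` pverts H \<and> snd e \<in> g ` pverts H}" using H iff[of u v] by auto
  next
    fix e assume "e \<in> {e \<in> parcs G. fst e \<in> g ` pverts H \<and> snd e \<in> g ` pverts H}"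
    then obtain u v where uv: "u \<in> pverts H" "v \<in> pverts H" "e = (g u, g v)" "adj G (g u) (g v)"
      by (cases e) auto
    then have "(u, v) \<in> parcs H" using iff by simp
    then show "e \<in> arcs ?K" using uv(3) by (force simp: f_def)
  qed
  have "induced_subgraph ?K (with_proj G)"
    unfolding induced_subgraph_def subgraph_def compatible_def
  proof (intro conjI)
    show "wf_digraph ?K" by unfold_locales (use arcs in \<open>auto simp: f_def\<close>)
  qed (use arcs g(2) wfG in \<open>auto simp: f_def\<close>)
  then show ?thesis using iso unfolding induced_free_def by blast
qed

context sgraph begin

lemma ip4_nth:
  assumes "ip4 a b c d" "i < 4" "j < 4"
  shows "E ([a, b, c, d] ! i) ([a, b, c, d] ! j) \<longleftrightarrow> j = Suc i \<or> i = Suc j"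
    "i \<noteq> j \<Longrightarrow> [a, b, c, d] ! i \<noteq> [a, b, c, d] ! j"
proof -
  have E: "E a b" "E b c" "E c d" "E b a" "E c b" "E d c" "\<not> E a c" "\<not> E b d" "\<not> E a d" "\<not> E c a" "\<not> E d b" "\<not> E d a"
    using assms(1) sym[of a b] sym[of b c] sym[of c d] sym[of c a] sym[of d b] sym[of d a] unfolding ip4_def by auto
  then have ne: "a \<noteq> b" "a \<noteq> c" "a \<noteq> d" "b \<noteq> c" "b \<noteq> d" "c \<noteq> d" using irr by auto
  have ij: "i \<in> {0, 1, 2, 3}" "j \<in> {0, 1, 2, 3}" using assms(2,3) by auto
  show "E ([a, b, c, d] ! i) ([a, b, c, d] ! j) \<longleftrightarrow> j = Suc i \<or> i = Suc j"
    using ij E irr by (auto simp: numeral_2_eq_2 numeral_3_eq_3)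
  show "[a, b, c, d] ! i \<noteq> [a, b, c, d] ! j" if "i \<noteq> j"
    using ij ne that by (auto simp: numeral_2_eq_2 numeral_3_eq_3)
qed

lemma ip3_nth:
  assumes "ip3 a b c" "i < 3" "j < 3"
  shows "E ([a, b, c] ! i) ([a, b, c] ! j) \<longleftrightarrow> j = Suc i \<or> i = Suc j"
    "i \<noteq> j \<Longrightarrow> [a, b, c] ! i \<noteq> [a, b, c] ! j"
proof -
  have E: "E a b" "E b c" "E b a" "E c b" "\<not> E a c" "\<not> E c a" "a \<noteq> c"
    using assms(1) sym[of a b] sym[of b c] sym[of c a] unfolding ip3_def by auto
  then have ne: "a \<noteq> b" "b \<noteq> c" using irr by auto
  have ij: "i \<in> {0, 1, 2}" "j \<in> {0, 1, 2}" using assms(2,3) by auto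
  show "E ([a, b, c] ! i) ([a, b, c] ! j) \<longleftrightarrow> j = Suc i \<or> i = Suc j"
    using ij E irr by (auto simp: numeral_2_eq_2)
  show "[a, b, c] ! i \<noteq> [a, b, c] ! j" if "i \<noteq> j"
    using ij ne E(7) that by (auto simp: numeral_2_eq_2)
qed

end

text \<open>The embedding \<open>g\<close> sends the left summand to the P4 and copy number
  \<open>i\<close> to the P3 number \<open>i\<close>. Anticompleteness gives the injectivity across
  different paths as well as the missing edges.\<close>

lemma induced_free_p4kp3_free:
  assumes G: "pair_graph G"
    and free: "induced_free (disjoint_union (path_graph 4) (copies k (path_graph 3))) G"
  shows "sgraph.p4kp3_free (adj G) k"
proof -
  interpret sgraph "pverts G" "adj G" by (rule pair_graph_sgraph[OF G])
  show ?thesis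
  proof (rule ccontr)
    assume "\<not> p4kp3_free k"
    then obtain a b c d p q r where p4: "ip4 a b c d"
      and p3: "\<forall>i<k. ip3 (p i) (q i) (r i) \<and> anti {a, b, c, d} {p i, q i, r i}"
      and an: "\<forall>i<k. \<forall>j<k. i \<noteq> j \<longrightarrow> anti {p i, q i, r i} {p j, q j, r j}"
      unfolding p4kp3_free_def by blast
    define g :: "nat + nat \<times> nat \<Rightarrow> 'a" where
      "g w = (case w of Inl i \<Rightarrow> [a, b, c, d] ! i | Inr (i, j) \<Rightarrow> [p i, q i, r i] ! j)" for w
    let ?H = "disjoint_union (path_graph 4) (copies k (path_graph 3))"
    have V: "pverts ?H = Inl ` {0..<4} \<union> Inr ` ({0..<k} \<times> {0..<3})"
      unfolding disjoint_union_def path_graph_def copies_def by simp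
    have in4: "[a, b, c, d] ! i \<in> {a, b, c, d}" if "i < 4" for i
      using nth_mem[of i "[a, b, c, d]"] that by simp
    have in3: "[p i, q i, r i] ! j \<in> {p i, q i, r i}" if "j < 3" for i j
      using nth_mem[of j "[p i, q i, r i]"] that by simp
    have sep: "[a, b, c, d] ! i \<noteq> [p i', q i', r i'] ! j' \<and> \<not> adj G ([a, b, c, d] ! i) ([p i', q i', r i'] ! j') \<and>
        \<not> adj G ([p i', q i', r i'] ! j') ([a, b, c, d] ! i)"
      if "i < 4" "i' < k" "j' < 3" for i i' j'
    proof -
      have A: "anti {a, b, c, d} {p i', q i', r i'}" using p3 that(2) by simp
      show ?thesis using bspec[OF bspec[OF A[unfolded anti_def] in4[OF that(1)]] in3[OF that(3), of i']]
          sym[of "[p i', q i', r i'] ! j'" "[a, b, c, d] ! i"] by blast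
    qed
    have sep3: "[p i, q i, r i] ! j \<noteq> [p i', q i', r i'] ! j' \<and> \<not> adj G ([p i, q i, r i] ! j) ([p i', q i', r i'] ! j')"
      if "i < k" "i' < k" "i \<noteq> i'" "j < 3" "j' < 3" for i i' j j'
    proof -
      have A: "anti {p i, q i, r i} {p i', q i', r i'}" using an that(1-3) by simp
      show ?thesis using bspec[OF bspec[OF A[unfolded anti_def] in3[OF that(4), of i]] in3[OF that(5), of i']] .
    qed
    have p3': "ip3 (p i) (q i) (r i)" if "i < k" for i using p3 that by simp
    have "\<not> induced_free ?H G"
    proof (rule embedding_not_induced_free[OF G, where g = g])
      show "parcs ?H \<subseteq> pverts ?H \<times> pverts ?H"
        unfolding disjoint_union_def path_graph_def copies_def by auto
      show "inj_on g (pverts ?H)"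
      proof (rule inj_onI)
        fix u v assume uv: "u \<in> pverts ?H" "v \<in> pverts ?H" "g u = g v"
        show "u = v"
        proof (cases u)
          case ul: (Inl i)
          then have i: "i < 4" using uv(1) V by auto
          show ?thesis
          proof (cases v)
            case (Inl j)
            then have "j < 4" using uv(2) V by auto
            moreover have "[a, b, c, d] ! i = [a, b, c, d] ! j" using uv(3) ul Inl by (simp add: g_def)
            ultimately show ?thesis using ip4_nth(2)[OF p4 i, of j] ul Inl by metis
          next
            case (Inr w)
            then obtain i' j' where "v = Inr (i', j')" "i' < k" "j' < 3" using uv(2) V by auto
            then show ?thesis using uv(3) ul sep[OF i, of i' j'] by (simp add: g_def)
          qed
        next
          case ur: (Inr w)
          then obtain i j where u: "u = Inr (i, j)" "i < k" "j < 3" using uv(1) V by auto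
          show ?thesis
          proof (cases v)
            case (Inl i')
            then have "i' < 4" using uv(2) V by auto
            then show ?thesis using uv(3) u Inl sep[of i' i j] by (simp add: g_def)
          next
            case (Inr w)
            then obtain i' j' where v: "v = Inr (i', j')" "i' < k" "j' < 3" using uv(2) V by auto
            show ?thesis
            proof (cases "i = i'")
              case True
              have "[p i, q i, r i] ! j = [p i, q i, r i] ! j'" using uv(3) u v True by (simp add: g_def)
              then have "j = j'" using ip3_nth(2)[OF p3'[OF u(2)] u(3) v(3)] by metis
              then show ?thesis using u v True by simp
            next
              case False
              then show ?thesis using uv(3) u v sep3[OF u(2) v(2) _ u(3) v(3)] by (simp add: g_def)
            qed
          qed
        qed
      qed
      show "g ` pverts ?H \<subseteq> pverts G"
      proof -
        have abcd: "{a, b, c, d} \<subseteq> pverts G"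
          using p4 E_V[of a b] E_V[of c d] unfolding ip4_def by simp
        have pqr: "{p i, q i, r i} \<subseteq> pverts G" if "i < k" for i
          using p3'[OF that] E_V[of "p i" "q i"] E_V[of "q i" "r i"] unfolding ip3_def by simp
        have "g w \<in> pverts G" if w: "w \<in> pverts ?H" for w
        proof (cases w)
          case (Inl i)
          then have "i < 4" using w V by auto
          then show ?thesis using subsetD[OF abcd in4] Inl by (simp add: g_def)
        next
          case (Inr e)
          then obtain i j where "w = Inr (i, j)" "i < k" "j < 3" using w V by auto
          then show ?thesis using subsetD[OF pqr in3, of i j] by (simp add: g_def)
        qed
        then show ?thesis by blast
      qed
      fix u v assume uv: "u \<in> pverts ?H" "v \<in> pverts ?H"
      show "(u, v) \<in> parcs ?H \<longleftrightarrow> adj G (g u) (g v)"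
      proof (cases u)
        case ul: (Inl i)
        then have i: "i < 4" using uv(1) V by auto
        show ?thesis
        proof (cases v)
          case (Inl j)
          then have j: "j < 4" using uv(2) V by auto
          then show ?thesis using ul Inl i ip4_nth(1)[OF p4 i j]
            by (auto simp: g_def disjoint_union_def path_graph_def copies_def)
        next
          case (Inr w)
          then obtain i' j' where v: "v = Inr (i', j')" "i' < k" "j' < 3" using uv(2) V by auto
          then show ?thesis using ul sep[OF i v(2,3)]
            by (auto simp: g_def disjoint_union_def)
        qed
      next
        case ur: (Inr w)
        then obtain i j where u: "u = Inr (i, j)" "i < k" "j < 3" using uv(1) V by auto
        show ?thesis
        proof (cases v)
          case (Inl i')
          then have "i' < 4" using uv(2) V by auto
          then show ?thesis using u Inl sep[OF _ u(2,3), of i'] by (auto simp: g_def disjoint_union_def)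
        next
          case (Inr w)
          then obtain i' j' where v: "v = Inr (i', j')" "i' < k" "j' < 3" using uv(2) V by auto
          show ?thesis
          proof (cases "i = i'")
            case True
            then show ?thesis using u v ip3_nth(1)[OF p3'[OF u(2)] u(3) v(3)]
              by (auto simp: g_def disjoint_union_def path_graph_def copies_def)
          next
            case False
            then show ?thesis using u v sep3[OF u(2) v(2) False u(3) v(3)]
              by (auto simp: g_def disjoint_union_def copies_def)
          qed
        qed
      qed
    qed
    then show False using free by simp
  qed
qed

section \<open>Contractions and paths in minimum total dominating sets\<close>

lemma total_domination_number_le:
  "total_dominating_set G D \<Longrightarrow> total_domination_number G \<le> enat (card D)"
  unfolding total_domination_number_def by (intro INF_lower) simp

text \<open>A finite bound excludes the infimum of the empty set, which is infinite, and in
  \<open>enat\<close> the infimum of a nonempty set is attained.\<close>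

lemma total_domination_number_leD:
  assumes "total_domination_number G \<le> enat n"
  obtains D where "total_dominating_set G D" "card D \<le> n"
proof -
  let ?A = "(\<lambda>D. enat (card D)) ` {D. total_dominating_set G D}"
  have "?A \<noteq> {}"
  proof
    assume "?A = {}"
    then have "total_domination_number G = Inf {}" unfolding total_domination_number_def by (rule arg_cong)
    then show False using assms by (simp add: top_enat_def)
  qed
  then obtain e where "e \<in> ?A" by blast
  then have "(LEAST x. x \<in> ?A) \<in> ?A" by (rule LeastI)
  then have "Inf ?A \<in> ?A" unfolding Inf_enat_def using \<open>?A \<noteq> {}\<close> by simp
  then show ?thesis using that assms unfolding total_domination_number_def by auto
qed

lemma contract_edge_simps:
  "pverts (contract_edge G (u, v)) = (\<lambda>x. if x = v then u else x) ` pverts G"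
  "parcs (contract_edge G (u, v)) = {((if x = v then u else x), (if y = v then u else y)) | x y.
     (x, y) \<in> parcs G \<and> (if x = v then u else x) \<noteq> (if y = v then u else y)}"
  by (simp_all add: contract_edge_def Let_def)

text \<open>Given a smaller set \<open>D'\<close> for the contraction of \<open>uv\<close>, where
  \<open>u\<close> names the merged vertex, add \<open>v\<close> if \<open>D'\<close> contains
  \<open>u\<close>, and otherwise an end of the edge with a neighbour in \<open>D'\<close>. Both
  times a minimum set with a path results. Conversely, if a minimum set contains the path
  \<open>x\<close>, \<open>y\<close>, \<open>z\<close>, contract \<open>xy\<close> and drop
  \<open>y\<close>; then \<open>z\<close> dominates the merged vertex.\<close>

lemma contractible_iff:
  assumes "input_graph G"
  shows "one_edge_contraction_total_dom G \<longleftrightarrow> \<not> sgraph.no_inst (pverts G) (adj G)"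
proof -
  have pg: "pair_graph G" using assms unfolding input_graph_def by auto
  interpret sgraph "pverts G" "adj G" by (rule pair_graph_sgraph[OF pg])
  have tds_eq: "total_dominating_set G D \<longleftrightarrow> tds D" for D
    unfolding total_dominating_set_def tds_def by simp
  have conn: "conn (pverts G)" by (rule input_graph_conn[OF assms])
  show ?thesis
  proof
    assume "one_edge_contraction_total_dom G"
    then obtain u v where uv: "adj G u v"
      and le: "total_domination_number (contract_edge G (u, v)) \<le> total_domination_number G - 1"
      unfolding one_edge_contraction_total_dom_def by auto
    have ne: "u \<noteq> v" using uv irr by auto
    have tV: "tds (pverts G)"
      unfolding tds_def
    proof (intro conjI ballI order_refl)
      fix w assume w: "w \<in> pverts G"
      have "{w} \<noteq> pverts G"
      proof
        assume "{w} = pverts G"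
        then have "u = w" "v = w" using E_V[OF uv] by auto
        then show False using ne by simp
      qed
      then show "\<exists>u\<in>pverts G. adj G w u" using conn w unfolding conn_def by blast
    qed
    then obtain D0 where D0: "tds D0" "\<And>D'. tds D' \<Longrightarrow> card D0 \<le> card D'"
      using ex_has_least_nat[of tds "pverts G" card] by blast
    \<comment> \<open>Finiteness matters: subtracting 1 from an infinite value would not lower
      it.\<close>
    obtain D1 where D1: "tds D1" "total_domination_number G = enat (card D1)"
    proof -
      have "total_domination_number G \<le> enat (card D0)" using total_domination_number_le tds_eq D0(1) by blast
      then obtain n where n: "total_domination_number G = enat n" by (cases "total_domination_number G") auto
      then obtain D1 where D1: "total_dominating_set G D1" "card D1 \<le> n"
        using total_domination_number_leD[of G n] by auto
      then have "total_domination_number G = enat (card D1)"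
        using total_domination_number_le[OF D1(1)] n by simp
      then show ?thesis using that D1(1) tds_eq by blast
    qed
    have c01: "card D0 = card D1"
    proof -
      have "enat (card D1) \<le> enat (card D0)" using total_domination_number_le[of G D0] tds_eq D0(1) D1(2) by simp
      then show ?thesis using D0(2)[OF D1(1)] by simp
    qed
    have "D0 \<noteq> {}" using D0(1) uv E_V[OF uv] unfolding tds_def by auto
    then have c0: "0 < card D0" using tds_finite[OF D0(1)] by (simp add: card_gt_0_iff)
    have "total_domination_number (contract_edge G (u, v)) \<le> enat (card D0 - 1)"
      using le D1(2) c01 by (simp add: one_enat_def)
    then obtain D' where D': "total_dominating_set (contract_edge G (u, v)) D'" "card D' \<le> card D0 - 1"
      by (rule total_domination_number_leD)
    have D'V: "D' \<subseteq> pverts G" "v \<notin> D'"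
      using D'(1) E_V[OF uv] ne unfolding total_dominating_set_def contract_edge_simps by (auto split: if_splits)
    have finD': "finite D'" using finite_subset[OF D'V(1) fin] .
    have nb: "\<exists>d\<in>D'. d \<noteq> w \<and> (\<exists>x y. adj G x y \<and> w = (if x = v then u else x) \<and> d = (if y = v then u else y))"
      if w: "w \<in> pverts G" "w \<noteq> v" for w
    proof -
      have "w = (if w = v then u else w)" using w(2) by simp
      then have "w \<in> pverts (contract_edge G (u, v))" unfolding contract_edge_simps using w(1) by (rule image_eqI)
      moreover have "\<forall>w\<in>pverts (contract_edge G (u, v)). \<exists>d\<in>D'. (w, d) \<in> parcs (contract_edge G (u, v))"
        using D'(1) unfolding total_dominating_set_def by (rule conjunct2)
      ultimately have "\<exists>d\<in>D'. (w, d) \<in> parcs (contract_edge G (u, v))" by (rule bspec[rotated])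
      then obtain d where d: "d \<in> D'" and wd: "(w, d) \<in> parcs (contract_edge G (u, v))" by (rule bexE)
      obtain x y where "w = (if x = v then u else x)" "d = (if y = v then u else y)" "adj G x y" "w \<noteq> d"
        using wd unfolding contract_edge_simps mem_Collect_eq prod.inject by metis
      then show ?thesis using d by (metis (no_types))
    qed
    have nb_out: "\<exists>d\<in>D'. adj G w d \<or> (d = u \<and> adj G w v)" if w: "w \<in> pverts G" "w \<noteq> v" "w \<noteq> u" for w
    proof -
      obtain d x y where d: "d \<in> D'" "adj G x y" "w = (if x = v then u else x)" "d = (if y = v then u else y)"
        using nb[OF w(1,2)] by blast
      have "x = w" using d(3) w(3) by (auto split: if_splits)
      then show ?thesis using d by (intro bexI[of _ d]) (auto split: if_splits)
    qed
    \<comment> \<open>The merged vertex \<open>u\<close> needs a dominator other than itself; this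
      becomes a vertex of the path.\<close>
    obtain d where d: "d \<in> D'" "d \<noteq> u" "adj G u d \<or> adj G v d"
    proof -
      obtain d x y where d: "d \<in> D'" "d \<noteq> u" "adj G x y" "u = (if x = v then u else x)" "d = (if y = v then u else y)"
        using nb[of u] E_V[OF uv] ne by blast
      have "y = d" "x = u \<or> x = v" using d(2,4,5) by (auto split: if_splits)
      then show ?thesis using that d by blast
    qed
    have dv: "d \<noteq> v" using d(1) D'V(2) by auto
    have "\<exists>D. tds D \<and> has_p3 D \<and> card D \<le> card D0"
    proof (cases "u \<in> D'")
      case True
      have "\<exists>x\<in>insert v D'. adj G w x" if w: "w \<in> pverts G" for w
      proof -
        consider "w = u" | "w = v" | "w \<noteq> u" "w \<noteq> v" by blast
        then show ?thesis
        proof cases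
          case 1 then show ?thesis using uv by blast
        next
          case 2 then show ?thesis using sym[OF uv] True by blast
        next
          case 3 then show ?thesis using nb_out[OF w 3(2,1)] by blast
        qed
      qed
      then have "tds (insert v D')" unfolding tds_def using D'V(1) E_V[OF uv] by simp
      moreover have "has_p3 (insert v D')"
        using d(3)
      proof
        assume "adj G u d"
        then show ?thesis by (intro has_p3I[of d _ u v]) (use d(1) True uv dv sym in auto)
      next
        assume "adj G v d"
        then show ?thesis by (intro has_p3I[of d _ v u]) (use d(1,2) True uv sym in auto)
      qed
      moreover have "card (insert v D') \<le> card D0" using D'V(2) finD' D'(2) c0 by simp
      ultimately show ?thesis by blast
    next
      case False
      obtain t where t: "t = u \<or> t = v" "adj G t d" using d(3) by blast
      have tD: "t \<notin> D'" using t(1) False D'V(2) by blast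
      have "\<exists>x\<in>insert t D'. adj G w x" if w: "w \<in> pverts G" for w
      proof -
        consider "w = t" | "w \<noteq> t" "w = u \<or> w = v" | "w \<noteq> u" "w \<noteq> v" by blast
        then show ?thesis
        proof cases
          case 1 then show ?thesis using t(2) d(1) by blast
        next
          case 2 then show ?thesis using t(1) uv sym[OF uv] by blast
        next
          case 3 then show ?thesis using nb_out[OF w 3(2,1)] False by blast
        qed
      qed
      moreover have "t \<in> pverts G" using E_V[OF t(2)] by blast
      ultimately have "tds (insert t D')" unfolding tds_def using D'V(1) by simp
      moreover have "has_p3 (insert t D')"
      proof -
        have "d \<in> pverts G" using d(1) D'V(1) by blast
        then obtain d2 where d2: "d2 \<in> D'" "adj G d d2" using nb_out[OF _ dv d(2)] False by blast
        then have "t \<noteq> d2" using tD by blast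
        then show ?thesis using d2 d(1) t(2) by (intro has_p3I[of t _ d d2]) auto
      qed
      moreover have "card (insert t D') \<le> card D0" using tD finD' D'(2) c0 by simp
      ultimately show ?thesis by blast
    qed
    then obtain D where D: "tds D" "has_p3 D" "card D \<le> card D0" by blast
    show "\<not> no_inst"
    proof
      assume no_inst
      then obtain D2 where "tds D2" "card D2 < card D" using D unfolding no_inst_def by blast
      then show False using D0(2)[of D2] D(3) by simp
    qed
  next
    assume "\<not> no_inst"
    then obtain D where D: "tds D" "has_p3 D" and min: "\<And>D'. tds D' \<Longrightarrow> card D \<le> card D'"
      unfolding no_inst_def by (meson not_le)
    obtain x y z where xyz: "x \<in> D" "y \<in> D" "z \<in> D" "adj G x y" "adj G y z" "x \<noteq> z"
      using D(2) unfolding has_p3_def by blast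
    have ne: "x \<noteq> y" "y \<noteq> z" using xyz(4,5) irr by auto
    have finD: "finite D" using tds_finite[OF D(1)] .
    let ?f = "\<lambda>w. if w = y then x else w"
    have "\<exists>d\<in>D - {y}. (?f w, d) \<in> parcs (contract_edge G (x, y))" if w: "w \<in> pverts G" for w
    proof (cases "w = x \<or> w = y")
      case True
      have "(?f y, ?f z) \<in> parcs (contract_edge G (x, y))"
        unfolding contract_edge_simps mem_Collect_eq prod.inject
        by (intro exI[of _ y] exI[of _ z]) (use xyz(5,6) ne in simp)
      then show ?thesis using True xyz(3) ne by (intro bexI[of _ z]) auto
    next
      case False
      obtain d where d: "d \<in> D" "adj G w d" using D(1) w unfolding tds_def by blast
      have "?f w \<noteq> ?f d" using d(2) irr False by auto
      then have "(?f w, ?f d) \<in> parcs (contract_edge G (x, y))"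
        unfolding contract_edge_simps mem_Collect_eq prod.inject
        by (intro exI[of _ w] exI[of _ d]) (use d(2) in simp)
      moreover have "?f d \<in> D - {y}" using d(1) xyz(1) ne by auto
      ultimately show ?thesis by blast
    qed
    moreover have "D - {y} \<subseteq> ?f ` pverts G"
    proof
      fix w assume w: "w \<in> D - {y}"
      then have "w \<in> pverts G" "w = ?f w" using D(1) unfolding tds_def by auto
      then show "w \<in> ?f ` pverts G" by blast
    qed
    ultimately have "total_dominating_set (contract_edge G (x, y)) (D - {y})"
      unfolding total_dominating_set_def contract_edge_simps(1) by blast
    then have "total_domination_number (contract_edge G (x, y)) \<le> enat (card (D - {y}))"
      by (rule total_domination_number_le)
    also have "card (D - {y}) = card D - 1" using xyz(2) finD by simp
    also have "enat (card D - 1) = enat (card D) - 1" by (simp add: one_enat_def)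
    also have "enat (card D) = total_domination_number G"
    proof (rule antisym)
      show "enat (card D) \<le> total_domination_number G"
        unfolding total_domination_number_def using min tds_eq by (intro INF_greatest) simp
      show "total_domination_number G \<le> enat (card D)" using total_domination_number_le tds_eq D(1) by blast
    qed
    finally show "one_edge_contraction_total_dom G"
      unfolding one_edge_contraction_total_dom_def using xyz(4) by blast
  qed
qed

theorem theorem9:
  fixes k :: nat
  shows "poly_time_solvable_on adjacency_matrix one_edge_contraction_total_dom
    {G. input_graph G \<and>
        induced_free (disjoint_union (path_graph 4) (copies k (path_graph 3))) G}"
proof (rule fo_poly_time[OF fo_not[OF fo_no_inst]])
  fix G :: "nat pair_pre_digraph"
  assume "G \<in> {G. input_graph G \<and>
    induced_free (disjoint_union (path_graph 4) (copies k (path_graph 3))) G}"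
  then have ig: "input_graph G"
    and free: "induced_free (disjoint_union (path_graph 4) (copies k (path_graph 3))) G" by auto
  have pg: "pair_graph G" using ig unfolding input_graph_def by auto
  interpret sgraph "pverts G" "adj G" by (rule pair_graph_sgraph[OF pg])
  have E: "(\<forall>u v. \<not> adj G u v) \<longleftrightarrow> (\<forall>u\<in>pverts G. \<forall>v\<in>pverts G. \<not> adj G u v)" using E_V by blast
  \<comment> \<open>The formula describes the no-instances, so the machine evaluates its
    negation.\<close>
  have "no_inst \<longleftrightarrow> no_inst_formula k G []"
    unfolding no_inst_iff[OF induced_free_p4kp3_free[OF pg free] input_graph_conn[OF ig]] no_inst_formula_def E ..
  then show "input_graph G \<and> (one_edge_contraction_total_dom G \<longleftrightarrow> \<not> no_inst_formula k G [])"
    using ig contractible_iff[OF ig] by simp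
qed

end
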